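(* There is a universal constant $C>0$ such that the following holds for all integers $d\ge1$, $2\le n_1\le n_2$, and all $\alpha\in(0,e^{-1})$, $\beta\in(0,1-\alpha)$. Let $\mathcal{P}^{(d)}_{\rm Multi}$ be the set of pairs of probability distributions on $\{1,\dots,d\}$. Let $\mathcal{P}_0=\{(p_Y,p_Z)\in\mathcal{P}^{(d)}_{\rm Multi}:p_Y=p_Z\}$ and $\mathcal{P}_1=\{(p_Y,p_Z)\in\mathcal{P}^{(d)}_{\rm Multi}:\|p_Y-p_Z\|_1\ge\epsilon_{n_1,n_2}\}$, where $$\epsilon_{n_1,n_2}\ \ge\ \frac{C}{\beta^{3/4}}\sqrt{\log\Big(\frac1\alpha\Big)}\cdot\max\left\{\frac{d^{1/2}}{n_1^{1/2}n_2^{1/4}},\ \frac{d^{1/4}}{n_1^{1/2}}\right\}.$$ Then the sample-splitting permutation test based on $U^{\rm split}_{n_1,n_2}$ satisfies $$\sup_{P\in\mathcal{P}_0}\mathbb{P}_P(U^{\rm split}_{n_1,n_2}>c_{1-\alpha})\le\alpha\quad\text{and}\quad\sup_{P\in\mathcal{P}_1}\mathbb{P}_P(U^{\rm split}_{n_1,n_2}\le c_{1-\alpha})\le\beta .$$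
   Context: Data: $Y_1,\dots,Y_{2n_1}$ i.i.d. from $p_Y$ and, independently, $Z_1,\dots,Z_{2n_2}$ i.i.d. from $p_Z$. Weights: $m:=\min\{n_2,d\}$ and $w_k:=\frac1{2d}+\frac1{2m}\sum_{i=1}^m\mathbb{1}(Z_{n_2+i}=k)$, $k=1,\dots,d$. Statistic: $g_w(x,y):=\sum_{k=1}^dw_k^{-1}\mathbb{1}(x=k)\mathbb{1}(y=k)$, $h(y_1,y_2;z_1,z_2):=g_w(y_1,y_2)+g_w(z_1,z_2)-g_w(y_1,z_2)-g_w(y_2,z_1)$, and $U^{\rm split}_{n_1,n_2}$ is computed from $Y_1,\dots,Y_{n_1}$ and $Z_1,\dots,Z_{n_1}$ only: $$U^{\rm split}_{n_1,n_2}:=\frac{1}{n_1^2(n_1-1)^2}\sum_{1\le i_1\ne i_2\le n_1}\ \sum_{1\le j_1\ne j_2\le n_1}h(Y_{i_1},Y_{i_2};Z_{j_1},Z_{j_2}).$$ Critical value: $c_{1-\alpha}$ is the $1-\alpha$ quantile, $\inf\{t:F(t)\ge1-\alpha\}$, of the distribution function $F$ of the statistic when the $2n_1$ observations $(Y_1,\dots,Y_{n_1},Z_1,\dots,Z_{n_1})$ are permuted by a uniformly random permutation of $2n_1$ positions (first $n_1$ positions forming the first sample, last $n_1$ the second), with the weights $w_k$ held fixed. *)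

theory Defs
  imports "HOL-Probability.Probability" "HOL-Combinatorics.Combinatorics"
begin

text \<open>Samples are functions on 1-based indices. The weights read \<open>z\<close> only at positions
  \<open>n2 + 1, \<dots>, n2 + m\<close>, the statistic only at \<open>1, \<dots>, n1\<close>.\<close>

definition split_weight :: "nat \<Rightarrow> nat \<Rightarrow> (nat \<Rightarrow> nat) \<Rightarrow> nat \<Rightarrow> real" where
  "split_weight d n2 z k =
     (let m = min n2 d
      in 1 / (2 * real d) + 1 / (2 * real m) * (\<Sum>i = 1..m. of_bool (z (n2 + i) = k)))"

definition g_kernel :: "nat \<Rightarrow> (nat \<Rightarrow> real) \<Rightarrow> nat \<Rightarrow> nat \<Rightarrow> real" where
  "g_kernel d w x y = (\<Sum>k = 1..d. inverse (w k) * of_bool (x = k) * of_bool (y = k))"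

definition h_kernel :: "nat \<Rightarrow> (nat \<Rightarrow> real) \<Rightarrow> nat \<Rightarrow> nat \<Rightarrow> nat \<Rightarrow> nat \<Rightarrow> real" where
  "h_kernel d w y1 y2 z1 z2 =
     g_kernel d w y1 y2 + g_kernel d w z1 z2 - g_kernel d w y1 z2 - g_kernel d w y2 z1"

definition U_stat :: "nat \<Rightarrow> nat \<Rightarrow> (nat \<Rightarrow> real) \<Rightarrow> (nat \<Rightarrow> nat) \<Rightarrow> (nat \<Rightarrow> nat) \<Rightarrow> real" where
  "U_stat d n1 w y z =
     1 / ((real n1)\<^sup>2 * (real n1 - 1)\<^sup>2) *
     (\<Sum>i1 = 1..n1. \<Sum>i2 \<in> {1..n1} - {i1}. \<Sum>j1 = 1..n1. \<Sum>j2 \<in> {1..n1} - {j1}.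
        h_kernel d w (y i1) (y i2) (z j1) (z j2))"

definition U_split :: "nat \<Rightarrow> nat \<Rightarrow> nat \<Rightarrow> (nat \<Rightarrow> nat) \<Rightarrow> (nat \<Rightarrow> nat) \<Rightarrow> real" where
  "U_split d n1 n2 y z = U_stat d n1 (split_weight d n2 z) y z"

definition pooled :: "nat \<Rightarrow> (nat \<Rightarrow> nat) \<Rightarrow> (nat \<Rightarrow> nat) \<Rightarrow> nat \<Rightarrow> nat" where
  "pooled n1 y z i = (if i \<le> n1 then y i else z (i - n1))"

text \<open>The weights stay those of the original \<open>z\<close>; only the pooled \<open>2 * n1\<close> observations are permuted.\<close>

definition U_perm ::
  "nat \<Rightarrow> nat \<Rightarrow> nat \<Rightarrow> (nat \<Rightarrow> nat) \<Rightarrow> (nat \<Rightarrow> nat) \<Rightarrow> (nat \<Rightarrow> nat) \<Rightarrow> real" where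
  "U_perm d n1 n2 y z \<pi> =
     U_stat d n1 (split_weight d n2 z)
       (\<lambda>i. pooled n1 y z (\<pi> i)) (\<lambda>j. pooled n1 y z (\<pi> (n1 + j)))"

definition perm_dist :: "nat \<Rightarrow> nat \<Rightarrow> nat \<Rightarrow> (nat \<Rightarrow> nat) \<Rightarrow> (nat \<Rightarrow> nat) \<Rightarrow> real pmf" where
  "perm_dist d n1 n2 y z =
     map_pmf (U_perm d n1 n2 y z) (pmf_of_set {\<pi>. \<pi> permutes {1..2 * n1}})"

definition crit_value ::
  "nat \<Rightarrow> nat \<Rightarrow> nat \<Rightarrow> real \<Rightarrow> (nat \<Rightarrow> nat) \<Rightarrow> (nat \<Rightarrow> nat) \<Rightarrow> real" where
  "crit_value d n1 n2 \<alpha> y z =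
     Inf {t. cdf (measure_pmf (perm_dist d n1 n2 y z)) t \<ge> 1 - \<alpha>}"

definition P_Multi :: "nat \<Rightarrow> (nat pmf \<times> nat pmf) set" where
  "P_Multi d = {(pY, pZ). set_pmf pY \<subseteq> {1..d} \<and> set_pmf pZ \<subseteq> {1..d}}"

definition l1_dist :: "nat \<Rightarrow> nat pmf \<Rightarrow> nat pmf \<Rightarrow> real" where
  "l1_dist d pY pZ = (\<Sum>k = 1..d. \<bar>pmf pY k - pmf pZ k\<bar>)"

definition P_null :: "nat \<Rightarrow> (nat pmf \<times> nat pmf) set" where
  "P_null d = {(pY, pZ) \<in> P_Multi d. pY = pZ}"

definition P_alt :: "nat \<Rightarrow> real \<Rightarrow> (nat pmf \<times> nat pmf) set" where
  "P_alt d \<epsilon> = {(pY, pZ) \<in> P_Multi d. l1_dist d pY pZ \<ge> \<epsilon>}"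

text \<open>Joint law of the two independent i.i.d. samples; outside the index ranges the sample
  functions take the dummy value \<open>0\<close>, which is never read by the statistics above.\<close>

definition data_pmf ::
  "nat \<Rightarrow> nat \<Rightarrow> nat pmf \<times> nat pmf \<Rightarrow> ((nat \<Rightarrow> nat) \<times> (nat \<Rightarrow> nat)) pmf" where
  "data_pmf n1 n2 P =
     pair_pmf (Pi_pmf {1..2 * n1} 0 (\<lambda>_. fst P)) (Pi_pmf {1..2 * n2} 0 (\<lambda>_. snd P))"

end

(* A quadratic Rademacher chaos is hypercontractive: by the two-point inequality, its moment of
   order 2p is at most ((2p - 1)^2 times its variance)^p. The statistic at a uniformly permuted
   sample is an average of statistics that pair position i with position n + i; exchanging the
   members of random pairs turns such a paired statistic into a chaos, so Markov's inequality with
   p ~ ln(1/alpha)/2 bounds the permutation quantile by a multiple of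
   ln(1/alpha) sqrt(G) / (n (n - 1)), where G is the sum of the squared kernel over distinct pairs.

   Given the weights, the statistic has mean delta = sum_k (p_Y(k) - p_Z(k))^2 / w_k, which is at
   least the squared l1 distance by Cauchy-Schwarz, as the weights sum to one. Its variance is
   bounded by the Efron-Stein inequality, and E G is at most 4 n^2 sum_k w_k^-2 (p_Y(k)^2 + p_Z(k)^2);
   Chebyshev and Markov give the conditional type II error. Finally the weights are averaged out
   with E sum_k w_k^-2 p_Z(k)^2 <= 4 d^2 / min(n2, d). The level under the null is exchangeability. *)

theory Submission
  imports Defs
begin

section \<open>Hypercontractivity for Rademacher chaos of order two\<close>

text \<open>A second-moment bound on the permuted statistic would put a power of
  \<open>1/\<alpha>\<close> into the radius; the factor \<open>sqrt (ln (1/\<alpha>))\<close> is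
  what forces moments whose order grows as \<open>\<alpha>\<close> shrinks. The coordinates of a
  uniform permutation are dependent, and the exchanges within pairs are the device that produces
  independent signs. Splitting makes the weights independent of the pooled sample, so the kernel can
  be treated as fixed until the last step.

  The conditional error is governed by the square mass over n1^2 times the squared mean, and the
  mean is at least the squared l1 distance. Hence the fourth roots in the radius: d^2 / (min(n2, d)
  n1^2) is the fourth power of the maximum in the theorem. The weights are adapted to p_Z only, so
  p_Y has to be traded for p_Z at the price of a term proportional to the mean.

  Sums over subsets and over permutations stand for expectations, and the norm inequalities are
  stated for powers, with no roots taken.\<close>

lemma binomial_double_le:
  assumes "k \<le> p"
  shows "real ((2 * p) choose (2 * k)) \<le> real (p choose k) * (2 * real p - 1) ^ k"
  using assms
proof (induction k)
  case 0
  then show ?case by simp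
next
  case (Suc k)
  have IH: "real ((2 * p) choose (2 * k)) \<le> real (p choose k) * (2 * real p - 1) ^ k"
    using Suc by simp
  have absorb: "real (m choose Suc j) * (real j + 1) = real (m choose j) * (real m - real j)"
    if "j \<le> m" for m j :: nat
  proof -
    have "Suc j * (m choose Suc j) = (m - j) * (m choose j)"
      by (metis binomial_absorb_comp binomial_absorption mult.commute)
    then have "real (Suc j * (m choose Suc j)) = real ((m - j) * (m choose j))" by simp
    then show ?thesis using that by (simp add: of_nat_diff algebra_simps)
  qed
  have kp: "real k + 1 \<le> real p" using Suc.prems by linarith
  have e1: "real (2 * p choose Suc (2 * k)) * (2 * real k + 1)
      = real (2 * p choose (2 * k)) * (2 * real p - 2 * real k)"
    using absorb[of "2 * k" "2 * p"] Suc.prems by simp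
  have e2: "real (2 * p choose Suc (Suc (2 * k))) * (2 * real k + 2)
      = real (2 * p choose Suc (2 * k)) * (2 * real p - 2 * real k - 1)"
    using absorb[of "Suc (2 * k)" "2 * p"] Suc.prems by (simp add: algebra_simps)
  have e3: "real (p choose Suc k) * (real k + 1) = real (p choose k) * (real p - real k)"
    using absorb[of k p] Suc.prems by simp
  \<comment> \<open>Passing from k to k+1 multiplies the left side by
    (2p-2k)(2p-2k-1)/((2k+2)(2k+1)) and \<open>p choose k\<close> by (p-k)/(k+1). The quotient of
    these factors is (2p-2k-1)/(2k+1), which is at most 2p-1.\<close>
  have "real (2 * p choose Suc (Suc (2 * k))) * ((2 * real k + 2) * (2 * real k + 1))
      = real (2 * p choose Suc (2 * k)) * (2 * real k + 1) * (2 * real p - 2 * real k - 1)"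
    by (simp only: mult.assoc[symmetric] e2) (simp only: mult_ac)
  also have "\<dots> = real (2 * p choose (2 * k)) * ((2 * real p - 2 * real k) * (2 * real p - 2 * real k - 1))"
    by (simp only: e1 mult.assoc)
  also have "\<dots> \<le> real (2 * p choose (2 * k)) * ((2 * real p - 2 * real k) * ((2 * real p - 1) * (2 * real k + 1)))"
  proof -
    have "2 * real p - 2 * real k - 1 \<le> (2 * real p - 1) * (2 * real k + 1)"
    proof -
      have "(2 * real p - 1) * (2 * real k + 1) = 2 * real k * (2 * real p - 1) + (2 * real p - 1)"
        by (simp only: distrib_left mult_1_right) (simp only: mult_ac)
      moreover have "0 \<le> 2 * real k * (2 * real p - 1)"
        using kp by (intro mult_nonneg_nonneg) auto
      ultimately show ?thesis by linarith
    qed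
    then show ?thesis using kp by (intro mult_left_mono) auto
  qed
  also have "\<dots> \<le> (real (p choose k) * (2 * real p - 1) ^ k) *
      ((2 * real p - 2 * real k) * ((2 * real p - 1) * (2 * real k + 1)))"
    using IH kp by (intro mult_right_mono) auto
  also have "\<dots> = (real (p choose k) * (real p - real k)) * (2 * real p - 1) ^ Suc k * (2 * (2 * real k + 1))"
  proof -
    have "c * q * ((2 * x - 2 * y) * (u * v)) = (c * (x - y)) * (u * q) * (2 * v)"
      for c q x y u v :: real by (simp add: algebra_simps)
    then show ?thesis by (simp only: power_Suc)
  qed
  also have "\<dots> = (real (p choose Suc k) * (2 * real p - 1) ^ Suc k) * ((2 * real k + 2) * (2 * real k + 1))"
  proof -
    have "c * (y + 1) * q * (2 * v) = (c * q) * ((2 * y + 2) * v)"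
      for c q y v :: real by (simp add: algebra_simps)
    then show ?thesis by (simp only: e3[symmetric])
  qed
  finally have "real (2 * p choose Suc (Suc (2 * k))) \<le> real (p choose Suc k) * (2 * real p - 1) ^ Suc k"
    by (rule mult_right_le_imp_le) (simp add: add_pos_nonneg)
  then show ?case by simp
qed

text \<open>Up to the factor 2 the left side is the moment of order 2p of s + t*eps for a random
  sign eps. Odd powers of t cancel, and the even ones are compared term by term with the binomial
  expansion of the right side.\<close>

lemma two_point_inequality:
  fixes s t :: real
  shows "(s + t) ^ (2 * p) + (s - t) ^ (2 * p) \<le> 2 * (s\<^sup>2 + (2 * real p - 1) * t\<^sup>2) ^ p"
proof -
  let ?b = "\<lambda>k. real ((2 * p) choose k) * t ^ k * s ^ (2 * p - k)"
  have "(s + t) ^ (2 * p) + (s - t) ^ (2 * p)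
      = (\<Sum>k\<le>2 * p. ?b k) + (\<Sum>k\<le>2 * p. (- 1) ^ k * ?b k)"
    using binomial_ring[of t s "2 * p"] binomial_ring[of "- t" s "2 * p"]
    by (simp add: add.commute power_minus[of t] mult.assoc mult.left_commute)
  also have "\<dots> = (\<Sum>k\<le>2 * p. (1 + (- 1) ^ k) * ?b k)"
    by (simp add: sum.distrib[symmetric] algebra_simps)
  also have "\<dots> = (\<Sum>k\<in>(\<lambda>j. 2 * j) ` {..p}. (1 + (- 1) ^ k) * ?b k)"
  proof (rule sum.mono_neutral_right)
    show "\<forall>i\<in>{..2 * p} - (\<lambda>j. 2 * j) ` {..p}. (1 + (- 1) ^ i) * ?b i = 0"
    proof
      fix i assume i: "i \<in> {..2 * p} - (\<lambda>j. 2 * j) ` {..p}"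
      then have "odd i" by (auto elim!: evenE)
      then show "(1 + (- 1) ^ i) * ?b i = 0" by simp
    qed
  qed auto
  also have "\<dots> = (\<Sum>j\<le>p. 2 * ?b (2 * j))"
    by (subst sum.reindex) (auto simp: inj_on_def)
  also have "\<dots> \<le> (\<Sum>j\<le>p. 2 * (real (p choose j) * ((2 * real p - 1) * t\<^sup>2) ^ j * (s\<^sup>2) ^ (p - j)))"
  proof (rule sum_mono)
    fix j assume j: "j \<in> {..p}"
    have "s ^ (2 * p - 2 * j) = (s\<^sup>2) ^ (p - j)"
      by (metis power_mult right_diff_distrib')
    then have "2 * ?b (2 * j) = 2 * (real ((2 * p) choose (2 * j)) * ((t\<^sup>2) ^ j * (s\<^sup>2) ^ (p - j)))"
      by (simp add: power_mult mult.assoc)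
    also have "\<dots> \<le> 2 * ((real (p choose j) * (2 * real p - 1) ^ j) * ((t\<^sup>2) ^ j * (s\<^sup>2) ^ (p - j)))"
      using binomial_double_le[of j p] j by (intro mult_left_mono mult_right_mono) auto
    finally show "2 * ?b (2 * j) \<le>
        2 * (real (p choose j) * ((2 * real p - 1) * t\<^sup>2) ^ j * (s\<^sup>2) ^ (p - j))"
      by (simp add: power_mult_distrib mult.assoc)
  qed
  also have "\<dots> = 2 * (s\<^sup>2 + (2 * real p - 1) * t\<^sup>2) ^ p"
    by (subst add.commute, subst binomial_ring) (simp add: sum_distrib_left)
  finally show ?thesis .
qed

text \<open>Convexity of the p-th power at the points x/a and y/b with weights a/(a+b) and b/(a+b),
  whose weighted mean is (x+y)/(a+b). This is the pointwise step of Minkowski's inequality.\<close>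

lemma power_add_le_convex:
  fixes x y a b :: real
  assumes "0 \<le> x" "0 \<le> y" "0 < a" "0 < b" "1 \<le> p"
  shows "(x + y) ^ p \<le> (a + b) ^ p * (a / (a + b) * (x / a) ^ p + b / (a + b) * (y / b) ^ p)"
proof -
  have cvx: "convex_on {0..} (\<lambda>z::real. z ^ p)"
  proof (rule convex_on_realI[where f' = "\<lambda>z. real p * z ^ (p - 1)"])
    show "((\<lambda>z. z ^ p) has_real_derivative real p * z ^ (p - 1)) (at z)" for z :: real
      by (auto intro!: derivative_eq_intros)
  qed (auto intro!: mult_left_mono power_mono)
  have "((1 - b / (a + b)) *\<^sub>R (x / a) + (b / (a + b)) *\<^sub>R (y / b)) ^ p
      \<le> (1 - b / (a + b)) * (x / a) ^ p + b / (a + b) * (y / b) ^ p"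
    using assms by (intro convex_onD[OF cvx]) (auto simp: divide_le_eq)
  moreover have "1 - b / (a + b) = a / (a + b)" using assms by (simp add: field_simps)
  moreover have "(a / (a + b)) *\<^sub>R (x / a) + (b / (a + b)) *\<^sub>R (y / b) = (x + y) / (a + b)"
    using assms by (simp add: add_divide_distrib)
  ultimately have "((x + y) / (a + b)) ^ p \<le> a / (a + b) * (x / a) ^ p + b / (a + b) * (y / b) ^ p"
    by simp
  then have "(a + b) ^ p * ((x + y) / (a + b)) ^ p
      \<le> (a + b) ^ p * (a / (a + b) * (x / a) ^ p + b / (a + b) * (y / b) ^ p)"
    using assms by (intro mult_left_mono) auto
  then show ?thesis using assms by (simp add: power_divide)
qed

text \<open>Minkowski's inequality with no root taken: a and b play the role of the p-norms of X and
  Y, relative to a total mass W. The cases a = 0 and b = 0 are separate because the convexity step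
  divides by a and b.\<close>

lemma sum_power_add_le:
  fixes X Y :: "'a \<Rightarrow> real"
  assumes fin: "finite I" and X: "\<And>i. i \<in> I \<Longrightarrow> 0 \<le> X i" and Y: "\<And>i. i \<in> I \<Longrightarrow> 0 \<le> Y i"
    and ab: "0 \<le> a" "0 \<le> b" and p: "1 \<le> p"
    and bX: "(\<Sum>i\<in>I. X i ^ p) \<le> W * a ^ p" and bY: "(\<Sum>i\<in>I. Y i ^ p) \<le> W * b ^ p"
  shows "(\<Sum>i\<in>I. (X i + Y i) ^ p) \<le> W * (a + b) ^ p"
proof -
  have vanish: "\<And>i. i \<in> I \<Longrightarrow> Z i = 0"
    if "\<And>i. i \<in> I \<Longrightarrow> 0 \<le> Z i" "(\<Sum>i\<in>I. Z i ^ p) \<le> 0" for Z :: "'a \<Rightarrow> real"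
  proof -
    fix i assume "i \<in> I"
    have "(\<Sum>i\<in>I. Z i ^ p) = 0" using that by (intro antisym sum_nonneg) auto
    then have "Z i ^ p = 0"
      using that fin \<open>i \<in> I\<close> by (subst (asm) sum_nonneg_eq_0_iff) auto
    then show "Z i = 0" by simp
  qed
  consider "a = 0" | "b = 0" | "0 < a" "0 < b" using ab by linarith
  then show ?thesis
  proof cases
    case 1
    then have "X i = 0" if "i \<in> I" for i using vanish[of X] X bX p that by (simp add: power_0_left)
    then show ?thesis using 1 bY by simp
  next
    case 2
    then have "Y i = 0" if "i \<in> I" for i using vanish[of Y] Y bY p that by (simp add: power_0_left)
    then show ?thesis using 2 bX by simp
  next
    case 3
    have "(\<Sum>i\<in>I. (X i + Y i) ^ p)
        \<le> (\<Sum>i\<in>I. (a + b) ^ p * (a / (a + b) * (X i / a) ^ p + b / (a + b) * (Y i / b) ^ p))"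
      using X Y 3 p by (intro sum_mono power_add_le_convex) auto
    also have "\<dots> = (a + b) ^ p * (a / (a + b) * ((\<Sum>i\<in>I. X i ^ p) / a ^ p)
        + b / (a + b) * ((\<Sum>i\<in>I. Y i ^ p) / b ^ p))"
      by (simp add: sum_distrib_left[symmetric] sum.distrib sum_divide_distrib[symmetric] power_divide)
    also have "\<dots> \<le> (a + b) ^ p * (a / (a + b) * W + b / (a + b) * W)"
      using 3 bX bY by (intro mult_left_mono add_mono) (auto simp: divide_le_eq)
    also have "\<dots> = W * (a + b) ^ p"
    proof -
      have "a / (a + b) + b / (a + b) = 1" using 3 by (simp add: add_divide_distrib[symmetric])
      then have "a / (a + b) * W + b / (a + b) * W = W" by (metis distrib_right mult_1)
      then show ?thesis by simp
    qed
    finally show ?thesis .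
  qed
qed

text \<open>A sign vector is encoded by the set S of its negative coordinates, so a sum over
  \<open>Pow A\<close> is \<open>2 ^ card A\<close> times an expectation over independent
  signs.\<close>

definition rad :: "'a set \<Rightarrow> 'a \<Rightarrow> real" where
  "rad S i = (if i \<in> S then - 1 else 1)"

lemma sum_Pow_insert:
  assumes "finite A" "a \<notin> A"
  shows "(\<Sum>S\<in>Pow (insert a A). f S) = (\<Sum>S\<in>Pow A. f S + f (insert a S))"
proof -
  have inj: "inj_on (insert a) (Pow A)"
    using assms by (intro inj_onI) (metis Diff_insert_absorb PowD subset_iff)
  have "(\<Sum>S\<in>Pow (insert a A). f S) = (\<Sum>S\<in>Pow A. f S) + (\<Sum>S\<in>insert a ` Pow A. f S)"
    unfolding Pow_insert using assms by (intro sum.union_disjoint) auto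
  also have "(\<Sum>S\<in>insert a ` Pow A. f S) = (\<Sum>S\<in>Pow A. f (insert a S))"
    by (subst sum.reindex[OF inj]) simp
  finally show ?thesis by (simp add: sum.distrib)
qed

text \<open>The induction step for a chaos. Given the earlier signs, the new sign yields
  \<open>f0 + f1\<close> or \<open>f0 - f1\<close>; the two-point inequality removes it, and
  Minkowski's inequality adds the squared norms u and (2p-1) v.\<close>

lemma sum_two_point_le:
  fixes f0 f1 :: "'a \<Rightarrow> real"
  assumes "finite I" "1 \<le> p" "0 \<le> u" "0 \<le> v"
    and "(\<Sum>i\<in>I. f0 i ^ (2 * p)) \<le> W * u ^ p" "(\<Sum>i\<in>I. f1 i ^ (2 * p)) \<le> W * v ^ p"
  shows "(\<Sum>i\<in>I. (f0 i + f1 i) ^ (2 * p) + (f0 i - f1 i) ^ (2 * p))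
      \<le> 2 * W * (u + (2 * real p - 1) * v) ^ p"
proof -
  have c: "0 \<le> 2 * real p - 1" using assms(2) by linarith
  have "(\<Sum>i\<in>I. (f0 i + f1 i) ^ (2 * p) + (f0 i - f1 i) ^ (2 * p))
      \<le> (\<Sum>i\<in>I. 2 * ((f0 i)\<^sup>2 + (2 * real p - 1) * (f1 i)\<^sup>2) ^ p)"
    by (intro sum_mono two_point_inequality)
  also have "\<dots> = 2 * (\<Sum>i\<in>I. ((f0 i)\<^sup>2 + (2 * real p - 1) * (f1 i)\<^sup>2) ^ p)"
    by (simp add: sum_distrib_left)
  also have "(\<Sum>i\<in>I. ((f0 i)\<^sup>2 + (2 * real p - 1) * (f1 i)\<^sup>2) ^ p)
      \<le> W * (u + (2 * real p - 1) * v) ^ p"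
  proof (rule sum_power_add_le)
    have "(\<Sum>i\<in>I. ((2 * real p - 1) * (f1 i)\<^sup>2) ^ p) = (2 * real p - 1) ^ p * (\<Sum>i\<in>I. f1 i ^ (2 * p))"
      by (simp add: power_mult_distrib sum_distrib_left power_mult)
    also have "\<dots> \<le> (2 * real p - 1) ^ p * (W * v ^ p)"
      using c assms by (intro mult_left_mono) auto
    finally show "(\<Sum>i\<in>I. ((2 * real p - 1) * (f1 i)\<^sup>2) ^ p) \<le> W * ((2 * real p - 1) * v) ^ p"
      by (simp add: power_mult_distrib mult_ac)
    show "(\<Sum>i\<in>I. ((f0 i)\<^sup>2) ^ p) \<le> W * u ^ p"
      using assms by (simp add: power_mult)
  qed (use assms c in auto)
  finally show ?thesis by simp
qed

text \<open>Khintchine's inequality for even moments. When a is adjoined, the part multiplied by the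
  new sign is the constant \<open>c a\<close>.\<close>

lemma linear_chaos_moment:
  assumes "finite A" "1 \<le> p"
  shows "(\<Sum>S\<in>Pow A. (\<Sum>i\<in>A. c i * rad S i) ^ (2 * p))
      \<le> 2 ^ card A * ((2 * real p - 1) * (\<Sum>i\<in>A. (c i)\<^sup>2)) ^ p"
  using assms(1)
proof (induction A rule: finite_induct)
  case empty
  then show ?case using assms by (simp add: power_0_left)
next
  case (insert a A)
  have r: "(\<Sum>i\<in>insert a A. c i * rad S i) = (\<Sum>i\<in>A. c i * rad S i) + c a"
    "(\<Sum>i\<in>insert a A. c i * rad (insert a S) i) = (\<Sum>i\<in>A. c i * rad S i) - c a"
    if "S \<in> Pow A" for S
  proof -
    have "(\<Sum>i\<in>A. c i * rad (insert a S) i) = (\<Sum>i\<in>A. c i * rad S i)"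
      using insert.hyps by (intro sum.cong) (auto simp: rad_def)
    then show "(\<Sum>i\<in>insert a A. c i * rad S i) = (\<Sum>i\<in>A. c i * rad S i) + c a"
      "(\<Sum>i\<in>insert a A. c i * rad (insert a S) i) = (\<Sum>i\<in>A. c i * rad S i) - c a"
      using insert.hyps that by (auto simp: rad_def)
  qed
  have "(\<Sum>S\<in>Pow (insert a A). (\<Sum>i\<in>insert a A. c i * rad S i) ^ (2 * p))
      = (\<Sum>S\<in>Pow A. ((\<Sum>i\<in>A. c i * rad S i) + c a) ^ (2 * p) + ((\<Sum>i\<in>A. c i * rad S i) - c a) ^ (2 * p))"
    unfolding sum_Pow_insert[OF insert.hyps] by (intro sum.cong refl) (simp only: r)
  also have "\<dots> \<le> 2 * 2 ^ card A * ((2 * real p - 1) * (\<Sum>i\<in>A. (c i)\<^sup>2) + (2 * real p - 1) * (c a)\<^sup>2) ^ p"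
    using insert assms
    by (intro sum_two_point_le) (auto simp: card_Pow power_mult intro!: mult_nonneg_nonneg sum_nonneg)
  also have "\<dots> = 2 ^ card (insert a A) * ((2 * real p - 1) * (\<Sum>i\<in>insert a A. (c i)\<^sup>2)) ^ p"
    using insert.hyps by (simp add: algebra_simps)
  finally show ?case .
qed

lemma sum_offdiag_insert:
  fixes g :: "'a \<Rightarrow> 'a \<Rightarrow> real"
  assumes "finite A" "a \<notin> A"
  shows "(\<Sum>i\<in>insert a A. \<Sum>j\<in>insert a A - {i}. g i j)
    = (\<Sum>i\<in>A. \<Sum>j\<in>A - {i}. g i j) + (\<Sum>j\<in>A. g a j + g j a)"
proof -
  have "(\<Sum>j\<in>insert a A - {i}. g i j) = g i a + (\<Sum>j\<in>A - {i}. g i j)" if "i \<in> A" for i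
  proof -
    have "insert a A - {i} = insert a (A - {i})" using assms that by auto
    then show ?thesis using assms by simp
  qed
  then have "(\<Sum>i\<in>A. \<Sum>j\<in>insert a A - {i}. g i j) = (\<Sum>i\<in>A. g i a + (\<Sum>j\<in>A - {i}. g i j))"
    by (intro sum.cong) auto
  moreover have "insert a A - {a} = A" using assms by auto
  ultimately show ?thesis using assms by (simp add: sum.distrib)
qed

text \<open>The part multiplied by the sign of a new index a is the linear form with coefficients
  \<open>c a j + c j a\<close>. Its moment bound costs one factor 2p-1 and the two-point inequality
  another, hence the square. The factor 2 comes from (x+y)^2 <= 2(x^2+y^2) applied to these
  coefficients.\<close>

lemma quadratic_chaos_moment:
  assumes "finite A" "1 \<le> p"
  shows "(\<Sum>S\<in>Pow A. (\<Sum>i\<in>A. \<Sum>j\<in>A - {i}. c i j * rad S i * rad S j) ^ (2 * p))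
      \<le> 2 ^ card A * ((2 * real p - 1)\<^sup>2 * (2 * (\<Sum>i\<in>A. \<Sum>j\<in>A - {i}. (c i j)\<^sup>2))) ^ p"
  using assms(1)
proof (induction A rule: finite_induct)
  case empty
  then show ?case using assms by (simp add: power_0_left)
next
  case (insert a A)
  let ?Q = "\<lambda>S. \<Sum>i\<in>A. \<Sum>j\<in>A - {i}. c i j * rad S i * rad S j"
  let ?l = "\<lambda>S. \<Sum>j\<in>A. (c a j + c j a) * rad S j"
  note split = sum_offdiag_insert[OF insert.hyps]
  have same: "rad (insert a S) i = rad S i" if "i \<in> A" for S i
    using insert.hyps that by (auto simp: rad_def)
  have r: "(\<Sum>i\<in>insert a A. \<Sum>j\<in>insert a A - {i}. c i j * rad S i * rad S j) = ?Q S + ?l S"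
    "(\<Sum>i\<in>insert a A. \<Sum>j\<in>insert a A - {i}. c i j * rad (insert a S) i * rad (insert a S) j) = ?Q S - ?l S"
    if "S \<in> Pow A" for S
  proof -
    have "rad S a = 1" "rad (insert a S) a = -1"
      using that insert.hyps by (auto simp: rad_def)
    moreover have "(\<Sum>i\<in>A. \<Sum>j\<in>A - {i}. c i j * rad (insert a S) i * rad (insert a S) j) = ?Q S"
      by (intro sum.cong refl) (simp add: same)
    moreover have "(\<Sum>j\<in>A. c a j * rad (insert a S) a * rad (insert a S) j
        + c j a * rad (insert a S) j * rad (insert a S) a) = - ?l S"
      unfolding sum_negf[symmetric] calculation(2)
      by (intro sum.cong refl) (simp add: same algebra_simps)
    moreover have "(\<Sum>j\<in>A. c a j * rad S a * rad S j + c j a * rad S j * rad S a) = ?l S"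
      unfolding calculation(1) by (intro sum.cong refl) (simp add: algebra_simps)
    ultimately show "(\<Sum>i\<in>insert a A. \<Sum>j\<in>insert a A - {i}. c i j * rad S i * rad S j) = ?Q S + ?l S"
      "(\<Sum>i\<in>insert a A. \<Sum>j\<in>insert a A - {i}. c i j * rad (insert a S) i * rad (insert a S) j) = ?Q S - ?l S"
      unfolding split by simp_all
  qed
  have c: "0 \<le> 2 * real p - 1" using assms(2) by linarith
  have "(\<Sum>S\<in>Pow (insert a A). (\<Sum>i\<in>insert a A. \<Sum>j\<in>insert a A - {i}. c i j * rad S i * rad S j) ^ (2 * p))
      = (\<Sum>S\<in>Pow A. (?Q S + ?l S) ^ (2 * p) + (?Q S - ?l S) ^ (2 * p))"
    unfolding sum_Pow_insert[OF insert.hyps] by (intro sum.cong refl) (simp only: r)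
  also have "\<dots> \<le> 2 * 2 ^ card A * ((2 * real p - 1)\<^sup>2 * (2 * (\<Sum>i\<in>A. \<Sum>j\<in>A - {i}. (c i j)\<^sup>2))
      + (2 * real p - 1) * ((2 * real p - 1) * (\<Sum>j\<in>A. (c a j + c j a)\<^sup>2))) ^ p"
    using insert assms c
    by (intro sum_two_point_le linear_chaos_moment) (auto intro!: mult_nonneg_nonneg sum_nonneg)
  also have "\<dots> \<le> 2 * 2 ^ card A * ((2 * real p - 1)\<^sup>2 * (2 * (\<Sum>i\<in>A. \<Sum>j\<in>A - {i}. (c i j)\<^sup>2))
      + (2 * real p - 1) * ((2 * real p - 1) * (\<Sum>j\<in>A. 2 * ((c a j)\<^sup>2 + (c j a)\<^sup>2)))) ^ p"
  proof -
    have "(x + y)\<^sup>2 \<le> 2 * (x\<^sup>2 + y\<^sup>2)" for x y :: real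
      using sum_squares_bound[of x y] by (simp add: power2_sum)
    then show ?thesis using c
      by (intro mult_left_mono power_mono add_left_mono sum_mono add_nonneg_nonneg)
        (auto intro!: mult_nonneg_nonneg sum_nonneg)
  qed
  also have "\<dots> = 2 ^ card (insert a A) * ((2 * real p - 1)\<^sup>2
      * (2 * (\<Sum>i\<in>insert a A. \<Sum>j\<in>insert a A - {i}. (c i j)\<^sup>2))) ^ p"
  proof -
    have "u\<^sup>2 * (2 * x) + u * (u * (2 * y)) = u\<^sup>2 * (2 * (x + y))" for u x y :: real
      by (simp add: power2_eq_square algebra_simps)
    then show ?thesis
      unfolding split using insert.hyps
      by (simp only: sum_distrib_left[symmetric] card_insert_disjoint power_Suc) simp
  qed
  finally show ?case .
qed

section \<open>Moments of the permuted statistic\<close>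

text \<open>The statistic as a function of the pooled sample, positions 1..n being the first sample
  and n+1..2n the second. Kernel and value type are left open so that the same expression, with
  multiplication as kernel, also describes its mean.\<close>

definition two_sample :: "nat \<Rightarrow> ('b \<Rightarrow> 'b \<Rightarrow> real) \<Rightarrow> (nat \<Rightarrow> 'b) \<Rightarrow> real" where
  "two_sample n g x =
     ((\<Sum>i\<in>{1..n}. \<Sum>j\<in>{1..n} - {i}. g (x i) (x j))
      + (\<Sum>i\<in>{n+1..2*n}. \<Sum>j\<in>{n+1..2*n} - {i}. g (x i) (x j))) / (real n * (real n - 1))
     - 2 * (\<Sum>i\<in>{1..n}. \<Sum>j\<in>{n+1..2*n}. g (x i) (x j)) / (real n)\<^sup>2"

definition pair_kernel :: "nat \<Rightarrow> ('b \<Rightarrow> 'b \<Rightarrow> real) \<Rightarrow> (nat \<Rightarrow> 'b) \<Rightarrow> nat \<Rightarrow> nat \<Rightarrow> real" where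
  "pair_kernel n g x i j =
     g (x i) (x j) + g (x (n + i)) (x (n + j)) - g (x i) (x (n + j)) - g (x (n + i)) (x j)"

definition paired_stat :: "nat \<Rightarrow> ('b \<Rightarrow> 'b \<Rightarrow> real) \<Rightarrow> (nat \<Rightarrow> 'b) \<Rightarrow> real" where
  "paired_stat n g x = (\<Sum>i\<in>{1..n}. \<Sum>j\<in>{1..n} - {i}. pair_kernel n g x i j) / (real n * (real n - 1))"

definition kernel_energy :: "nat \<Rightarrow> ('b \<Rightarrow> 'b \<Rightarrow> real) \<Rightarrow> (nat \<Rightarrow> 'b) \<Rightarrow> real" where
  "kernel_energy n g x = (\<Sum>i\<in>{1..2*n}. \<Sum>j\<in>{1..2*n} - {i}. (g (x i) (x j))\<^sup>2)"

definition swap_pairs :: "nat \<Rightarrow> nat set \<Rightarrow> nat \<Rightarrow> nat" where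
  "swap_pairs n S k = (if k \<in> S then n + k else if n < k \<and> k - n \<in> S then k - n else k)"

section \<open>Off-diagonal sums and averages over permutations\<close>

lemma sum_offdiag:
  fixes f :: "'a \<Rightarrow> 'a \<Rightarrow> real"
  assumes "finite S"
  shows "(\<Sum>a\<in>S. \<Sum>b\<in>S - {a}. f a b) = (\<Sum>a\<in>S. \<Sum>b\<in>S. f a b) - (\<Sum>a\<in>S. f a a)"
  using assms by (simp add: sum_diff1 sum_subtractf)

lemma sum_permute:
  fixes f :: "'a \<Rightarrow> real"
  assumes "\<pi> permutes S"
  shows "(\<Sum>a\<in>S. f (\<pi> a)) = (\<Sum>a\<in>S. f a)"
  using sum.permute[OF assms, of f] by (simp add: comp_def)

lemma sum_offdiag_permute:
  fixes f :: "'a \<Rightarrow> 'a \<Rightarrow> real"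
  assumes "\<pi> permutes S" "finite S"
  shows "(\<Sum>a\<in>S. \<Sum>b\<in>S - {a}. f (\<pi> a) (\<pi> b)) = (\<Sum>a\<in>S. \<Sum>b\<in>S - {a}. f a b)"
proof -
  have "(\<Sum>a\<in>S. \<Sum>b\<in>S. f (\<pi> a) (\<pi> b)) = (\<Sum>a\<in>S. \<Sum>b\<in>S. f (\<pi> a) b)"
    by (intro sum.cong refl sum_permute[OF assms(1)])
  also have "\<dots> = (\<Sum>a\<in>S. \<Sum>b\<in>S. f a b)"
    by (rule sum_permute[OF assms(1), of "\<lambda>a. \<Sum>b\<in>S. f a b"])
  finally show ?thesis
    using sum_permute[OF assms(1), of "\<lambda>a. f a a"] by (simp add: sum_offdiag assms(2))
qed

text \<open>A uniform permutation sends b to a uniform point of S. Composing with a transposition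
  shows that the sum does not depend on b, and summed over all b each permutation contributes the
  full sum of f.\<close>

lemma sum_permutations_apply:
  fixes f :: "'a \<Rightarrow> real"
  assumes "finite S" "b \<in> S"
  shows "(\<Sum>L | L permutes S. f (L b)) = fact (card S) / real (card S) * (\<Sum>a\<in>S. f a)"
proof -
  have eq: "(\<Sum>L | L permutes S. f (L c)) = (\<Sum>L | L permutes S. f (L b))" if "c \<in> S" for c
  proof -
    have "Transposition.transpose b c permutes S" using that assms(2) by (intro permutes_swap_id)
    from sum_permutations_compose_right[OF this, of "\<lambda>L. f (L b)"]
    show ?thesis by simp
  qed
  have "real (card S) * (\<Sum>L | L permutes S. f (L b)) = (\<Sum>c\<in>S. \<Sum>L | L permutes S. f (L c))"
    by (simp add: eq)
  also have "\<dots> = (\<Sum>L | L permutes S. \<Sum>c\<in>S. f (L c))" by (rule sum.swap)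
  also have "\<dots> = (\<Sum>L | L permutes S. \<Sum>c\<in>S. f c)"
    by (rule sum.cong[OF refl], rule sum_permute) simp
  also have "\<dots> = fact (card S) * (\<Sum>a\<in>S. f a)"
    using card_permutations[OF refl assms(1)] by simp
  finally have "real (card S) * (\<Sum>L | L permutes S. f (L b)) = fact (card S) * (\<Sum>a\<in>S. f a)" .
  moreover have "card S \<noteq> 0" using assms by auto
  ultimately show ?thesis by (simp add: field_simps)
qed

lemma upper_half_reindex:
  fixes f :: "nat \<Rightarrow> real"
  shows "(\<Sum>i\<in>{n+1..2*n}. f i) = (\<Sum>i\<in>{1..n}. f (n + i))"
proof -
  have "(\<Sum>i\<in>{1+n..n+n}. f i) = (\<Sum>i\<in>{1..n}. f (i + n))"
    by (rule sum.shift_bounds_cl_nat_ivl)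
  then show ?thesis by (simp add: add.commute mult_2)
qed

lemma upper_half_offdiag_reindex:
  fixes f :: "nat \<Rightarrow> nat \<Rightarrow> real"
  shows "(\<Sum>i\<in>{n+1..2*n}. \<Sum>j\<in>{n+1..2*n} - {i}. f i j)
    = (\<Sum>i\<in>{1..n}. \<Sum>j\<in>{1..n} - {i}. f (n + i) (n + j))"
  unfolding sum_offdiag[OF finite_atLeastAtMost] by (simp only: upper_half_reindex)

text \<open>For fixed i, each of the n-1 indices j gives a uniform point \<open>L (n + j)\<close> of
  the upper half. The resulting factor (n-1)/n turns the normalisation 1/(n(n-1)) of
  \<open>paired_stat\<close> into the 1/n^2 of the cross terms.\<close>

lemma sum_offdiag_upper_permutations:
  fixes f :: "nat \<Rightarrow> nat \<Rightarrow> real"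
  assumes "1 \<le> n"
  shows "(\<Sum>L | L permutes {n+1..2*n}. \<Sum>i\<in>{1..n}. \<Sum>j\<in>{1..n} - {i}. f i (L (n + j)))
    = fact n * ((real n - 1) / real n) * (\<Sum>i\<in>{1..n}. \<Sum>j\<in>{n+1..2*n}. f i j)"
proof -
  have L: "(\<Sum>L | L permutes {n+1..2*n}. f i (L (n + j))) = fact n / real n * (\<Sum>k\<in>{n+1..2*n}. f i k)"
    if "j \<in> {1..n}" for i j
    using sum_permutations_apply[of "{n+1..2*n}" "n + j" "f i"] that by simp
  have "(\<Sum>L | L permutes {n+1..2*n}. \<Sum>i\<in>{1..n}. \<Sum>j\<in>{1..n} - {i}. f i (L (n + j)))
    = (\<Sum>i\<in>{1..n}. \<Sum>j\<in>{1..n} - {i}. \<Sum>L | L permutes {n+1..2*n}. f i (L (n + j)))"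
    by (subst sum.swap, intro sum.cong refl, subst sum.swap) auto
  also have "\<dots> = (\<Sum>i\<in>{1..n}. \<Sum>j\<in>{1..n} - {i}. fact n / real n * (\<Sum>k\<in>{n+1..2*n}. f i k))"
    by (intro sum.cong refl L) auto
  also have "\<dots> = (\<Sum>i\<in>{1..n}. (real n - 1) * (fact n / real n * (\<Sum>k\<in>{n+1..2*n}. f i k)))"
    using assms by (intro sum.cong refl) (auto simp: of_nat_diff)
  finally show ?thesis by (simp add: sum_distrib_left mult_ac)
qed

text \<open>Only the cross terms feel a permutation of the second sample, so averaging over such
  permutations turns the pairing of \<^term>\<open>i\<close> with \<^term>\<open>n + i\<close> into the full cross sum.\<close>

lemma two_sample_eq_average:
  assumes "2 \<le> n" and sym: "\<And>a b. g a b = g b a"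
  shows "(\<Sum>L | L permutes {n+1..2*n}. paired_stat n g (x \<circ> L)) = fact n * two_sample n g x"
proof -
  let ?B = "{n+1..2*n}"
  let ?P = "{L. L permutes ?B}"
  have card: "(\<Sum>L\<in>?P. c) = fact n * c" for c :: real
    using card_permutations[of ?B n] by simp
  have fixA: "L i = i" if "L \<in> ?P" "i \<in> {1..n}" for L i
    using that by (auto intro: permutes_not_in)
  have s1: "(\<Sum>L\<in>?P. \<Sum>i\<in>{1..n}. \<Sum>j\<in>{1..n} - {i}. g (x (L i)) (x (L j)))
      = fact n * (\<Sum>i\<in>{1..n}. \<Sum>j\<in>{1..n} - {i}. g (x i) (x j))"
    unfolding card[symmetric]
  proof (intro sum.cong refl)
    fix L i j assume "L \<in> ?P" "i \<in> {1..n}" "j \<in> {1..n} - {i}"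
    then have "L i = i" "L j = j" using fixA[of L] by blast+
    then show "g (x (L i)) (x (L j)) = g (x i) (x j)" by simp
  qed
  have s2: "(\<Sum>L\<in>?P. \<Sum>i\<in>{1..n}. \<Sum>j\<in>{1..n} - {i}. g (x (L (n + i))) (x (L (n + j))))
      = fact n * (\<Sum>i\<in>?B. \<Sum>j\<in>?B - {i}. g (x i) (x j))"
    unfolding card[symmetric]
  proof (rule sum.cong[OF refl])
    fix L assume "L \<in> ?P"
    then show "(\<Sum>i\<in>{1..n}. \<Sum>j\<in>{1..n} - {i}. g (x (L (n + i))) (x (L (n + j))))
      = (\<Sum>i\<in>?B. \<Sum>j\<in>?B - {i}. g (x i) (x j))"
      using sum_offdiag_permute[of L ?B "\<lambda>a b. g (x a) (x b)"]
        upper_half_offdiag_reindex[of "\<lambda>i j. g (x (L i)) (x (L j))" n] by simp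
  qed
  have s3: "(\<Sum>L\<in>?P. \<Sum>i\<in>{1..n}. \<Sum>j\<in>{1..n} - {i}. g (x (L i)) (x (L (n + j))))
      = fact n * ((real n - 1) / real n) * (\<Sum>i\<in>{1..n}. \<Sum>j\<in>?B. g (x i) (x j))"
  proof -
    have "(\<Sum>L\<in>?P. \<Sum>i\<in>{1..n}. \<Sum>j\<in>{1..n} - {i}. g (x (L i)) (x (L (n + j))))
      = (\<Sum>L\<in>?P. \<Sum>i\<in>{1..n}. \<Sum>j\<in>{1..n} - {i}. g (x i) (x (L (n + j))))"
    proof (intro sum.cong refl)
      fix L i j assume "L \<in> ?P" "i \<in> {1..n}"
      then have "L i = i" using fixA[of L] by blast
      then show "g (x (L i)) (x (L (n + j))) = g (x i) (x (L (n + j)))" by simp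
    qed
    then show ?thesis
      using sum_offdiag_upper_permutations[of n "\<lambda>i j. g (x i) (x j)"] assms(1) by simp
  qed
  \<comment> \<open>Symmetry of g exchanges i and j, so for every L this cross term equals the
    previous one.\<close>
  have s4: "(\<Sum>L\<in>?P. \<Sum>i\<in>{1..n}. \<Sum>j\<in>{1..n} - {i}. g (x (L (n + i))) (x (L j)))
      = fact n * ((real n - 1) / real n) * (\<Sum>i\<in>{1..n}. \<Sum>j\<in>?B. g (x i) (x j))"
    unfolding s3[symmetric]
  proof (rule sum.cong[OF refl])
    fix L
    show "(\<Sum>i\<in>{1..n}. \<Sum>j\<in>{1..n} - {i}. g (x (L (n + i))) (x (L j)))
      = (\<Sum>i\<in>{1..n}. \<Sum>j\<in>{1..n} - {i}. g (x (L i)) (x (L (n + j))))"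
      unfolding sum_offdiag[OF finite_atLeastAtMost]
      by (subst sum.swap) (simp only: sym[of "x (L (n + j))" for j])
  qed
  have "(\<Sum>L\<in>?P. paired_stat n g (x \<circ> L))
      = ((\<Sum>L\<in>?P. \<Sum>i\<in>{1..n}. \<Sum>j\<in>{1..n} - {i}. g (x (L i)) (x (L j)))
      + (\<Sum>L\<in>?P. \<Sum>i\<in>{1..n}. \<Sum>j\<in>{1..n} - {i}. g (x (L (n + i))) (x (L (n + j))))
      - (\<Sum>L\<in>?P. \<Sum>i\<in>{1..n}. \<Sum>j\<in>{1..n} - {i}. g (x (L i)) (x (L (n + j))))
      - (\<Sum>L\<in>?P. \<Sum>i\<in>{1..n}. \<Sum>j\<in>{1..n} - {i}. g (x (L (n + i))) (x (L j)))) / (real n * (real n - 1))"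
    by (simp only: paired_stat_def pair_kernel_def sum_divide_distrib[symmetric] sum.distrib sum_subtractf comp_def)
  also have "\<dots> = (fact n * (\<Sum>i\<in>{1..n}. \<Sum>j\<in>{1..n} - {i}. g (x i) (x j))
      + fact n * (\<Sum>i\<in>?B. \<Sum>j\<in>?B - {i}. g (x i) (x j))
      - fact n * ((real n - 1) / real n) * (\<Sum>i\<in>{1..n}. \<Sum>j\<in>?B. g (x i) (x j))
      - fact n * ((real n - 1) / real n) * (\<Sum>i\<in>{1..n}. \<Sum>j\<in>?B. g (x i) (x j))) / (real n * (real n - 1))"
    by (simp only: s1 s2 s3 s4)
  also have "\<dots> = fact n * two_sample n g x"
  proof -
    have "(f * a + f * b - f * ((n - 1) / n) * c - f * ((n - 1) / n) * c) / (n * (n - 1))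
      = f * ((a + b) / (n * (n - 1)) - 2 * c / n\<^sup>2)" if "1 < n" for f a b c n :: real
    proof -
      have "f * ((n - 1) / n) * c / (n * (n - 1)) = f * c / n\<^sup>2"
        using that by (simp add: power2_eq_square)
      then show ?thesis
        by (simp only: add_divide_distrib diff_divide_distrib) (simp add: algebra_simps)
    qed
    moreover have "1 < real n" using assms(1) by simp
    ultimately show ?thesis
      unfolding two_sample_def by blast
  qed
  finally show ?thesis .
qed

lemma sum_offdiag_Un:
  fixes f :: "'a \<Rightarrow> 'a \<Rightarrow> real"
  assumes "finite A" "finite B" "A \<inter> B = {}"
  shows "(\<Sum>i\<in>A \<union> B. \<Sum>j\<in>A \<union> B - {i}. f i j)
    = (\<Sum>i\<in>A. \<Sum>j\<in>A - {i}. f i j) + (\<Sum>i\<in>A. \<Sum>j\<in>B. f i j)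
      + (\<Sum>i\<in>B. \<Sum>j\<in>A. f i j) + (\<Sum>i\<in>B. \<Sum>j\<in>B - {i}. f i j)"
  using assms by (simp add: sum_offdiag sum.union_disjoint sum.distrib)

text \<open>The pair kernel is the bilinear extension of g, evaluated at the difference of the point
  masses at \<open>x i\<close> and \<open>x (n + i)\<close> and at the same difference for j.
  Exchanging the members of a pair negates its difference.\<close>

lemma pair_kernel_swap:
  assumes "i \<in> {1..n}" "j \<in> {1..n}" "S \<subseteq> {1..n}"
  shows "pair_kernel n g (x \<circ> swap_pairs n S) i j = pair_kernel n g x i j * rad S i * rad S j"
proof -
  have "swap_pairs n S k = (if k \<in> S then n + k else k)" "swap_pairs n S (n + k) = (if k \<in> S then k else n + k)"
    if "k \<in> {1..n}" for k
    using that assms(3) by (auto simp: swap_pairs_def)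
  then show ?thesis
    using assms by (auto simp: pair_kernel_def rad_def)
qed

lemma swap_pairs_permutes:
  assumes "S \<subseteq> {1..n}"
  shows "swap_pairs n S permutes {1..2*n}"
proof -
  have outside: "swap_pairs n S k = k" if "k \<notin> {1..2*n}" for k
    using that assms unfolding swap_pairs_def
    by (smt (verit, ccfv_threshold) atLeastAtMost_iff le_add_diff_inverse less_imp_le_nat mult_2 nat_add_left_cancel_le subsetD trans_le_add2)
  have invol: "swap_pairs n S (swap_pairs n S k) = k" for k
    using assms by (auto simp: swap_pairs_def)
  show ?thesis
    unfolding permutes_def using outside invol by metis
qed

text \<open>The square of a sum of four terms costs the factor 4. The four families of index pairs
  are disjoint and off the diagonal of {1..2n}; the positions left over are (i, n+i) and (n+i, i),
  which add nonnegative terms to the energy.\<close>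

lemma sum_squares_pair_kernel_le:
  "(\<Sum>i\<in>{1..n}. \<Sum>j\<in>{1..n} - {i}. (pair_kernel n g x i j)\<^sup>2) \<le> 4 * kernel_energy n g x"
proof -
  let ?A = "{1..n}" and ?B = "{n+1..2*n}"
  let ?f = "\<lambda>i j. (g (x i) (x j))\<^sup>2"
  have four: "(a + b - c - d)\<^sup>2 \<le> 4 * (a\<^sup>2 + b\<^sup>2 + c\<^sup>2 + d\<^sup>2)" for a b c d :: real
  proof -
    have two: "(u + v)\<^sup>2 \<le> 2 * u\<^sup>2 + 2 * v\<^sup>2" "(u - v)\<^sup>2 \<le> 2 * u\<^sup>2 + 2 * v\<^sup>2" for u v :: real
      using sum_squares_bound[of u v] sum_squares_bound[of u "- v"]
      by (auto simp: power2_sum power2_diff)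
    have "(a + b - c - d)\<^sup>2 \<le> 2 * (a + b)\<^sup>2 + 2 * (c + d)\<^sup>2"
      using two(2)[of "a + b" "c + d"] by (simp only: diff_diff_add)
    also have "\<dots> \<le> 2 * (2 * a\<^sup>2 + 2 * b\<^sup>2) + 2 * (2 * c\<^sup>2 + 2 * d\<^sup>2)"
      by (intro add_mono mult_left_mono two) auto
    finally show ?thesis by simp
  qed
  have arith: "4 * (a + d + b + c) \<le> 4 * e"
    if "e = a + b' + c' + d" "a + b + c + d \<le> a + b' + c' + d" for a b c d e b' c' :: real
    using that by simp
  have AB: "{1..2*n} = ?A \<union> ?B" "?A \<inter> ?B = {}" by auto
  have "kernel_energy n g x = (\<Sum>i\<in>?A. \<Sum>j\<in>?A - {i}. ?f i j) + (\<Sum>i\<in>?A. \<Sum>j\<in>?B. ?f i j)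
      + (\<Sum>i\<in>?B. \<Sum>j\<in>?A. ?f i j) + (\<Sum>i\<in>?B. \<Sum>j\<in>?B - {i}. ?f i j)"
    unfolding kernel_energy_def AB(1) by (rule sum_offdiag_Un) auto
  also have "\<dots> = (\<Sum>i\<in>?A. \<Sum>j\<in>?A - {i}. ?f i j) + (\<Sum>i\<in>?A. \<Sum>j\<in>?A. ?f i (n + j))
      + (\<Sum>i\<in>?A. \<Sum>j\<in>?A. ?f (n + i) j) + (\<Sum>i\<in>?A. \<Sum>j\<in>?A - {i}. ?f (n + i) (n + j))"
    by (simp only: upper_half_offdiag_reindex upper_half_reindex)
  finally have "kernel_energy n g x = (\<Sum>i\<in>?A. \<Sum>j\<in>?A - {i}. ?f i j) + (\<Sum>i\<in>?A. \<Sum>j\<in>?A. ?f i (n + j))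
      + (\<Sum>i\<in>?A. \<Sum>j\<in>?A. ?f (n + i) j) + (\<Sum>i\<in>?A. \<Sum>j\<in>?A - {i}. ?f (n + i) (n + j))" .
  moreover have "\<dots> \<ge> (\<Sum>i\<in>?A. \<Sum>j\<in>?A - {i}. ?f i j) + (\<Sum>i\<in>?A. \<Sum>j\<in>?A - {i}. ?f i (n + j))
      + (\<Sum>i\<in>?A. \<Sum>j\<in>?A - {i}. ?f (n + i) j) + (\<Sum>i\<in>?A. \<Sum>j\<in>?A - {i}. ?f (n + i) (n + j))"
    by (intro add_mono order.refl sum_mono sum_mono2) auto
  ultimately have "4 * ((\<Sum>i\<in>?A. \<Sum>j\<in>?A - {i}. ?f i j) + (\<Sum>i\<in>?A. \<Sum>j\<in>?A - {i}. ?f (n + i) (n + j))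
      + (\<Sum>i\<in>?A. \<Sum>j\<in>?A - {i}. ?f i (n + j)) + (\<Sum>i\<in>?A. \<Sum>j\<in>?A - {i}. ?f (n + i) j)) \<le> 4 * kernel_energy n g x"
    by (rule arith)
  moreover have "(\<Sum>i\<in>?A. \<Sum>j\<in>?A - {i}. (pair_kernel n g x i j)\<^sup>2)
      \<le> (\<Sum>i\<in>?A. \<Sum>j\<in>?A - {i}. 4 * (?f i j + ?f (n + i) (n + j) + ?f i (n + j) + ?f (n + i) j))"
    unfolding pair_kernel_def by (intro sum_mono four)
  ultimately show ?thesis
    by (simp only: sum_distrib_left[symmetric] sum.distrib)
qed

lemma power_even_average_le:
  fixes f :: "'a \<Rightarrow> real"
  assumes "finite I" "I \<noteq> {}"
  shows "((\<Sum>i\<in>I. f i) / card I) ^ (2 * p) \<le> (\<Sum>i\<in>I. f i ^ (2 * p)) / card I"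
proof -
  have "card I \<noteq> 0" using assms by auto
  have "(\<Sum>i\<in>I. (1 / real (card I)) *\<^sub>R f i) ^ (2 * p) \<le> (\<Sum>i\<in>I. 1 / real (card I) * f i ^ (2 * p))"
    using assms \<open>card I \<noteq> 0\<close>
    by (intro convex_on_sum[where C = UNIV and f = "\<lambda>z. z ^ (2 * p)"] convex_power_even) auto
  then show ?thesis
    by (simp add: sum_divide_distrib)
qed

lemma kernel_energy_permute:
  assumes "\<pi> permutes {1..2*n}"
  shows "kernel_energy n g (x \<circ> \<pi>) = kernel_energy n g x"
  unfolding kernel_energy_def comp_def
  using sum_offdiag_permute[OF assms, of "\<lambda>a b. (g (x a) (x b))\<^sup>2"] by simp

text \<open>Swapping the pairs indexed by \<^term>\<open>S\<close> preserves the law of a uniform permutation and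
  multiplies the kernel at \<^term>\<open>(i, j)\<close> by \<^term>\<open>rad S i * rad S j\<close>; average over all \<^term>\<open>S\<close>.\<close>

lemma paired_stat_permutation_moment:
  assumes "2 \<le> n" "1 \<le> p"
  shows "(\<Sum>\<pi> | \<pi> permutes {1..2*n}. paired_stat n g (x \<circ> \<pi>) ^ (2 * p))
    \<le> fact (2 * n) * ((2 * real p - 1)\<^sup>2 * (8 * kernel_energy n g x) / (real n * (real n - 1))\<^sup>2) ^ p"
proof -
  let ?P = "{\<pi>. \<pi> permutes {1..2*n}}" and ?A = "{1..n}"
  let ?N = "real n * (real n - 1)"
  let ?E = "kernel_energy n g x"
  have swap: "(\<Sum>\<pi>\<in>?P. paired_stat n g (x \<circ> \<pi>) ^ (2 * p))
      = (\<Sum>\<pi>\<in>?P. ((\<Sum>i\<in>?A. \<Sum>j\<in>?A - {i}. pair_kernel n g (x \<circ> \<pi>) i j * rad S i * rad S j) / ?N) ^ (2 * p))"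
    if "S \<in> Pow ?A" for S
  proof -
    have "(\<Sum>\<pi>\<in>?P. paired_stat n g (x \<circ> \<pi>) ^ (2 * p))
        = (\<Sum>\<pi>\<in>?P. paired_stat n g (x \<circ> (\<pi> \<circ> swap_pairs n S)) ^ (2 * p))"
      using that by (intro sum_permutations_compose_right swap_pairs_permutes) auto
    also have "\<dots> = (\<Sum>\<pi>\<in>?P. ((\<Sum>i\<in>?A. \<Sum>j\<in>?A - {i}.
        pair_kernel n g ((x \<circ> \<pi>) \<circ> swap_pairs n S) i j) / ?N) ^ (2 * p))"
      by (simp only: paired_stat_def o_assoc)
    also have "\<dots> = (\<Sum>\<pi>\<in>?P. ((\<Sum>i\<in>?A. \<Sum>j\<in>?A - {i}. pair_kernel n g (x \<circ> \<pi>) i j * rad S i * rad S j) / ?N) ^ (2 * p))"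
      using that
      by (intro sum.cong refl arg_cong[where f = "\<lambda>z. (z / ?N) ^ (2 * p)"] pair_kernel_swap) auto
    finally show ?thesis .
  qed
  have one: "(\<Sum>S\<in>Pow ?A. ((\<Sum>i\<in>?A. \<Sum>j\<in>?A - {i}. pair_kernel n g (x \<circ> \<pi>) i j * rad S i * rad S j) / ?N) ^ (2 * p))
      \<le> 2 ^ n * ((2 * real p - 1)\<^sup>2 * (8 * ?E) / ?N\<^sup>2) ^ p" if "\<pi> \<in> ?P" for \<pi>
  proof -
    let ?q = "\<Sum>i\<in>?A. \<Sum>j\<in>?A - {i}. (pair_kernel n g (x \<circ> \<pi>) i j)\<^sup>2"
    \<comment> \<open>Permuting the sample leaves the energy unchanged, so the bound is the same for
      every \<open>\<pi>\<close>.\<close>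
    have "?q \<le> 4 * ?E"
      using sum_squares_pair_kernel_le[of n g "x \<circ> \<pi>"] kernel_energy_permute[of \<pi> n g x] that by simp
    moreover have "0 \<le> ?q" by (intro sum_nonneg) auto
    ultimately have "0 \<le> ?q" "2 * ?q \<le> 8 * ?E" by auto
    then have "((2 * real p - 1)\<^sup>2 * (2 * ?q)) ^ p \<le> ((2 * real p - 1)\<^sup>2 * (8 * ?E)) ^ p"
      by (intro power_mono mult_left_mono mult_nonneg_nonneg) auto
    then have le: "2 ^ card ?A * ((2 * real p - 1)\<^sup>2 * (2 * ?q)) ^ p
        \<le> 2 ^ n * ((2 * real p - 1)\<^sup>2 * (8 * ?E)) ^ p"
      by simp
    have "(\<Sum>S\<in>Pow ?A. ((\<Sum>i\<in>?A. \<Sum>j\<in>?A - {i}. pair_kernel n g (x \<circ> \<pi>) i j * rad S i * rad S j) / ?N) ^ (2 * p))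
        = (\<Sum>S\<in>Pow ?A. (\<Sum>i\<in>?A. \<Sum>j\<in>?A - {i}. pair_kernel n g (x \<circ> \<pi>) i j * rad S i * rad S j) ^ (2 * p)) / ?N ^ (2 * p)"
      by (simp only: power_divide sum_divide_distrib[symmetric])
    also have "\<dots> \<le> (2 ^ card ?A * ((2 * real p - 1)\<^sup>2 * (2 * ?q)) ^ p) / ?N ^ (2 * p)"
      using assms by (intro divide_right_mono quadratic_chaos_moment) (auto intro: zero_le_even_power)
    also have "\<dots> \<le> (2 ^ n * ((2 * real p - 1)\<^sup>2 * (8 * ?E)) ^ p) / ?N ^ (2 * p)"
      by (rule divide_right_mono[OF le]) simp
    also have "\<dots> = 2 ^ n * ((2 * real p - 1)\<^sup>2 * (8 * ?E) / ?N\<^sup>2) ^ p"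
      by (simp only: power_divide power_mult times_divide_eq_right)
    finally show ?thesis .
  qed
  have "2 ^ n * (\<Sum>\<pi>\<in>?P. paired_stat n g (x \<circ> \<pi>) ^ (2 * p))
      = (\<Sum>S\<in>Pow ?A. \<Sum>\<pi>\<in>?P. paired_stat n g (x \<circ> \<pi>) ^ (2 * p))"
    by (simp add: card_Pow)
  also have "\<dots> = (\<Sum>S\<in>Pow ?A. \<Sum>\<pi>\<in>?P. ((\<Sum>i\<in>?A. \<Sum>j\<in>?A - {i}. pair_kernel n g (x \<circ> \<pi>) i j * rad S i * rad S j) / ?N) ^ (2 * p))"
    by (rule sum.cong[OF refl swap])
  also have "\<dots> = (\<Sum>\<pi>\<in>?P. \<Sum>S\<in>Pow ?A. ((\<Sum>i\<in>?A. \<Sum>j\<in>?A - {i}. pair_kernel n g (x \<circ> \<pi>) i j * rad S i * rad S j) / ?N) ^ (2 * p))"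
    by (rule sum.swap)
  also have "\<dots> \<le> (\<Sum>\<pi>\<in>?P. 2 ^ n * ((2 * real p - 1)\<^sup>2 * (8 * ?E) / ?N\<^sup>2) ^ p)"
    by (rule sum_mono[OF one])
  also have "\<dots> = 2 ^ n * (fact (2 * n) * ((2 * real p - 1)\<^sup>2 * (8 * ?E) / ?N\<^sup>2) ^ p)"
    using card_permutations[of "{1..2*n}" "2 * n"] by simp
  finally show ?thesis by (rule mult_left_le_imp_le) simp
qed

text \<open>Jensen's inequality for the even power moves the average over permutations L of the
  second sample outside. Each L also permutes the whole index set, so \<open>\<pi> \<circ> L\<close>
  again runs through all permutations and the bound for the paired statistic is inherited without
  loss.\<close>

lemma two_sample_permutation_moment:
  assumes "2 \<le> n" "1 \<le> p" and sym: "\<And>a b. g a b = g b a"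
  shows "(\<Sum>\<pi> | \<pi> permutes {1..2*n}. two_sample n g (x \<circ> \<pi>) ^ (2 * p))
    \<le> fact (2 * n) * ((2 * real p - 1)\<^sup>2 * (8 * kernel_energy n g x) / (real n * (real n - 1))\<^sup>2) ^ p"
proof -
  let ?P = "{\<pi>. \<pi> permutes {1..2*n}}" and ?L = "{L. L permutes {n+1..2*n}}"
  have cardL: "card ?L = fact n" using card_permutations[of "{n+1..2*n}" n] by simp
  have L: "finite ?L" "?L \<noteq> {}" using finite_permutations[of "{n+1..2*n}"] permutes_id by blast+
  have "two_sample n g y ^ (2 * p) \<le> (\<Sum>L\<in>?L. paired_stat n g (y \<circ> L) ^ (2 * p)) / fact n" for y
  proof -
    have "two_sample n g y = (\<Sum>L\<in>?L. paired_stat n g (y \<circ> L)) / card ?L"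
      using two_sample_eq_average[of n g y, OF assms(1) sym] cardL by simp
    then show ?thesis
      using power_even_average_le[OF L, of "\<lambda>L. paired_stat n g (y \<circ> L)" p] cardL by simp
  qed
  then have "(\<Sum>\<pi>\<in>?P. two_sample n g (x \<circ> \<pi>) ^ (2 * p))
      \<le> (\<Sum>\<pi>\<in>?P. (\<Sum>L\<in>?L. paired_stat n g (x \<circ> \<pi> \<circ> L) ^ (2 * p)) / fact n)"
    by (intro sum_mono)
  also have "\<dots> = (\<Sum>L\<in>?L. \<Sum>\<pi>\<in>?P. paired_stat n g (x \<circ> (\<pi> \<circ> L)) ^ (2 * p)) / fact n"
    by (simp only: sum_divide_distrib[symmetric] o_assoc) (subst sum.swap, rule refl)
  also have "\<dots> = (\<Sum>L\<in>?L. \<Sum>\<pi>\<in>?P. paired_stat n g (x \<circ> \<pi>) ^ (2 * p)) / fact n"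
  proof -
    have "(\<Sum>\<pi>\<in>?P. paired_stat n g (x \<circ> (\<pi> \<circ> L)) ^ (2 * p)) = (\<Sum>\<pi>\<in>?P. paired_stat n g (x \<circ> \<pi>) ^ (2 * p))"
      if "L \<in> ?L" for L
    proof -
      have "L permutes {1..2*n}" using that by (auto intro: permutes_subset)
      then show ?thesis
        by (rule sum_permutations_compose_right[symmetric])
    qed
    then show ?thesis by (metis (no_types, lifting) sum.cong)
  qed
  also have "\<dots> = (\<Sum>\<pi>\<in>?P. paired_stat n g (x \<circ> \<pi>) ^ (2 * p))"
    using cardL by simp
  also note paired_stat_permutation_moment[OF assms(1,2), of g x]
  finally show ?thesis .
qed

section \<open>The permutation quantile\<close>

definition perm_law :: "nat \<Rightarrow> ('b \<Rightarrow> 'b \<Rightarrow> real) \<Rightarrow> (nat \<Rightarrow> 'b) \<Rightarrow> real pmf" where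
  "perm_law n g x = map_pmf (\<lambda>\<pi>. two_sample n g (x \<circ> \<pi>)) (pmf_of_set {\<pi>. \<pi> permutes {1..2*n}})"

definition pmf_quantile :: "real \<Rightarrow> real pmf \<Rightarrow> real" where
  "pmf_quantile q Q = Inf {t. cdf (measure_pmf Q) t \<ge> q}"

lemma finite_nonempty_permutations:
  "finite {\<pi>. \<pi> permutes {1..2*n::nat}}" "{\<pi>. \<pi> permutes {1..2*n::nat}} \<noteq> {}"
  using finite_permutations[of "{1..2*n}"] permutes_id by blast+

lemma set_pmf_permutations:
  "set_pmf (pmf_of_set {\<pi>. \<pi> permutes {1..2*n::nat}}) = {\<pi>. \<pi> permutes {1..2*n}}"
  by (rule set_pmf_of_set[OF finite_nonempty_permutations(2,1)])

lemma pmf_quantile_le: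
  assumes "finite (set_pmf Q)" "0 < q" "q \<le> cdf (measure_pmf Q) t"
  shows "pmf_quantile q Q \<le> t"
  unfolding pmf_quantile_def
proof (rule cInf_lower)
  \<comment> \<open>An infimum of reals is a lower bound only for a set that is bounded below. To
    the left of the least atom the distribution function is 0, which is less than q.\<close>
  show "bdd_below {t. q \<le> cdf (measure_pmf Q) t}"
  proof (rule bdd_belowI)
    fix s assume s: "s \<in> {t. q \<le> cdf (measure_pmf Q) t}"
    show "Min (set_pmf Q) \<le> s"
    proof (rule ccontr)
      assume "\<not> Min (set_pmf Q) \<le> s"
      then have "set_pmf Q \<inter> {..s} = {}" using assms(1) by (auto simp: Min_le_iff set_pmf_not_empty)
      then have "measure_pmf.prob Q {..s} = 0" by (simp add: measure_pmf_zero_iff)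
      then show False using s assms(2) by (simp add: cdf_def)
    qed
  qed
qed (use assms in simp)

lemma prob_greater_pmf_quantile:
  assumes "finite (set_pmf Q)" "q \<le> 1"
  shows "measure_pmf.prob Q {pmf_quantile q Q<..} \<le> 1 - q"
proof -
  let ?c = "pmf_quantile q Q" and ?T = "{t. q \<le> cdf (measure_pmf Q) t}"
  have "measure_pmf.prob Q {..Max (set_pmf Q)} = 1"
    using assms(1) by (subst measure_pmf.prob_eq_1) (auto simp: AE_measure_pmf_iff)
  then have "Max (set_pmf Q) \<in> ?T" using assms(2) by (simp add: cdf_def)
  then have ne: "?T \<noteq> {}" by blast
  \<comment> \<open>The smaller of c+1 and the next atom after the quantile c. As s exceeds the
    infimum, some t in the set lies below s, and every atom above c is at least s, hence above t.
    This takes the place of right-continuity of the distribution function.\<close>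
  define s where "s = Min (insert (?c + 1) (set_pmf Q \<inter> {?c<..}))"
  have s: "?c < s" unfolding s_def using assms(1) by (subst Min_gr_iff) auto
  obtain t where t: "t \<in> ?T" "t < s"
    using s ne unfolding pmf_quantile_def by (meson cInf_lessD)
  have "set_pmf Q \<inter> {?c<..} \<subseteq> {t<..}"
  proof
    fix r assume "r \<in> set_pmf Q \<inter> {?c<..}"
    then have "s \<le> r" unfolding s_def using assms(1) by (intro Min_le) auto
    then show "r \<in> {t<..}" using t by simp
  qed
  then have "measure_pmf.prob Q {?c<..} \<le> measure_pmf.prob Q {t<..}"
    by (intro measure_pmf.finite_measure_mono_AE) (auto simp: AE_measure_pmf_iff)
  also have "\<dots> = measure_pmf.prob Q (UNIV - {..t})"
    by (intro arg_cong[where f = "measure_pmf.prob Q"]) auto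
  also have "\<dots> = 1 - measure_pmf.prob Q {..t}"
    using measure_pmf.prob_compl[of "{..t}" Q] by simp
  also have "\<dots> \<le> 1 - q" using t by (simp add: cdf_def)
  finally show ?thesis .
qed

lemma finite_set_perm_law: "finite (set_pmf (perm_law n g x))"
  unfolding perm_law_def
  by (simp only: set_map_pmf set_pmf_permutations finite_imageI finite_nonempty_permutations)

text \<open>Left composition with \<open>\<sigma>\<close> is a bijection of the permutations.
  Consequently the critical value is a symmetric function of the pooled sample.\<close>

lemma perm_law_permute:
  assumes "\<sigma> permutes {1..2*n}"
  shows "perm_law n g (x \<circ> \<sigma>) = perm_law n g x"
proof -
  let ?P = "{\<pi>. \<pi> permutes {1..2*n}}"
  have "bij_betw (\<lambda>\<pi>. \<sigma> \<circ> \<pi>) ?P ?P"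
  proof (rule bij_betw_byWitness[where f' = "\<lambda>\<pi>. inv \<sigma> \<circ> \<pi>"])
    show "\<forall>\<pi>\<in>?P. inv \<sigma> \<circ> (\<sigma> \<circ> \<pi>) = \<pi>" "\<forall>\<pi>\<in>?P. \<sigma> \<circ> (inv \<sigma> \<circ> \<pi>) = \<pi>"
      using permutes_inv_o[OF assms] by (simp_all add: o_assoc)
  qed (use assms in \<open>auto intro: permutes_compose permutes_inv\<close>)
  then have "map_pmf (\<lambda>\<pi>. \<sigma> \<circ> \<pi>) (pmf_of_set ?P) = pmf_of_set ?P"
    using finite_nonempty_permutations by (intro map_pmf_of_set_bij_betw) auto
  then have "perm_law n g x = map_pmf (\<lambda>\<pi>. two_sample n g (x \<circ> \<pi>)) (map_pmf (\<lambda>\<pi>. \<sigma> \<circ> \<pi>) (pmf_of_set ?P))"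
    unfolding perm_law_def by simp
  then show ?thesis by (simp add: perm_law_def map_pmf_comp o_assoc)
qed

text \<open>Markov's inequality for the power 2p: V/t^2 is at most exp(-2), and its p-th power is
  the asserted fraction. For t = 0 the quotient is meaningless, but then V = 0 forces every value of
  f to vanish.\<close>

lemma even_moment_tail:
  fixes f :: "'a \<Rightarrow> real" and V t :: real
  assumes "finite I" "1 \<le> p" "0 \<le> V" and moment: "(\<Sum>i\<in>I. f i ^ (2 * p)) \<le> card I * V ^ p"
    and "0 \<le> t" "(exp 1)\<^sup>2 * V \<le> t\<^sup>2"
  shows "real (card {i \<in> I. t < f i}) \<le> card I * exp (- 2 * real p)"
proof (cases "t = 0")
  case True
  then have "V = 0" using assms by (simp add: mult_le_0_iff)
  then have "(\<Sum>i\<in>I. f i ^ (2 * p)) \<le> 0" using moment assms(2) by (simp add: power_0_left)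
  then have "(\<Sum>i\<in>I. f i ^ (2 * p)) = 0" by (intro antisym sum_nonneg) (auto simp: zero_le_even_power)
  then have "\<forall>i\<in>I. f i ^ (2 * p) = 0"
    using assms(1) by (subst (asm) sum_nonneg_eq_0_iff) (auto simp: zero_le_even_power)
  then have "{i \<in> I. t < f i} = {}" using True by auto
  then show ?thesis by (simp only: card.empty) simp
next
  case False
  then have t: "0 < t" using assms by simp
  have "real (card {i \<in> I. t < f i}) * t ^ (2 * p) = (\<Sum>i\<in>{i \<in> I. t < f i}. t ^ (2 * p))" by simp
  also have "\<dots> \<le> (\<Sum>i\<in>{i \<in> I. t < f i}. f i ^ (2 * p))"
    using t by (intro sum_mono power_mono) auto
  also have "\<dots> \<le> (\<Sum>i\<in>I. f i ^ (2 * p))"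
    using assms(1) by (intro sum_mono2) (auto simp: zero_le_even_power)
  also have "\<dots> \<le> card I * V ^ p" by (rule moment)
  also have "\<dots> \<le> card I * (t\<^sup>2 * exp (- 2)) ^ p"
  proof -
    have "exp (- 2) * (exp 1)\<^sup>2 = (1::real)"
      by (simp add: power2_eq_square mult_exp_exp)
    then have "exp (-2) * ((exp 1)\<^sup>2 * V) = V"
      by (simp only: mult.assoc[symmetric] mult_1)
    moreover have "exp (-2) * ((exp 1)\<^sup>2 * V) \<le> exp (-2) * t\<^sup>2"
      using assms by (intro mult_left_mono) auto
    ultimately have "V \<le> t\<^sup>2 * exp (- 2)" by (simp only: mult.commute)
    then show ?thesis using assms by (intro mult_left_mono power_mono) auto
  qed
  also have "\<dots> = (card I * exp (- 2 * real p)) * t ^ (2 * p)"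
    by (simp add: power_mult_distrib power_mult[symmetric] exp_of_nat_mult[symmetric] mult.commute)
  finally show ?thesis using t by simp
qed

lemma one_less_ln_reciprocal:
  fixes \<alpha> :: real
  assumes "0 < \<alpha>" "\<alpha> < exp (-1)"
  shows "1 < ln (1 / \<alpha>)"
proof -
  have "exp 1 < 1 / \<alpha>" using assms by (simp add: exp_minus field_simps)
  then have "ln (exp 1) < ln (1 / \<alpha>)" using assms by (subst ln_less_cancel_iff) auto
  then show ?thesis by simp
qed

lemma pmf_quantile_perm_law_le:
  assumes n: "2 \<le> n" and \<alpha>: "0 < \<alpha>" "\<alpha> < exp (-1)" and sym: "\<And>a b. g a b = g b a"
  shows "pmf_quantile (1 - \<alpha>) (perm_law n g x)
    \<le> 2 * exp 1 * ln (1 / \<alpha>) * sqrt (8 * kernel_energy n g x) / (real n * (real n - 1))"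
proof -
  let ?P = "{\<pi>. \<pi> permutes {1..2*n}}" and ?N = "real n * (real n - 1)"
  let ?E = "kernel_energy n g x"
  let ?t = "2 * exp 1 * ln (1 / \<alpha>) * sqrt (8 * ?E) / ?N"
  note L = one_less_ln_reciprocal[OF \<alpha>]
  \<comment> \<open>With the ceiling, exp(-2p) is at most \<open>\<alpha>\<close>, while 2p-1 <
    ln(1/\<open>\<alpha>\<close>) + 1 < 2 ln(1/\<open>\<alpha>\<close>) because
    \<open>\<alpha>\<close> is below exp(-1). So e times the square root of the per-point moment
    bound is at most the stated threshold.\<close>
  define p where "p = nat \<lceil>ln (1 / \<alpha>) / 2\<rceil>"
  have p: "ln (1 / \<alpha>) / 2 \<le> real p" "real p < ln (1 / \<alpha>) / 2 + 1"
    unfolding p_def using L by linarith+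
  have p1: "1 \<le> p" using p L by (cases p) auto
  have E: "0 \<le> ?E" unfolding kernel_energy_def by (intro sum_nonneg) auto
  have N: "0 < ?N" using n by simp
  let ?V = "(2 * real p - 1)\<^sup>2 * (8 * ?E) / ?N\<^sup>2"
  have card: "card ?P = fact (2 * n)" by (rule card_permutations) auto
  have "real (card {\<pi> \<in> ?P. ?t < two_sample n g (x \<circ> \<pi>)}) \<le> card ?P * exp (- 2 * real p)"
  proof (rule even_moment_tail)
    show "(\<Sum>\<pi>\<in>?P. two_sample n g (x \<circ> \<pi>) ^ (2 * p)) \<le> card ?P * ?V ^ p"
      using two_sample_permutation_moment[of n p g x, OF n p1 sym] card by simp
    have "(2 * real p - 1)\<^sup>2 \<le> (2 * ln (1 / \<alpha>))\<^sup>2"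
      using p L p1 by (intro power_mono) auto
    then have "(exp 1)\<^sup>2 * ?V \<le> (exp 1)\<^sup>2 * ((2 * ln (1 / \<alpha>))\<^sup>2 * (8 * ?E) / ?N\<^sup>2)"
      using E by (intro mult_left_mono divide_right_mono mult_right_mono) auto
    also have "\<dots> = ?t\<^sup>2"
      using E by (simp add: power_mult_distrib power_divide)
    finally show "(exp 1)\<^sup>2 * ?V \<le> ?t\<^sup>2" .
  qed (use p1 E L N in \<open>auto intro!: finite_permutations\<close>)
  also have "\<dots> \<le> card ?P * \<alpha>"
  proof -
    have "exp (- 2 * real p) \<le> exp (- ln (1 / \<alpha>))" using p by simp
    also have "\<dots> = \<alpha>" using \<alpha> by (simp add: ln_div)
    finally show ?thesis by (intro mult_left_mono) auto
  qed
  finally have tail: "measure_pmf.prob (perm_law n g x) {?t<..} \<le> \<alpha>"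
  proof -
    assume a: "real (card {\<pi> \<in> ?P. ?t < two_sample n g (x \<circ> \<pi>)}) \<le> card ?P * \<alpha>"
    have "measure_pmf.prob (perm_law n g x) {?t<..}
        = real (card (?P \<inter> (\<lambda>\<pi>. two_sample n g (x \<circ> \<pi>)) -` {?t<..})) / card ?P"
      unfolding perm_law_def
      using measure_pmf_of_set[OF finite_nonempty_permutations(2,1)] by simp
    also have "?P \<inter> (\<lambda>\<pi>. two_sample n g (x \<circ> \<pi>)) -` {?t<..} = {\<pi> \<in> ?P. ?t < two_sample n g (x \<circ> \<pi>)}"
      by auto
    finally show ?thesis using a card by (simp add: divide_le_eq mult.commute)
  qed
  show ?thesis
  proof (rule pmf_quantile_le[OF finite_set_perm_law])
    have "\<alpha> < 1" using \<alpha> by (meson exp_le_one_iff less_le_trans neg_le_0_iff_le zero_le_one)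
    then show "0 < 1 - \<alpha>" by simp
    have "UNIV - {?t<..} = {..?t}" by auto
    then have "measure_pmf.prob (perm_law n g x) {..?t} = 1 - measure_pmf.prob (perm_law n g x) {?t<..}"
      using measure_pmf.prob_compl[of "{?t<..}" "perm_law n g x"] by simp
    then show "1 - \<alpha> \<le> cdf (measure_pmf (perm_law n g x)) ?t"
      using tail by (simp add: cdf_def)
  qed
qed

text \<open>By exchangeability the rejection probability can be averaged over a random permutation
  of the sample. After the two integrals are interchanged the sample is fixed, the critical value
  does not change with the permutation, and the permuted statistic exceeds the quantile of its own
  law with probability at most \<open>\<alpha>\<close>.\<close>

lemma exchangeable_permutation_test:
  fixes X :: "(nat \<Rightarrow> 'b) pmf"
  assumes exch: "\<And>\<pi>. \<pi> permutes {1..2*n} \<Longrightarrow> map_pmf (\<lambda>x. x \<circ> \<pi>) X = X" and \<alpha>: "0 \<le> \<alpha>"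
  shows "emeasure (measure_pmf X) {x. pmf_quantile (1 - \<alpha>) (perm_law n g x) < two_sample n g x} \<le> ennreal \<alpha>"
proof -
  let ?P = "{\<pi>. \<pi> permutes {1..2*n}}"
  let ?c = "\<lambda>x. pmf_quantile (1 - \<alpha>) (perm_law n g x)"
  let ?R = "{x. ?c x < two_sample n g x}"
  have "(\<integral>\<^sup>+\<pi>. emeasure (measure_pmf X) ?R \<partial>pmf_of_set ?P)
      = (\<integral>\<^sup>+\<pi>. (\<integral>\<^sup>+x. indicator ?R (x \<circ> \<pi>) \<partial>X) \<partial>pmf_of_set ?P)"
  proof (rule nn_integral_cong_AE, unfold AE_measure_pmf_iff, safe)
    fix \<pi> assume "\<pi> \<in> set_pmf (pmf_of_set ?P)"
    then have "\<pi> permutes {1..2*n}"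
      by (simp only: set_pmf_permutations mem_Collect_eq)
    then have "emeasure (measure_pmf X) ?R = emeasure (measure_pmf (map_pmf (\<lambda>x. x \<circ> \<pi>) X)) ?R"
      by (simp only: exch)
    moreover have "(\<lambda>x. indicator ?R (x \<circ> \<pi>) :: ennreal) = indicator ((\<lambda>x. x \<circ> \<pi>) -` ?R)"
      by (simp add: fun_eq_iff indicator_def)
    ultimately show "emeasure (measure_pmf X) ?R = (\<integral>\<^sup>+x. indicator ?R (x \<circ> \<pi>) \<partial>X)"
      by simp
  qed
  also have "\<dots> = (\<integral>\<^sup>+x. (\<integral>\<^sup>+\<pi>. indicator ?R (x \<circ> \<pi>) \<partial>pmf_of_set ?P) \<partial>X)"
    
  proof -
    \<comment> \<open>Fubini for discrete laws: both iterated integrals are integrals over the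
      product law, which is symmetric up to swapping coordinates.\<close>
    have "(\<integral>\<^sup>+\<pi>. (\<integral>\<^sup>+x. indicator ?R (x \<circ> \<pi>) \<partial>X) \<partial>pmf_of_set ?P)
        = (\<integral>\<^sup>+z. indicator ?R (snd z \<circ> fst z) \<partial>pair_pmf (pmf_of_set ?P) X)"
      by (simp add: nn_integral_pair_pmf')
    also have "\<dots> = (\<integral>\<^sup>+z. indicator ?R (fst z \<circ> snd z) \<partial>pair_pmf X (pmf_of_set ?P))"
      by (subst pair_commute_pmf) (simp add: case_prod_unfold)
    finally show ?thesis by (simp add: nn_integral_pair_pmf')
  qed
  also have "\<dots> \<le> (\<integral>\<^sup>+x. ennreal \<alpha> \<partial>X)"
  proof (rule nn_integral_mono)
    fix x :: "nat \<Rightarrow> 'b"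
    have "(\<integral>\<^sup>+\<pi>. indicator ?R (x \<circ> \<pi>) \<partial>pmf_of_set ?P)
        = (\<integral>\<^sup>+\<pi>. indicator {?c x<..} (two_sample n g (x \<circ> \<pi>)) \<partial>pmf_of_set ?P)"
    proof (rule nn_integral_cong_AE, unfold AE_measure_pmf_iff, rule ballI)
      fix \<pi> assume "\<pi> \<in> set_pmf (pmf_of_set ?P)"
      then have "\<pi> permutes {1..2*n}"
        by (simp only: set_pmf_permutations mem_Collect_eq)
      then show "indicator ?R (x \<circ> \<pi>) = (indicator {?c x<..} (two_sample n g (x \<circ> \<pi>)) :: ennreal)"
        by (simp add: perm_law_permute indicator_def)
    qed
    also have "\<dots> = emeasure (measure_pmf (perm_law n g x)) {?c x<..}"
    proof -
      have "(\<lambda>\<pi>. indicator {?c x<..} (two_sample n g (x \<circ> \<pi>)) :: ennreal)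
          = indicator ((\<lambda>\<pi>. two_sample n g (x \<circ> \<pi>)) -` {?c x<..})"
        by (simp add: fun_eq_iff indicator_def)
      moreover have "emeasure (measure_pmf (perm_law n g x)) {?c x<..}
          = emeasure (measure_pmf (pmf_of_set ?P)) ((\<lambda>\<pi>. two_sample n g (x \<circ> \<pi>)) -` {?c x<..})"
        unfolding perm_law_def[of n g x] by (rule emeasure_map_pmf)
      ultimately show ?thesis by simp
    qed
    also have "\<dots> \<le> ennreal \<alpha>"
      using prob_greater_pmf_quantile[OF finite_set_perm_law[of n g x], of "1 - \<alpha>"] \<alpha>
      by (simp add: measure_pmf.emeasure_eq_measure)
    finally show "(\<integral>\<^sup>+\<pi>. indicator ?R (x \<circ> \<pi>) \<partial>pmf_of_set ?P) \<le> ennreal \<alpha>" .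
  qed
  finally show ?thesis by simp
qed

section \<open>Reduction to the pooled sample\<close>

lemma sum_offdiag_first:
  fixes f :: "'a \<Rightarrow> real"
  assumes "finite A"
  shows "(\<Sum>a\<in>A. \<Sum>b\<in>A - {a}. f a) = (real (card A) - 1) * (\<Sum>a\<in>A. f a)"
  unfolding sum_offdiag[OF assms, of "\<lambda>a b. f a"]
  by (simp add: sum_distrib_left[symmetric] left_diff_distrib)

lemma sum_offdiag_second:
  fixes f :: "'a \<Rightarrow> real"
  assumes "finite A"
  shows "(\<Sum>a\<in>A. \<Sum>b\<in>A - {a}. f b) = (real (card A) - 1) * (\<Sum>a\<in>A. f a)"
  using assms by (simp add: sum_offdiag left_diff_distrib)

text \<open>Each of the four kernel terms ignores two of the four indices. A within-sample term is
  repeated n(n-1) times. A cross term is repeated (n-1)^2 times, and its two remaining indices range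
  freely, which is why the cross sum is not off-diagonal.\<close>

lemma U_stat_eq_two_sample:
  assumes n: "2 \<le> n" and y: "\<And>i. i \<in> {1..n} \<Longrightarrow> y i = x i"
    and z: "\<And>i. i \<in> {1..n} \<Longrightarrow> z i = x (n + i)"
  shows "U_stat d n w y z = two_sample n (g_kernel d w) x"
proof -
  let ?A = "{1..n}" and ?g = "g_kernel d w" and ?c = "real n - 1"
  have card: "real (card ?A) = real n" by simp
  have const: "(\<Sum>a\<in>?A. \<Sum>b\<in>?A - {a}. r) = ?c * (real n * r)" for r :: real
    by (subst sum_offdiag_first) simp_all
  let ?yy = "\<Sum>i\<in>?A. \<Sum>j\<in>?A - {i}. ?g (y i) (y j)"
  let ?zz = "\<Sum>i\<in>?A. \<Sum>j\<in>?A - {i}. ?g (z i) (z j)"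
  let ?yz = "\<Sum>i\<in>?A. \<Sum>j\<in>?A. ?g (y i) (z j)"
  have t1: "(\<Sum>i1\<in>?A. \<Sum>i2\<in>?A - {i1}. \<Sum>j1\<in>?A. \<Sum>j2\<in>?A - {j1}. ?g (y i1) (y i2)) = ?c * real n * ?yy"
    by (simp only: const sum_distrib_left mult.assoc)
  have t2: "(\<Sum>i1\<in>?A. \<Sum>i2\<in>?A - {i1}. \<Sum>j1\<in>?A. \<Sum>j2\<in>?A - {j1}. ?g (z j1) (z j2)) = ?c * real n * ?zz"
    by (simp only: const mult.assoc)
  have t3: "(\<Sum>i1\<in>?A. \<Sum>i2\<in>?A - {i1}. \<Sum>j1\<in>?A. \<Sum>j2\<in>?A - {j1}. ?g (y i1) (z j2)) = ?c * (?c * ?yz)"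
    by (simp only: sum_offdiag_second sum_offdiag_first card finite_atLeastAtMost sum_distrib_left)
  have t4: "(\<Sum>i1\<in>?A. \<Sum>i2\<in>?A - {i1}. \<Sum>j1\<in>?A. \<Sum>j2\<in>?A - {j1}. ?g (y i2) (z j1)) = ?c * (?c * ?yz)"
    by (simp only: sum_offdiag_first[OF finite_atLeastAtMost] card sum_distrib_left[symmetric])
      (simp only: sum_offdiag_second[OF finite_atLeastAtMost] card)
  have "U_stat d n w y z = (?c * real n * ?yy + ?c * real n * ?zz - ?c * (?c * ?yz) - ?c * (?c * ?yz))
      / ((real n)\<^sup>2 * ?c\<^sup>2)"
    unfolding t1[symmetric] t2[symmetric]
    unfolding U_stat_def h_kernel_def
    by (simp only: sum.distrib sum_subtractf t1 t2 t3 t4) simp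
  also have "\<dots> = (?yy + ?zz) / (real n * ?c) - 2 * ?yz / (real n)\<^sup>2"
  proof -
    have "(c * n * a + c * n * b - c * (c * e) - c * (c * e)) / (n\<^sup>2 * c\<^sup>2) = (a + b) / (n * c) - 2 * e / n\<^sup>2"
      if "n \<noteq> 0" "c \<noteq> 0" for a b c e n :: real
    proof -
      have "c * n * a / (n\<^sup>2 * c\<^sup>2) = a / (n * c)" "c * n * b / (n\<^sup>2 * c\<^sup>2) = b / (n * c)"
        "c * (c * e) / (n\<^sup>2 * c\<^sup>2) = e / n\<^sup>2"
        using that by (simp_all add: power2_eq_square)
      then show ?thesis by (simp add: add_divide_distrib diff_divide_distrib)
    qed
    moreover have "real n \<noteq> 0" "?c \<noteq> 0" using n by auto
    ultimately show ?thesis by blast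
  qed
  also have "\<dots> = two_sample n ?g x"
  proof -
    have "?yy = (\<Sum>i\<in>?A. \<Sum>j\<in>?A - {i}. ?g (x i) (x j))"
      using y by (intro sum.cong refl) auto
    moreover have "?zz = (\<Sum>i\<in>{n+1..2*n}. \<Sum>j\<in>{n+1..2*n} - {i}. ?g (x i) (x j))"
      unfolding upper_half_offdiag_reindex using z by (intro sum.cong refl) auto
    moreover have "?yz = (\<Sum>i\<in>?A. \<Sum>j\<in>{n+1..2*n}. ?g (x i) (x j))"
      unfolding upper_half_reindex using y z by (intro sum.cong refl) auto
    ultimately show ?thesis by (simp only: two_sample_def)
  qed
  finally show ?thesis .
qed

lemma two_sample_cong:
  assumes "\<And>i. i \<in> {1..2*n} \<Longrightarrow> x i = x' i"
  shows "two_sample n g x = two_sample n g x'"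
  unfolding two_sample_def
  by (intro arg_cong2[where f = "(-)"] arg_cong2[where f = "(/)"] arg_cong2[where f = "(+)"]
      arg_cong2[where f = "(*)"] sum.cong refl) (auto simp: assms)

lemma perm_law_cong:
  assumes "\<And>i. i \<in> {1..2*n} \<Longrightarrow> x i = x' i"
  shows "perm_law n g x = perm_law n g x'"
  unfolding perm_law_def
proof (rule map_pmf_cong[OF refl])
  fix \<pi> assume "\<pi> \<in> set_pmf (pmf_of_set {\<pi>. \<pi> permutes {1..2*n}})"
  then have "\<pi> permutes {1..2*n}" by (simp only: set_pmf_permutations mem_Collect_eq)
  then show "two_sample n g (x \<circ> \<pi>) = two_sample n g (x' \<circ> \<pi>)"
    by (intro two_sample_cong) (simp only: comp_def assms permutes_in_image)
qed

lemma split_weight_cong: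
  assumes "\<And>i. i \<in> {n2+1..2*n2} \<Longrightarrow> z i = z' i"
  shows "split_weight d n2 z = split_weight d n2 z'"
  unfolding split_weight_def Let_def
  by (intro ext arg_cong2[where f = "(+)"] arg_cong2[where f = "(*)"] sum.cong refl) (auto simp: assms)

lemma emeasure_pair_pmf:
  "emeasure (measure_pmf (pair_pmf A B)) E = (\<integral>\<^sup>+a. emeasure (measure_pmf B) (Pair a -` E) \<partial>A)"
proof -
  have "emeasure (measure_pmf (pair_pmf A B)) E = (\<integral>\<^sup>+z. indicator E z \<partial>pair_pmf A B)" by simp
  also have "\<dots> = (\<integral>\<^sup>+a. \<integral>\<^sup>+b. indicator (Pair a -` E) b \<partial>B \<partial>A)"
    unfolding nn_integral_pair_pmf' by (simp add: indicator_def)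
  finally show ?thesis by simp
qed

text \<open>The weights read z only on this block, and the statistic reads only what
  \<open>pooled_part\<close> keeps. Resetting the other positions to 0 makes the law of each part
  exactly a \<open>Pi_pmf\<close> with default 0.\<close>

definition weight_part :: "nat \<Rightarrow> (nat \<Rightarrow> nat) \<Rightarrow> nat \<Rightarrow> nat" where
  "weight_part n2 z i = (if i \<in> {n2+1..2*n2} then z i else 0)"

definition pooled_part :: "nat \<Rightarrow> (nat \<Rightarrow> nat) \<Rightarrow> (nat \<Rightarrow> nat) \<Rightarrow> nat \<Rightarrow> nat" where
  "pooled_part n1 y z i = (if i \<in> {1..2*n1} then pooled n1 y z i else 0)"

lemma U_split_eq:
  assumes "2 \<le> n1"
  shows "U_split d n1 n2 y z
    = two_sample n1 (g_kernel d (split_weight d n2 (weight_part n2 z))) (pooled_part n1 y z)"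
proof -
  have "split_weight d n2 z = split_weight d n2 (weight_part n2 z)"
    by (rule split_weight_cong) (simp add: weight_part_def)
  then show ?thesis
    unfolding U_split_def using assms
    by (simp only:) (rule U_stat_eq_two_sample; simp add: pooled_part_def pooled_def)
qed

lemma crit_value_eq:
  assumes "2 \<le> n1"
  shows "crit_value d n1 n2 \<alpha> y z = pmf_quantile (1 - \<alpha>)
    (perm_law n1 (g_kernel d (split_weight d n2 (weight_part n2 z))) (pooled_part n1 y z))"
proof -
  have w: "split_weight d n2 z = split_weight d n2 (weight_part n2 z)"
    by (rule split_weight_cong) (simp add: weight_part_def)
  have "U_perm d n1 n2 y z \<pi> = two_sample n1 (g_kernel d (split_weight d n2 (weight_part n2 z))) (pooled n1 y z \<circ> \<pi>)" for \<pi>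
    unfolding U_perm_def w using assms by (rule U_stat_eq_two_sample) simp_all
  then have "perm_dist d n1 n2 y z
      = perm_law n1 (g_kernel d (split_weight d n2 (weight_part n2 z))) (pooled n1 y z)"
    unfolding perm_dist_def perm_law_def by presburger
  also have "\<dots> = perm_law n1 (g_kernel d (split_weight d n2 (weight_part n2 z))) (pooled_part n1 y z)"
    by (rule perm_law_cong) (simp add: pooled_part_def)
  finally show ?thesis unfolding crit_value_def pmf_quantile_def by simp
qed

definition sample_law :: "nat \<Rightarrow> 'b pmf \<Rightarrow> 'b pmf \<Rightarrow> nat \<Rightarrow> 'b pmf" where
  "sample_law n pY pZ i = (if i \<le> n then pY else pZ)"

text \<open>Since n1 <= n2, the z-observations in the pooled sample precede the block read by the
  weights. The two parts are therefore functions of disjoint groups of independent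
  observations.\<close>

lemma map_pmf_data_pmf:
  assumes "n1 \<le> n2"
  shows "map_pmf (\<lambda>(y, z). (weight_part n2 z, pooled_part n1 y z)) (data_pmf n1 n2 (pY, pZ))
    = pair_pmf (Pi_pmf {n2+1..2*n2} 0 (\<lambda>_. pZ)) (Pi_pmf {1..2*n1} 0 (sample_law n1 pY pZ))"
proof -
  let ?W = "Pi_pmf {n2+1..2*n2} 0 (\<lambda>_. pZ)" and ?Z = "Pi_pmf {1..n2} 0 (\<lambda>_. pZ)"
  let ?Y = "Pi_pmf {1..2*n1} 0 (\<lambda>_. pY)"
  let ?j = "\<lambda>y z i. if i \<in> {1..n1} then y i else if i \<in> {n1+1..2*n1} then z (i - n1) else (0::nat)"
  have Zall: "Pi_pmf {1..2*n2} 0 (\<lambda>_. pZ)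
      = map_pmf (\<lambda>(f, g) i. if i \<in> {1..n2} then f i else g i) (pair_pmf ?Z ?W)"
  proof -
    have "{1..2*n2} = {1..n2} \<union> {n2+1..2*n2}" by auto
    then show ?thesis by (simp only:) (rule Pi_pmf_union; auto)
  qed
  have "map_pmf (\<lambda>(y, z). (weight_part n2 z, pooled_part n1 y z)) (data_pmf n1 n2 (pY, pZ))
      = map_pmf (\<lambda>(y, f, g). (g, ?j y f)) (pair_pmf ?Y (pair_pmf ?Z ?W))"
    unfolding data_pmf_def fst_conv snd_conv Zall pair_map_pmf2 map_pmf_comp
  proof (rule map_pmf_cong[OF refl])
    fix t assume "t \<in> set_pmf (pair_pmf ?Y (pair_pmf ?Z ?W))"
    then obtain y f g where t: "t = (y, f, g)" and g: "g \<in> set_pmf ?W"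
      by (cases t) auto
    \<comment> \<open>On the support of its law g takes the default 0 outside the block, which is
      what makes \<open>weight_part\<close> return g itself.\<close>
    from g have "g i = 0" if "i \<notin> {n2+1..2*n2}" for i
      using set_Pi_pmf_subset[of "{n2+1..2*n2}" "0::nat" "\<lambda>_. pZ"] that by blast
    then have "weight_part n2 (\<lambda>i. if i \<in> {1..n2} then f i else g i) = g"
      by (auto simp: weight_part_def fun_eq_iff)
    moreover have "pooled_part n1 y (\<lambda>i. if i \<in> {1..n2} then f i else g i) = ?j y f"
      using assms by (auto simp: pooled_part_def pooled_def fun_eq_iff)
    ultimately show "(case apsnd (\<lambda>(f, g) i. if i \<in> {1..n2} then f i else g i) t of
        (y, z) \<Rightarrow> (weight_part n2 z, pooled_part n1 y z)) = (case t of (y, f, g) \<Rightarrow> (g, ?j y f))"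
      unfolding t by (simp only: apsnd_conv prod.case)
  qed
  moreover have "Pi_pmf {1..2*n1} 0 (sample_law n1 pY pZ)
      = map_pmf (\<lambda>(y, f). ?j y f) (pair_pmf ?Y ?Z)"
  proof -
    have Y: "Pi_pmf {1..n1} 0 (sample_law n1 pY pZ) = map_pmf (\<lambda>y i. if i \<in> {1..n1} then y i else 0) ?Y"
      by (subst Pi_pmf_subset[symmetric]) (auto intro!: Pi_pmf_cong simp: sample_law_def)
    have "Pi_pmf {n1+1..2*n1} 0 (sample_law n1 pY pZ) = Pi_pmf {n1+1..2*n1} 0 (\<lambda>_. pZ)"
      by (rule Pi_pmf_cong) (auto simp: sample_law_def)
    also have "\<dots> = map_pmf (\<lambda>f. f \<circ> (\<lambda>i. i - n1)) (Pi_pmf {1..n1} 0 (\<lambda>_. pZ))"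
    proof (rule Pi_pmf_bij_betw)
      show "bij_betw (\<lambda>i. i - n1) {n1+1..2*n1} {1..n1}"
        by (rule bij_betw_byWitness[where f' = "\<lambda>i. i + n1"]) auto
    qed auto
    also have "Pi_pmf {1..n1} 0 (\<lambda>_. pZ) = map_pmf (\<lambda>f i. if i \<in> {1..n1} then f i else 0) ?Z"
      using assms by (intro Pi_pmf_subset) auto
    finally have Z: "Pi_pmf {n1+1..2*n1} 0 (sample_law n1 pY pZ)
        = map_pmf (\<lambda>f i. if i - n1 \<in> {1..n1} then f (i - n1) else 0) ?Z"
      by (simp add: map_pmf_comp comp_def)
    have "{1..2*n1} = {1..n1} \<union> {n1+1..2*n1}" by auto
    then have "Pi_pmf {1..2*n1} 0 (sample_law n1 pY pZ)
        = map_pmf (\<lambda>(f, g) i. if i \<in> {1..n1} then f i else g i)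
          (pair_pmf (Pi_pmf {1..n1} 0 (sample_law n1 pY pZ)) (Pi_pmf {n1+1..2*n1} 0 (sample_law n1 pY pZ)))"
      by (simp only:) (rule Pi_pmf_union; auto)
    also have "\<dots> = map_pmf (\<lambda>(y, f). ?j y f) (pair_pmf ?Y ?Z)"
      unfolding Y Z map_pair[symmetric] map_pmf_comp
      by (rule map_pmf_cong[OF refl]) (auto simp: fun_eq_iff)
    finally show ?thesis .
  qed
  moreover have "pair_pmf ?W (map_pmf (\<lambda>(y, f). ?j y f) (pair_pmf ?Y ?Z))
      = map_pmf (\<lambda>(y, f, g). (g, ?j y f)) (pair_pmf ?Y (pair_pmf ?Z ?W))"
    by (subst pair_commute_pmf) (simp add: pair_pmf_def map_pmf_def bind_assoc_pmf bind_return_pmf)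
  ultimately show ?thesis by simp
qed

text \<open>Once the weight block v is fixed, so is the kernel, and the pooled sample is i.i.d. and
  hence exchangeable. The conditional level bound is then integrated over v.\<close>

lemma type_I_error:
  assumes "2 \<le> n1" "n1 \<le> n2" "0 \<le> \<alpha>"
  shows "emeasure (measure_pmf (data_pmf n1 n2 (p, p)))
    {(y, z). U_split d n1 n2 y z > crit_value d n1 n2 \<alpha> y z} \<le> ennreal \<alpha>"
proof -
  let ?g = "\<lambda>v. g_kernel d (split_weight d n2 v)"
  let ?E = "{(v, x). pmf_quantile (1 - \<alpha>) (perm_law n1 (?g v) x) < two_sample n1 (?g v) x}"
  let ?X = "Pi_pmf {1..2*n1} 0 (\<lambda>_. p)" and ?V = "Pi_pmf {n2+1..2*n2} 0 (\<lambda>_. p)"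
  have X: "Pi_pmf {1..2*n1} 0 (sample_law n1 p p) = ?X"
    by (rule Pi_pmf_cong) (auto simp: sample_law_def)
  have exch: "map_pmf (\<lambda>x. x \<circ> \<pi>) ?X = ?X" if "\<pi> permutes {1..2*n1}" for \<pi>
    using that by (intro Pi_pmf_bij_betw[symmetric]) (auto simp: permutes_imp_bij permutes_not_in)
  have "{(y, z). U_split d n1 n2 y z > crit_value d n1 n2 \<alpha> y z}
      = (\<lambda>(y, z). (weight_part n2 z, pooled_part n1 y z)) -` ?E"
    using assms by (auto simp: U_split_eq crit_value_eq)
  then have "emeasure (measure_pmf (data_pmf n1 n2 (p, p))) {(y, z). U_split d n1 n2 y z > crit_value d n1 n2 \<alpha> y z}
      = emeasure (measure_pmf (map_pmf (\<lambda>(y, z). (weight_part n2 z, pooled_part n1 y z)) (data_pmf n1 n2 (p, p)))) ?E"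
    by simp
  also have "\<dots> = emeasure (measure_pmf (pair_pmf ?V ?X)) ?E"
    by (simp only: map_pmf_data_pmf[OF assms(2)] X)
  also have "\<dots> = (\<integral>\<^sup>+v. emeasure (measure_pmf ?X) (Pair v -` ?E) \<partial>?V)"
    by (rule emeasure_pair_pmf)
  also have "\<dots> \<le> (\<integral>\<^sup>+v. ennreal \<alpha> \<partial>?V)"
  proof (rule nn_integral_mono)
    fix v
    have "Pair v -` ?E = {x. pmf_quantile (1 - \<alpha>) (perm_law n1 (?g v) x) < two_sample n1 (?g v) x}"
      by auto
    then show "emeasure (measure_pmf ?X) (Pair v -` ?E) \<le> ennreal \<alpha>"
      using exchangeable_permutation_test[of n1 ?X \<alpha> "?g v", OF exch assms(3)] by simp
  qed
  finally show ?thesis by simp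
qed

section \<open>The Efron--Stein inequality\<close>

lemma finite_set_Pi_pmf:
  assumes "finite A" "\<And>i. i \<in> A \<Longrightarrow> finite (set_pmf (p i))"
  shows "finite (set_pmf (Pi_pmf A d p))"
  unfolding set_Pi_pmf[OF assms(1)] using assms by (intro finite_PiE_dflt) auto

lemma expectation_pair_pmf_finite:
  fixes f :: "'a \<times> 'b \<Rightarrow> real"
  assumes "finite (set_pmf P)" "finite (set_pmf Q)"
  shows "measure_pmf.expectation (pair_pmf P Q) f
    = measure_pmf.expectation P (\<lambda>a. measure_pmf.expectation Q (\<lambda>b. f (a, b)))"
proof -
  have "measure_pmf.expectation (pair_pmf P Q) f
      = (\<Sum>z\<in>set_pmf P \<times> set_pmf Q. f z * pmf (pair_pmf P Q) z)"
    using assms by (intro integral_measure_pmf_real) auto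
  also have "\<dots> = (\<Sum>a\<in>set_pmf P. (\<Sum>b\<in>set_pmf Q. f (a, b) * pmf Q b) * pmf P a)"
    unfolding sum.cartesian_product' by (simp add: pmf_pair sum_distrib_left sum_distrib_right mult_ac)
  also have "\<dots> = (\<Sum>a\<in>set_pmf P. measure_pmf.expectation Q (\<lambda>b. f (a, b)) * pmf P a)"
    using assms by (intro sum.cong refl arg_cong2[where f = "(*)"] integral_measure_pmf_real[symmetric]) auto
  also have "\<dots> = measure_pmf.expectation P (\<lambda>a. measure_pmf.expectation Q (\<lambda>b. f (a, b)))"
    using assms by (intro integral_measure_pmf_real[symmetric]) auto
  finally show ?thesis .
qed

lemma expectation_Pi_pmf_insert:
  fixes f :: "('i \<Rightarrow> 'a) \<Rightarrow> real"
  assumes "finite A" "a \<notin> A" "\<And>i. i \<in> insert a A \<Longrightarrow> finite (set_pmf (p i))"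
  shows "measure_pmf.expectation (Pi_pmf (insert a A) d p) f
    = measure_pmf.expectation (p a) (\<lambda>u. measure_pmf.expectation (Pi_pmf A d p) (\<lambda>x. f (x(a := u))))"
proof -
  have "finite (set_pmf (Pi_pmf A d p))" using assms by (intro finite_set_Pi_pmf) auto
  then show ?thesis
    unfolding Pi_pmf_insert[OF assms(1,2)] using assms
    by (simp add: expectation_pair_pmf_finite)
qed

lemma expectation_Pi_pmf_component:
  fixes f :: "'a \<Rightarrow> real"
  assumes "finite A" "i \<in> A"
  shows "measure_pmf.expectation (Pi_pmf A d p) (\<lambda>x. f (x i)) = measure_pmf.expectation (p i) f"
proof -
  have "measure_pmf.expectation (p i) f = measure_pmf.expectation (map_pmf (\<lambda>x. x i) (Pi_pmf A d p)) f"
    using Pi_pmf_component[OF assms(1), of i d p] assms(2) by simp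
  then show ?thesis by simp
qed

lemma expectation_Pi_pmf_two:
  fixes f :: "'a \<Rightarrow> 'a \<Rightarrow> real"
  assumes "finite A" "i \<in> A" "j \<in> A" "i \<noteq> j" "\<And>i. i \<in> A \<Longrightarrow> finite (set_pmf (p i))"
  shows "measure_pmf.expectation (Pi_pmf A d p) (\<lambda>x. f (x i) (x j))
    = measure_pmf.expectation (p i) (\<lambda>u. measure_pmf.expectation (p j) (\<lambda>v. f u v))"
proof -
  have A: "A = insert i (A - {i})" using assms by auto
  have "measure_pmf.expectation (Pi_pmf (insert i (A - {i})) d p) (\<lambda>x. f (x i) (x j))
    = measure_pmf.expectation (p i) (\<lambda>u. measure_pmf.expectation (Pi_pmf (A - {i}) d p)
        (\<lambda>x. f ((x(i := u)) i) ((x(i := u)) j)))"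
    using assms by (intro expectation_Pi_pmf_insert) auto
  also have "\<dots> = measure_pmf.expectation (p i) (\<lambda>u. measure_pmf.expectation (p j) (\<lambda>v. f u v))"
    using assms by (simp add: expectation_Pi_pmf_component)
  finally show ?thesis using A by simp
qed

lemma expectation_centered_square:
  fixes f :: "'a \<Rightarrow> real"
  assumes "finite (set_pmf P)"
  shows "measure_pmf.expectation P (\<lambda>x. (f x - measure_pmf.expectation P f)\<^sup>2)
    = measure_pmf.expectation P (\<lambda>x. (f x)\<^sup>2) - (measure_pmf.expectation P f)\<^sup>2"
proof -
  note [simp] = integrable_measure_pmf_finite[OF assms]
  show ?thesis by (simp add: power2_diff) (simp add: power2_eq_square)
qed

lemma expectation_square_ge:
  fixes f :: "'a \<Rightarrow> real"
  assumes "finite (set_pmf P)"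
  shows "(measure_pmf.expectation P f)\<^sup>2 \<le> measure_pmf.expectation P (\<lambda>x. (f x)\<^sup>2)"
proof -
  have "0 \<le> measure_pmf.expectation P (\<lambda>x. (f x - measure_pmf.expectation P f)\<^sup>2)" by simp
  then show ?thesis by (simp add: expectation_centered_square[OF assms])
qed

lemma expectation_double_sum:
  fixes f :: "'i \<Rightarrow> 'j \<Rightarrow> 'a \<Rightarrow> real"
  assumes "finite (set_pmf P)"
  shows "measure_pmf.expectation P (\<lambda>x. \<Sum>i\<in>I. \<Sum>j\<in>J i. c i j * f i j x)
    = (\<Sum>i\<in>I. \<Sum>j\<in>J i. c i j * measure_pmf.expectation P (f i j))"
  by (simp add: integrable_measure_pmf_finite[OF assms])

lemma expectation_affine:
  fixes f :: "'a \<Rightarrow> real"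
  assumes "finite (set_pmf P)"
  shows "measure_pmf.expectation P (\<lambda>x. a + b * (r * f x + s)) = a + b * (r * measure_pmf.expectation P f + s)"
  by (simp add: integrable_measure_pmf_finite[OF assms])

lemma expectation_mono_finite:
  fixes f g :: "'a \<Rightarrow> real"
  assumes "finite (set_pmf P)" "\<And>x. x \<in> set_pmf P \<Longrightarrow> f x \<le> g x"
  shows "measure_pmf.expectation P f \<le> measure_pmf.expectation P g"
  using assms by (intro integral_mono_AE integrable_measure_pmf_finite) (auto simp: AE_measure_pmf_iff)

text \<open>The comparison function \<open>c i\<close> may be any function that ignores coordinate
  i. Inductively, the variance is the mean conditional variance given coordinate a plus the variance
  of the conditional mean m. The first part is the induction hypothesis. The second is at most the
  second moment of m about the constant k, the mean of \<open>c a\<close>, and Jensen's inequality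
  bounds that moment.\<close>

lemma Efron_Stein:
  fixes f :: "('i \<Rightarrow> 'a) \<Rightarrow> real"
  assumes "finite A" "\<And>i. i \<in> A \<Longrightarrow> finite (set_pmf (p i))"
    and "\<And>i x u. i \<in> A \<Longrightarrow> c i (x(i := u)) = c i x"
  shows "measure_pmf.expectation (Pi_pmf A d p) (\<lambda>x. (f x)\<^sup>2)
      - (measure_pmf.expectation (Pi_pmf A d p) f)\<^sup>2
    \<le> (\<Sum>i\<in>A. measure_pmf.expectation (Pi_pmf A d p) (\<lambda>x. (f x - c i x)\<^sup>2))"
  using assms
proof (induction A arbitrary: f c rule: finite_induct)
  case empty
  then show ?case by simp
next
  case (insert a A)
  let ?E = "measure_pmf.expectation (Pi_pmf A d p)" and ?Ea = "measure_pmf.expectation (p a)"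
  have fin: "finite (set_pmf (Pi_pmf A d p))" "finite (set_pmf (p a))"
    using insert.hyps insert.prems(1) by (auto intro!: finite_set_Pi_pmf)
  note [simp] = integrable_measure_pmf_finite[OF fin(1)] integrable_measure_pmf_finite[OF fin(2)]
  have ins: "measure_pmf.expectation (Pi_pmf (insert a A) d p) h = ?Ea (\<lambda>u. ?E (\<lambda>x. h (x(a := u))))"
    for h :: "('i \<Rightarrow> 'a) \<Rightarrow> real"
    using insert.hyps insert.prems(1) by (intro expectation_Pi_pmf_insert) auto
  define m where "m u = ?E (\<lambda>x. f (x(a := u)))" for u
  define k where "k = ?E (c a)"
  have IH: "?E (\<lambda>x. (f (x(a := u)))\<^sup>2) - (m u)\<^sup>2
      \<le> (\<Sum>i\<in>A. ?E (\<lambda>x. (f (x(a := u)) - c i (x(a := u)))\<^sup>2))" for u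
    unfolding m_def
  proof (rule insert.IH)
    fix i x v assume "i \<in> A"
    then have "x(i := v, a := u) = (x(a := u))(i := v)" using insert.hyps by (auto simp: fun_eq_iff)
    then have "c i (x(i := v, a := u)) = c i ((x(a := u))(i := v))" by (simp only:)
    also have "\<dots> = c i (x(a := u))" using \<open>i \<in> A\<close> by (intro insert.prems(2)) simp
    finally show "c i (x(i := v, a := u)) = c i (x(a := u))" .
  qed (use insert.prems(1) in auto)
  have "?Ea (\<lambda>u. (m u)\<^sup>2) - (?Ea m)\<^sup>2 \<le> ?Ea (\<lambda>u. (m u - k)\<^sup>2)"
  proof -
    have "?Ea (\<lambda>u. (m u - k)\<^sup>2) - (?Ea (\<lambda>u. (m u)\<^sup>2) - (?Ea m)\<^sup>2) = (?Ea m - k)\<^sup>2"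
      by (simp add: power2_diff)
    moreover have "0 \<le> (?Ea m - k)\<^sup>2" by simp
    ultimately show ?thesis by linarith
  qed
  also have "\<dots> \<le> ?Ea (\<lambda>u. ?E (\<lambda>x. (f (x(a := u)) - c a (x(a := u)))\<^sup>2))"
  proof (rule expectation_mono_finite[OF fin(2)])
    fix u
    have "c a (x(a := u)) = c a x" for x by (rule insert.prems(2)) simp
    then have "m u - k = ?E (\<lambda>x. f (x(a := u)) - c a (x(a := u)))"
      unfolding m_def k_def by simp
    then show "(m u - k)\<^sup>2 \<le> ?E (\<lambda>x. (f (x(a := u)) - c a (x(a := u)))\<^sup>2)"
      by (simp only: expectation_square_ge[OF fin(1)])
  qed
  finally have last: "?Ea (\<lambda>u. (m u)\<^sup>2) - (?Ea m)\<^sup>2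
      \<le> ?Ea (\<lambda>u. ?E (\<lambda>x. (f (x(a := u)) - c a (x(a := u)))\<^sup>2))" .
  have "?Ea (\<lambda>u. ?E (\<lambda>x. (f (x(a := u)))\<^sup>2) - (m u)\<^sup>2)
      \<le> ?Ea (\<lambda>u. \<Sum>i\<in>A. ?E (\<lambda>x. (f (x(a := u)) - c i (x(a := u)))\<^sup>2))"
    by (rule expectation_mono_finite[OF fin(2) IH])
  then have "?Ea (\<lambda>u. ?E (\<lambda>x. (f (x(a := u)))\<^sup>2)) - ?Ea (\<lambda>u. (m u)\<^sup>2)
      \<le> (\<Sum>i\<in>A. ?Ea (\<lambda>u. ?E (\<lambda>x. (f (x(a := u)) - c i (x(a := u)))\<^sup>2)))"
    by simp
  with last have "?Ea (\<lambda>u. ?E (\<lambda>x. (f (x(a := u)))\<^sup>2)) - (?Ea m)\<^sup>2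
      \<le> (\<Sum>i\<in>insert a A. ?Ea (\<lambda>u. ?E (\<lambda>x. (f (x(a := u)) - c i (x(a := u)))\<^sup>2)))"
    using insert.hyps by simp
  moreover have "m = (\<lambda>u. ?E (\<lambda>x. f (x(a := u))))" by (simp add: fun_eq_iff m_def)
  ultimately show ?case by (simp only: ins)
qed

text \<open>Variance plus squared mean: products of distinct indicators factor by independence, and
  the variance of an indicator is at most its mean. In the computation this means adding the missing
  squares on the diagonal.\<close>

lemma second_moment_indicator_sum:
  assumes "finite A" "\<And>i. i \<in> A \<Longrightarrow> finite (set_pmf (p i))"
  shows "measure_pmf.expectation (Pi_pmf A d p) (\<lambda>x. (\<Sum>j\<in>A. a j * of_bool (x j = u))\<^sup>2)
    \<le> (\<Sum>j\<in>A. (a j)\<^sup>2 * pmf (p j) u) + (\<Sum>j\<in>A. a j * pmf (p j) u)\<^sup>2"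
proof -
  let ?E = "measure_pmf.expectation (Pi_pmf A d p)"
  let ?q = "\<lambda>j. pmf (p j) u"
  note [simp] = integrable_measure_pmf_finite[OF finite_set_Pi_pmf[OF assms]]
  have ind: "measure_pmf.expectation (p j) (\<lambda>v. of_bool (v = u)) = ?q j" for j
  proof -
    have "measure_pmf.expectation (p j) (\<lambda>v. of_bool (v = u) :: real)
        = measure_pmf.expectation (p j) (indicator {u})"
      by (intro Bochner_Integration.integral_cong) (auto simp: indicator_def)
    then show ?thesis by (simp add: measure_pmf_single)
  qed
  have cov: "?E (\<lambda>x. of_bool (x j = u) * of_bool (x l = u)) = (if j = l then ?q j else ?q j * ?q l)"
    if "j \<in> A" "l \<in> A" for j l
  proof (cases "j = l")
    case True
    then show ?thesis
      using expectation_Pi_pmf_component[OF assms(1) that(1), of d p "\<lambda>v. of_bool (v = u)"] by (simp add: ind of_bool_conj[symmetric])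
  next
    case False
    then show ?thesis
      using expectation_Pi_pmf_two[OF assms(1) that False assms(2),
        where d = d and f = "\<lambda>v w. of_bool (v = u) * of_bool (w = u)"]
      by (simp add: ind)
  qed
  have "?E (\<lambda>x. (\<Sum>j\<in>A. a j * of_bool (x j = u))\<^sup>2)
      = ?E (\<lambda>x. \<Sum>j\<in>A. \<Sum>l\<in>A. a j * a l * (of_bool (x j = u) * of_bool (x l = u)))"
    by (simp add: power2_eq_square sum_product mult_ac)
  also have "\<dots> = (\<Sum>j\<in>A. \<Sum>l\<in>A. a j * a l * ?E (\<lambda>x. of_bool (x j = u) * of_bool (x l = u)))"
    by simp
  also have "\<dots> = (\<Sum>j\<in>A. \<Sum>l\<in>A. a j * a l * (if j = l then ?q j else ?q j * ?q l))"
    by (intro sum.cong refl) (simp only: cov)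
  also have "\<dots> \<le> (\<Sum>j\<in>A. \<Sum>l\<in>A. (if l = j then (a j)\<^sup>2 * ?q j else 0) + (a j * ?q j) * (a l * ?q l))"
  proof (intro sum_mono)
    fix j l
    show "a j * a l * (if j = l then ?q j else ?q j * ?q l)
        \<le> (if l = j then (a j)\<^sup>2 * ?q j else 0) + (a j * ?q j) * (a l * ?q l)"
      using zero_le_square[of "a j * ?q j"] by (auto simp: power2_eq_square mult_ac)
  qed
  also have "\<dots> = (\<Sum>j\<in>A. (a j)\<^sup>2 * ?q j) + (\<Sum>j\<in>A. a j * ?q j)\<^sup>2"
    using assms(1) by (simp add: sum.distrib sum_product power2_eq_square[of "sum _ _"])
  finally show ?thesis .
qed

section \<open>Mean and variance of the statistic\<close>

text \<open>Coefficients of the statistic as a quadratic form over ordered pairs: the factor 2/n^2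
  of the cross term is shared equally by (i, j) and (j, i).\<close>

definition half_coeff :: "nat \<Rightarrow> nat \<Rightarrow> nat \<Rightarrow> real" where
  "half_coeff n i j = (if (i \<le> n) = (j \<le> n) then 1 / (real n * (real n - 1)) else - 1 / (real n)\<^sup>2)"

definition diag_kernel :: "('b \<Rightarrow> real) \<Rightarrow> 'b \<Rightarrow> 'b \<Rightarrow> real" where
  "diag_kernel W a b = W a * of_bool (a = b)"

definition separation :: "'b set \<Rightarrow> ('b \<Rightarrow> real) \<Rightarrow> 'b pmf \<Rightarrow> 'b pmf \<Rightarrow> real" where
  "separation D W pY pZ = (\<Sum>u\<in>D. W u * (pmf pY u - pmf pZ u)\<^sup>2)"

definition square_mass :: "'b set \<Rightarrow> ('b \<Rightarrow> real) \<Rightarrow> 'b pmf \<Rightarrow> 'b pmf \<Rightarrow> real" where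
  "square_mass D W pY pZ = (\<Sum>u\<in>D. (W u)\<^sup>2 * ((pmf pY u)\<^sup>2 + (pmf pZ u)\<^sup>2))"

lemma diag_kernel_commute: "diag_kernel W a b = diag_kernel W b a"
  by (simp add: diag_kernel_def)

lemma half_coeff_commute: "half_coeff n i j = half_coeff n j i"
  by (simp add: half_coeff_def eq_commute)

lemma two_sample_quadratic:
  assumes sym: "\<And>a b. g a b = g b a"
  shows "two_sample n g x = (\<Sum>i\<in>{1..2*n}. \<Sum>j\<in>{1..2*n} - {i}. half_coeff n i j * g (x i) (x j))"
proof -
  let ?A = "{1..n}" and ?B = "{n+1..2*n}" and ?h = "\<lambda>i j. half_coeff n i j * g (x i) (x j)"
  let ?s = "1 / (real n * (real n - 1))" and ?c = "- 1 / (real n)\<^sup>2"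
  have I: "{1..2*n} = ?A \<union> ?B" by auto
  have AA: "(\<Sum>i\<in>?A. \<Sum>j\<in>?A - {i}. ?h i j) = ?s * (\<Sum>i\<in>?A. \<Sum>j\<in>?A - {i}. g (x i) (x j))"
    unfolding sum_distrib_left by (intro sum.cong refl) (auto simp: half_coeff_def)
  have BB: "(\<Sum>i\<in>?B. \<Sum>j\<in>?B - {i}. ?h i j) = ?s * (\<Sum>i\<in>?B. \<Sum>j\<in>?B - {i}. g (x i) (x j))"
    unfolding sum_distrib_left by (intro sum.cong refl) (auto simp: half_coeff_def)
  have AB: "(\<Sum>i\<in>?A. \<Sum>j\<in>?B. ?h i j) = ?c * (\<Sum>i\<in>?A. \<Sum>j\<in>?B. g (x i) (x j))"
    unfolding sum_distrib_left by (intro sum.cong refl) (auto simp: half_coeff_def)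
  have BA: "(\<Sum>i\<in>?B. \<Sum>j\<in>?A. ?h i j) = ?c * (\<Sum>i\<in>?A. \<Sum>j\<in>?B. g (x i) (x j))"
    unfolding sum_distrib_left
  proof (subst sum.swap, intro sum.cong refl)
    fix i j assume "i \<in> ?A" "j \<in> ?B"
    then show "?h j i = ?c * g (x i) (x j)"
      using sym[of "x i" "x j"] by (auto simp: half_coeff_def)
  qed
  have "(\<Sum>i\<in>{1..2*n}. \<Sum>j\<in>{1..2*n} - {i}. ?h i j)
      = (\<Sum>i\<in>?A. \<Sum>j\<in>?A - {i}. ?h i j) + (\<Sum>i\<in>?A. \<Sum>j\<in>?B. ?h i j)
        + (\<Sum>i\<in>?B. \<Sum>j\<in>?A. ?h i j) + (\<Sum>i\<in>?B. \<Sum>j\<in>?B - {i}. ?h i j)"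
    unfolding I by (rule sum_offdiag_Un) auto
  also have "\<dots> = two_sample n g x"
    unfolding AA BB AB BA two_sample_def by (simp add: add_divide_distrib)
  finally show ?thesis by simp
qed

text \<open>Row i meets n-1 other indices in its own half and n in the opposite half.\<close>

lemma row_sum:
  fixes s t :: real
  assumes "i \<in> {1..2*n}"
  shows "(\<Sum>j\<in>{1..2*n} - {i}. if (i \<le> n) = (j \<le> n) then s else t) = (real n - 1) * s + real n * t"
proof -
  let ?f = "\<lambda>j. if (i \<le> n) = (j \<le> n) then s else t"
  have I: "{1..2*n} = {1..n} \<union> {n+1..2*n}" by auto
  have "(\<Sum>j\<in>{1..2*n}. ?f j) = (\<Sum>j\<in>{1..n}. ?f j) + (\<Sum>j\<in>{n+1..2*n}. ?f j)"
    unfolding I by (rule sum.union_disjoint) auto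
  also have "(\<Sum>j\<in>{1..n}. ?f j) = (\<Sum>j\<in>{1..n}. if i \<le> n then s else t)"
    by (intro sum.cong refl) auto
  also have "(\<Sum>j\<in>{n+1..2*n}. ?f j) = (\<Sum>j\<in>{n+1..2*n}. if i \<le> n then t else s)"
    by (intro sum.cong refl) auto
  finally have "(\<Sum>j\<in>{1..2*n}. ?f j) = real n * s + real n * t" by simp
  then show ?thesis using assms by (simp add: sum_diff1 left_diff_distrib)
qed

text \<open>Serves to compute the mean of the statistic: on a sample that is constant on each half,
  the within parts give a^2 + b^2 and the cross part 2ab.\<close>

lemma two_sample_times:
  assumes "2 \<le> n"
  shows "two_sample n (*) (\<lambda>i. if i \<le> n then a else b) = (a - b)\<^sup>2"
proof -
  have k: "(\<Sum>i\<in>{1..n}. \<Sum>j\<in>{1..n} - {i}. r) = real n * (real n - 1) * r" for r :: real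
    by (simp add: sum_offdiag_first algebra_simps)
  have AA: "(\<Sum>i\<in>{1..n}. \<Sum>j\<in>{1..n} - {i}. (if i \<le> n then a else b) * (if j \<le> n then a else b))
      = real n * (real n - 1) * (a * a)"
    unfolding k[symmetric] by (intro sum.cong refl) auto
  have BB: "(\<Sum>i\<in>{n+1..2*n}. \<Sum>j\<in>{n+1..2*n} - {i}. (if i \<le> n then a else b) * (if j \<le> n then a else b))
      = real n * (real n - 1) * (b * b)"
    unfolding upper_half_offdiag_reindex k[symmetric] by (intro sum.cong refl) auto
  have AB: "(\<Sum>i\<in>{1..n}. \<Sum>j\<in>{n+1..2*n}. (if i \<le> n then a else b) * (if j \<le> n then a else b))
      = (\<Sum>i\<in>{1..n}. \<Sum>j\<in>{n+1..2*n}. a * b)"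
    by (intro sum.cong refl) auto
  show ?thesis
    unfolding two_sample_def AA BB AB using assms
    by (simp add: distrib_left[symmetric] power2_diff) (simp add: power2_eq_square)
qed

lemma expectation_sum_superset:
  fixes f :: "'b \<Rightarrow> real"
  assumes "finite D" "set_pmf P \<subseteq> D"
  shows "measure_pmf.expectation P f = (\<Sum>u\<in>D. f u * pmf P u)"
  using assms by (intro integral_measure_pmf_real) auto

section \<open>Moments of the statistic when the weights are fixed\<close>

locale two_sample_model =
  fixes n :: nat and D :: "'b set" and pY pZ :: "'b pmf" and W :: "'b \<Rightarrow> real" and dflt :: 'b
  assumes n: "2 \<le> n" and D: "finite D" "set_pmf pY \<subseteq> D" "set_pmf pZ \<subseteq> D" and W: "\<And>u. 0 \<le> W u"

abbreviation (in two_sample_model) "q \<equiv> sample_law n pY pZ"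
abbreviation (in two_sample_model) "X \<equiv> Pi_pmf {1..2*n} dflt q"

lemma (in two_sample_model) set_sample_law: "set_pmf (q i) \<subseteq> D"
  using D by (simp add: sample_law_def)

lemma (in two_sample_model) finite_set_sample_law: "finite (set_pmf (q i))"
  using set_sample_law D(1) by (rule finite_subset)

lemma (in two_sample_model) finite_set_pooled: "finite (set_pmf X)"
  by (intro finite_set_Pi_pmf finite_set_sample_law) auto

lemma (in two_sample_model) expectation_diag_kernel:
  assumes "i \<in> {1..2*n}" "j \<in> {1..2*n} - {i}"
  shows "measure_pmf.expectation X (\<lambda>x. diag_kernel V (x i) (x j)) = (\<Sum>u\<in>D. V u * (pmf (q i) u * pmf (q j) u))"
proof -
  have "measure_pmf.expectation (q j) (\<lambda>v. diag_kernel V u v) = V u * pmf (q j) u" if "u \<in> D" for u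
    unfolding expectation_sum_superset[OF D(1) set_sample_law] diag_kernel_def using that D(1)
    by (simp add: of_bool_def if_distrib if_distribR cong: if_cong)
  then have "measure_pmf.expectation (q i) (\<lambda>u. measure_pmf.expectation (q j) (\<lambda>v. diag_kernel V u v))
      = (\<Sum>u\<in>D. V u * (pmf (q i) u * pmf (q j) u))"
    by (simp add: expectation_sum_superset[OF D(1) set_sample_law] mult_ac)
  then show ?thesis
    using assms by (subst expectation_Pi_pmf_two) (auto intro: finite_set_sample_law)
qed

text \<open>Independence factors the mean of each kernel value over the common category u. For each
  u the result is again the two-sample expression, with multiplication as kernel, evaluated at the
  probabilities of u.\<close>

lemma (in two_sample_model) expectation_two_sample: "measure_pmf.expectation X (two_sample n (diag_kernel W)) = separation D W pY pZ"
proof -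
  let ?I = "{1..2*n}"
  have "measure_pmf.expectation X (two_sample n (diag_kernel W))
      = measure_pmf.expectation X (\<lambda>x. \<Sum>i\<in>?I. \<Sum>j\<in>?I - {i}. half_coeff n i j * diag_kernel W (x i) (x j))"
    by (intro Bochner_Integration.integral_cong refl two_sample_quadratic diag_kernel_commute)
  also have "\<dots> = (\<Sum>i\<in>?I. \<Sum>j\<in>?I - {i}. half_coeff n i j * measure_pmf.expectation X (\<lambda>x. diag_kernel W (x i) (x j)))"
    by (rule expectation_double_sum[OF finite_set_pooled])
  also have "\<dots> = (\<Sum>i\<in>?I. \<Sum>j\<in>?I - {i}. half_coeff n i j * (\<Sum>u\<in>D. W u * (pmf (q i) u * pmf (q j) u)))"
    by (intro sum.cong refl) (simp only: expectation_diag_kernel)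
  also have "\<dots> = (\<Sum>i\<in>?I. \<Sum>j\<in>?I - {i}. \<Sum>u\<in>D. W u * (half_coeff n i j * (pmf (q i) u * pmf (q j) u)))"
    by (simp add: sum_distrib_left mult_ac)
  also have "\<dots> = (\<Sum>i\<in>?I. \<Sum>u\<in>D. \<Sum>j\<in>?I - {i}. W u * (half_coeff n i j * (pmf (q i) u * pmf (q j) u)))"
    by (intro sum.cong refl sum.swap)
  also have "\<dots> = (\<Sum>u\<in>D. \<Sum>i\<in>?I. \<Sum>j\<in>?I - {i}. W u * (half_coeff n i j * (pmf (q i) u * pmf (q j) u)))"
    by (rule sum.swap)
  also have "\<dots> = (\<Sum>u\<in>D. W u * two_sample n (*) (\<lambda>i. pmf (q i) u))"
    by (simp only: two_sample_quadratic[of "(*) :: real \<Rightarrow> _", OF mult.commute] sum_distrib_left)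
  also have "\<dots> = separation D W pY pZ"
    unfolding separation_def
  proof (intro sum.cong refl)
    fix u
    have "(\<lambda>i. pmf (q i) u) = (\<lambda>i. if i \<le> n then pmf pY u else pmf pZ u)"
      by (auto simp: sample_law_def)
    then show "W u * two_sample n (*) (\<lambda>i. pmf (q i) u) = W u * (pmf pY u - pmf pZ u)\<^sup>2"
      using two_sample_times[OF n] by simp
  qed
  finally show ?thesis .
qed

text \<open>There are at most (2n)^2 pairs. With a and b the probabilities of u under pY and pZ, a
  pair of observations shares the category u with probability a^2, ab or b^2, each at most a^2 +
  b^2.\<close>

lemma (in two_sample_model) expectation_kernel_energy:
  "measure_pmf.expectation X (kernel_energy n (diag_kernel W)) \<le> 4 * (real n)\<^sup>2 * square_mass D W pY pZ"
proof -
  let ?I = "{1..2*n}"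
  have sq: "(diag_kernel W a b)\<^sup>2 = diag_kernel (\<lambda>u. (W u)\<^sup>2) a b" for a b
    by (simp add: diag_kernel_def power_mult_distrib)
  have le: "measure_pmf.expectation X (\<lambda>x. (diag_kernel W (x i) (x j))\<^sup>2) \<le> square_mass D W pY pZ"
    if "i \<in> ?I" "j \<in> ?I - {i}" for i j
  proof -
    have "measure_pmf.expectation X (\<lambda>x. (diag_kernel W (x i) (x j))\<^sup>2)
        = (\<Sum>u\<in>D. (W u)\<^sup>2 * (pmf (q i) u * pmf (q j) u))"
      unfolding sq by (rule expectation_diag_kernel[OF that])
    also have "\<dots> \<le> square_mass D W pY pZ"
      unfolding square_mass_def
    proof (intro sum_mono mult_left_mono)
      fix u
      have "2 * (pmf pY u * pmf pZ u) \<le> (pmf pY u)\<^sup>2 + (pmf pZ u)\<^sup>2"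
        using sum_squares_bound[of "pmf pY u" "pmf pZ u"] by (simp add: mult.assoc)
      moreover have "0 \<le> pmf pY u * pmf pZ u" by simp
      ultimately have "pmf pY u * pmf pZ u \<le> (pmf pY u)\<^sup>2 + (pmf pZ u)\<^sup>2" by linarith
      then show "pmf (q i) u * pmf (q j) u \<le> (pmf pY u)\<^sup>2 + (pmf pZ u)\<^sup>2"
        by (auto simp: sample_law_def power2_eq_square mult.commute)
    qed simp
    finally show ?thesis .
  qed
  have "0 \<le> square_mass D W pY pZ" unfolding square_mass_def by (intro sum_nonneg) auto
  have "measure_pmf.expectation X (kernel_energy n (diag_kernel W))
      = (\<Sum>i\<in>?I. \<Sum>j\<in>?I - {i}. measure_pmf.expectation X (\<lambda>x. (diag_kernel W (x i) (x j))\<^sup>2))"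
    unfolding kernel_energy_def
    using expectation_double_sum[OF finite_set_pooled, where c = "\<lambda>_ _. 1"] by simp
  also have "\<dots> \<le> (\<Sum>i\<in>?I. \<Sum>j\<in>?I - {i}. square_mass D W pY pZ)"
    by (intro sum_mono le)
  also have "\<dots> \<le> (\<Sum>i\<in>?I. \<Sum>j\<in>?I. square_mass D W pY pZ)"
    using \<open>0 \<le> square_mass D W pY pZ\<close> by (intro sum_mono sum_mono2) auto
  also have "\<dots> = 4 * (real n)\<^sup>2 * square_mass D W pY pZ"
    by (simp add: power2_eq_square)
  finally show ?thesis .
qed

text \<open>Given that \<open>x i\<close> is u, the increment is 2 W(u) times a linear form in the
  indicators that \<open>x j\<close> is u. The coefficients of row i sum to 1/n over its own half
  and to -1/n over the other, so the form has mean (a-b)/n up to sign. Its variance part uses n-1 >=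
  n/2.\<close>

lemma (in two_sample_model) expectation_increment:
  assumes i: "i \<in> {1..2*n}"
  shows "measure_pmf.expectation X (\<lambda>x. (2 * (\<Sum>j\<in>{1..2*n} - {i}. half_coeff n i j * diag_kernel W (x i) (x j)))\<^sup>2)
    \<le> (\<Sum>u\<in>D. 4 * (W u)\<^sup>2 * (2 * (pmf pY u + pmf pZ u) / real n ^ 3 + (pmf pY u - pmf pZ u)\<^sup>2 / (real n)\<^sup>2) * pmf (q i) u)"
proof -
  let ?J = "{1..2*n} - {i}"
  let ?F = "\<lambda>u. measure_pmf.expectation (Pi_pmf ?J dflt q) (\<lambda>x. (\<Sum>j\<in>?J. half_coeff n i j * of_bool (x j = u))\<^sup>2)"
  have I: "{1..2*n} = insert i ?J" using i by auto
  have "measure_pmf.expectation X (\<lambda>x. (2 * (\<Sum>j\<in>?J. half_coeff n i j * diag_kernel W (x i) (x j)))\<^sup>2)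
      = measure_pmf.expectation (q i) (\<lambda>u. measure_pmf.expectation (Pi_pmf ?J dflt q)
          (\<lambda>x. (2 * (\<Sum>j\<in>?J. half_coeff n i j * diag_kernel W ((x(i := u)) i) ((x(i := u)) j)))\<^sup>2))"
    by (subst (1) I, rule expectation_Pi_pmf_insert) (auto intro: finite_set_sample_law)
  also have "\<dots> = measure_pmf.expectation (q i) (\<lambda>u. 4 * (W u)\<^sup>2 * ?F u)"
  proof (intro Bochner_Integration.integral_cong refl)
    fix u
    have "(2 * (\<Sum>j\<in>?J. half_coeff n i j * diag_kernel W ((x(i := u)) i) ((x(i := u)) j)))\<^sup>2
        = 4 * (W u)\<^sup>2 * (\<Sum>j\<in>?J. half_coeff n i j * of_bool (x j = u))\<^sup>2" for x
    proof -
      have "(\<Sum>j\<in>?J. half_coeff n i j * diag_kernel W ((x(i := u)) i) ((x(i := u)) j))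
          = (\<Sum>j\<in>?J. W u * (half_coeff n i j * of_bool (x j = u)))"
        by (intro sum.cong refl) (auto simp: diag_kernel_def)
      also have "\<dots> = W u * (\<Sum>j\<in>?J. half_coeff n i j * of_bool (x j = u))"
        by (rule sum_distrib_left[symmetric])
      finally show ?thesis by (simp only: power_mult_distrib) simp
    qed
    then show "measure_pmf.expectation (Pi_pmf ?J dflt q)
          (\<lambda>x. (2 * (\<Sum>j\<in>?J. half_coeff n i j * diag_kernel W ((x(i := u)) i) ((x(i := u)) j)))\<^sup>2)
        = 4 * (W u)\<^sup>2 * ?F u" by (simp only: integral_mult_right_zero)
  qed
  also have "\<dots> = (\<Sum>u\<in>D. 4 * (W u)\<^sup>2 * ?F u * pmf (q i) u)"
    by (rule expectation_sum_superset[OF D(1) set_sample_law])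
  also have "\<dots> \<le> (\<Sum>u\<in>D. 4 * (W u)\<^sup>2
      * (2 * (pmf pY u + pmf pZ u) / real n ^ 3 + (pmf pY u - pmf pZ u)\<^sup>2 / (real n)\<^sup>2) * pmf (q i) u)"
  proof (intro sum_mono mult_right_mono mult_left_mono)
    fix u
    let ?a = "pmf pY u" and ?b = "pmf pZ u" and ?s = "1 / (real n * (real n - 1))"
    let ?p = "if i \<le> n then ?a else ?b" and ?r = "if i \<le> n then ?b else ?a"
    have "(\<Sum>j\<in>?J. (half_coeff n i j)\<^sup>2 * pmf (q j) u)
        = (\<Sum>j\<in>?J. if (i \<le> n) = (j \<le> n) then ?s\<^sup>2 * ?p else (- 1 / (real n)\<^sup>2)\<^sup>2 * ?r)"
      by (intro sum.cong refl) (auto simp: half_coeff_def sample_law_def)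
    also have "\<dots> = (real n - 1) * (?s\<^sup>2 * ?p) + real n * ((- 1 / (real n)\<^sup>2)\<^sup>2 * ?r)"
      by (rule row_sum[OF i])
    also have "\<dots> \<le> 2 / real n ^ 3 * ?p + 2 / real n ^ 3 * ?r"
    proof (rule add_mono)
      have "(real n - 1) * ?s\<^sup>2 = 1 / ((real n)\<^sup>2 * (real n - 1))"
        using n by (simp add: power2_eq_square)
      also have "\<dots> \<le> 2 / real n ^ 3"
        using n by (simp add: divide_simps power2_eq_square power3_eq_cube)
      finally show "(real n - 1) * (?s\<^sup>2 * ?p) \<le> 2 / real n ^ 3 * ?p"
        unfolding mult.assoc[symmetric] by (intro mult_right_mono) auto
      have "real n * (- 1 / (real n)\<^sup>2)\<^sup>2 = 1 / real n ^ 3"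
        using n by (simp add: power2_eq_square power3_eq_cube)
      also have "\<dots> \<le> 2 / real n ^ 3" by (simp add: divide_right_mono)
      finally show "real n * ((- 1 / (real n)\<^sup>2)\<^sup>2 * ?r) \<le> 2 / real n ^ 3 * ?r"
        unfolding mult.assoc[symmetric] by (intro mult_right_mono) auto
    qed
    also have "\<dots> = 2 * (?a + ?b) / real n ^ 3"
      by (simp add: add_divide_distrib)
    finally have v: "(\<Sum>j\<in>?J. (half_coeff n i j)\<^sup>2 * pmf (q j) u) \<le> 2 * (?a + ?b) / real n ^ 3" .
    have "(\<Sum>j\<in>?J. half_coeff n i j * pmf (q j) u)
        = (\<Sum>j\<in>?J. if (i \<le> n) = (j \<le> n) then ?s * ?p else - 1 / (real n)\<^sup>2 * ?r)"
      by (intro sum.cong refl) (auto simp: half_coeff_def sample_law_def)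
    also have "\<dots> = (real n - 1) * (?s * ?p) + real n * (- 1 / (real n)\<^sup>2 * ?r)"
      by (rule row_sum[OF i])
    also have "\<dots> = (?p - ?r) / real n"
      using n by (simp add: power2_eq_square diff_divide_distrib)
    finally have m: "(\<Sum>j\<in>?J. half_coeff n i j * pmf (q j) u)\<^sup>2 = (?a - ?b)\<^sup>2 / (real n)\<^sup>2"
      by (simp add: power_divide power2_commute)
    have "?F u \<le> (\<Sum>j\<in>?J. (half_coeff n i j)\<^sup>2 * pmf (q j) u) + (\<Sum>j\<in>?J. half_coeff n i j * pmf (q j) u)\<^sup>2"
      by (rule second_moment_indicator_sum) (auto intro: finite_set_sample_law)
    then show "?F u \<le> 2 * (?a + ?b) / real n ^ 3 + (?a - ?b)\<^sup>2 / (real n)\<^sup>2"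
      using v m by simp
  qed auto
  finally show ?thesis .
qed

text \<open>Summing the increment bounds over i brings a factor n(a+b) in each category u. The
  variance part becomes square mass over n^2. In the other part the factor W(u)(a+b) is at most the
  square root of twice the square mass, and what remains sums to the separation.\<close>

lemma (in two_sample_model) variance_two_sample:
  "measure_pmf.expectation X (\<lambda>x. (two_sample n (diag_kernel W) x - separation D W pY pZ)\<^sup>2)
    \<le> 16 * square_mass D W pY pZ / (real n)\<^sup>2 + 4 / real n * sqrt (2 * square_mass D W pY pZ) * separation D W pY pZ"
proof -
  let ?I = "{1..2*n}" and ?U = "two_sample n (diag_kernel W)"
  let ?M = "square_mass D W pY pZ" and ?\<delta> = "separation D W pY pZ"
  let ?h = "\<lambda>x i j. half_coeff n i j * diag_kernel W (x i) (x j)"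
  \<comment> \<open>the part of the statistic that does not involve observation \<open>i\<close>, for Efron--Stein\<close>
  define c where "c i x = (\<Sum>k\<in>?I - {i}. \<Sum>l\<in>?I - {i} - {k}. ?h x k l)" for i x
  have incr: "?U x - c i x = 2 * (\<Sum>j\<in>?I - {i}. ?h x i j)" if "i \<in> ?I" for i x
  proof -
    have I: "?I = insert i (?I - {i})" using that by auto
    have "?U x = (\<Sum>k\<in>?I. \<Sum>l\<in>?I - {k}. ?h x k l)"
      by (rule two_sample_quadratic[OF diag_kernel_commute])
    also have "\<dots> = c i x + (\<Sum>j\<in>?I - {i}. ?h x i j + ?h x j i)"
      unfolding c_def by (subst (1 2) I, rule sum_offdiag_insert) auto
    also have "(\<Sum>j\<in>?I - {i}. ?h x i j + ?h x j i) = 2 * (\<Sum>j\<in>?I - {i}. ?h x i j)"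
      unfolding sum_distrib_left
      by (intro sum.cong refl) (simp add: half_coeff_commute[of n _ i] diag_kernel_commute[of W _ "x i"])
    finally show ?thesis by simp
  qed
  have "measure_pmf.expectation X (\<lambda>x. (?U x - ?\<delta>)\<^sup>2)
      = measure_pmf.expectation X (\<lambda>x. (?U x)\<^sup>2) - (measure_pmf.expectation X ?U)\<^sup>2"
    unfolding expectation_two_sample[symmetric] by (rule expectation_centered_square[OF finite_set_pooled])
  also have "\<dots> \<le> (\<Sum>i\<in>?I. measure_pmf.expectation X (\<lambda>x. (?U x - c i x)\<^sup>2))"
  proof (rule Efron_Stein)
    show "c i (x(i := u)) = c i x" for i x u
      unfolding c_def by (intro sum.cong refl) auto
  qed (auto intro: finite_set_sample_law)
  also have "\<dots> = (\<Sum>i\<in>?I. measure_pmf.expectation X (\<lambda>x. (2 * (\<Sum>j\<in>?I - {i}. ?h x i j))\<^sup>2))"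
    by (intro sum.cong refl) (simp only: incr)
  also have "\<dots> \<le> (\<Sum>i\<in>?I. \<Sum>u\<in>D. 4 * (W u)\<^sup>2 * (2 * (pmf pY u + pmf pZ u) / real n ^ 3
      + (pmf pY u - pmf pZ u)\<^sup>2 / (real n)\<^sup>2) * pmf (q i) u)"
    by (intro sum_mono expectation_increment)
  also have "\<dots> = (\<Sum>u\<in>D. 4 * (W u)\<^sup>2 * (2 * (pmf pY u + pmf pZ u) / real n ^ 3
      + (pmf pY u - pmf pZ u)\<^sup>2 / (real n)\<^sup>2) * (\<Sum>i\<in>?I. pmf (q i) u))"
    by (subst sum.swap) (simp only: sum_distrib_left)
  also have "\<dots> \<le> (\<Sum>u\<in>D. 16 / (real n)\<^sup>2 * ((W u)\<^sup>2 * ((pmf pY u)\<^sup>2 + (pmf pZ u)\<^sup>2))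
      + 4 / real n * sqrt (2 * ?M) * (W u * (pmf pY u - pmf pZ u)\<^sup>2))"
  proof (rule sum_mono)
    fix u assume u: "u \<in> D"
    let ?a = "pmf pY u" and ?b = "pmf pZ u"
    have I: "?I = {1..n} \<union> {n+1..2*n}" by auto
    have "(\<Sum>i\<in>?I. pmf (q i) u) = (\<Sum>i\<in>{1..n}. pmf (q i) u) + (\<Sum>i\<in>{n+1..2*n}. pmf (q i) u)"
      unfolding I by (rule sum.union_disjoint) auto
    also have "\<dots> = (\<Sum>i\<in>{1..n}. ?a) + (\<Sum>i\<in>{n+1..2*n}. ?b)"
      by (intro arg_cong2[where f = "(+)"] sum.cong refl) (auto simp: sample_law_def)
    finally have S: "(\<Sum>i\<in>?I. pmf (q i) u) = real n * (?a + ?b)" by (simp add: distrib_left)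
    have sq: "(?a + ?b)\<^sup>2 \<le> 2 * (?a\<^sup>2 + ?b\<^sup>2)"
      using sum_squares_bound[of ?a ?b] by (simp add: power2_sum)
    have "(W u * (?a + ?b))\<^sup>2 \<le> 2 * ((W u)\<^sup>2 * (?a\<^sup>2 + ?b\<^sup>2))"
      using mult_left_mono[OF sq, of "(W u)\<^sup>2"]
      by (simp only: power_mult_distrib mult.left_commute[of 2] zero_le_power2)
    also have "\<dots> \<le> 2 * ?M"
      unfolding square_mass_def using u D(1)
      by (intro mult_left_mono member_le_sum[where f = "\<lambda>u. (W u)\<^sup>2 * ((pmf pY u)\<^sup>2 + (pmf pZ u)\<^sup>2)"]) auto
    finally have rt: "W u * (?a + ?b) \<le> sqrt (2 * ?M)" by (rule real_le_rsqrt)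
    have "4 * (W u)\<^sup>2 * (2 * (?a + ?b) / real n ^ 3 + (?a - ?b)\<^sup>2 / (real n)\<^sup>2) * (real n * (?a + ?b))
        = 8 / (real n)\<^sup>2 * ((W u)\<^sup>2 * (?a + ?b)\<^sup>2) + 4 / real n * (W u * (?a + ?b)) * (W u * (?a - ?b)\<^sup>2)"
    proof -
      have "4 * w\<^sup>2 * (2 * s / m ^ 3 + t / m\<^sup>2) * (m * s)
          = 8 / m\<^sup>2 * (w\<^sup>2 * s\<^sup>2) + 4 / m * (w * s) * (w * t)" if "m \<noteq> 0" for w s t m :: real
        using that by (simp add: field_simps power2_eq_square power3_eq_cube)
      moreover have "real n \<noteq> 0" using n by auto
      ultimately show ?thesis by blast
    qed
    also have "\<dots> \<le> 8 / (real n)\<^sup>2 * ((W u)\<^sup>2 * (2 * (?a\<^sup>2 + ?b\<^sup>2))) + 4 / real n * sqrt (2 * ?M) * (W u * (?a - ?b)\<^sup>2)"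
      using W[of u] by (intro add_mono mult_left_mono mult_right_mono sq rt) auto
    also have "8 / (real n)\<^sup>2 * ((W u)\<^sup>2 * (2 * (?a\<^sup>2 + ?b\<^sup>2))) = 16 / (real n)\<^sup>2 * ((W u)\<^sup>2 * (?a\<^sup>2 + ?b\<^sup>2))"
      by simp
    finally show "4 * (W u)\<^sup>2 * (2 * (?a + ?b) / real n ^ 3 + (?a - ?b)\<^sup>2 / (real n)\<^sup>2) * (\<Sum>i\<in>?I. pmf (q i) u)
        \<le> 16 / (real n)\<^sup>2 * ((W u)\<^sup>2 * (?a\<^sup>2 + ?b\<^sup>2)) + 4 / real n * sqrt (2 * ?M) * (W u * (?a - ?b)\<^sup>2)"
      unfolding S .
  qed
  also have "\<dots> = 16 * ?M / (real n)\<^sup>2 + 4 / real n * sqrt (2 * ?M) * ?\<delta>"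
    by (simp only: sum.distrib sum_distrib_left[symmetric] separation_def[symmetric] square_mass_def[symmetric]) simp
  finally show ?thesis .
qed

section \<open>The type II error\<close>

lemma (in two_sample_model) type_II_given_weights:
  fixes \<alpha> \<beta> :: real
  defines "\<delta> \<equiv> separation D W pY pZ" and "L \<equiv> ln (1 / \<alpha>)"
  assumes \<alpha>: "0 < \<alpha>" "\<alpha> < exp (-1)" and \<beta>: "0 < \<beta>" "\<beta> < 1" and \<delta>: "0 < \<delta>"
  shows "measure_pmf.prob X {x. two_sample n (diag_kernel W) x \<le> pmf_quantile (1 - \<alpha>) (perm_law n (diag_kernel W) x)}
    \<le> \<beta> / 2 + 19000 * L\<^sup>2 / \<beta> * (square_mass D W pY pZ / ((real n)\<^sup>2 * \<delta>\<^sup>2))"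
proof -
  let ?U = "two_sample n (diag_kernel W)" and ?G = "kernel_energy n (diag_kernel W)"
  let ?M = "square_mass D W pY pZ" and ?N = "real n * (real n - 1)"
  let ?S = "{x. ?U x \<le> pmf_quantile (1 - \<alpha>) (perm_law n (diag_kernel W) x)}"
  \<comment> \<open>Chosen so that the square of the quantile bound is this constant times the
    energy over N^2; 32 is 2^2 * 8.\<close>
  let ?\<kappa> = "32 * (exp 1)\<^sup>2 * L\<^sup>2"
  let ?r = "?M / ((real n)\<^sup>2 * \<delta>\<^sup>2)"
  have n0: "0 < real n" "0 < ?N" using n by auto
  have M: "0 \<le> ?M" unfolding square_mass_def by (intro sum_nonneg) auto
  have L: "1 < L" unfolding L_def by (rule one_less_ln_reciprocal[OF \<alpha>])
  \<comment> \<open>On the error event either the statistic is at most half its mean or the quantile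
    bound is at least half that mean. In the first case the first summand reaches 1 (Chebyshev), in
    the second case the second does (Markov).\<close>
  have dominate: "indicator ?S x \<le> 4 / \<delta>\<^sup>2 * (?U x - \<delta>)\<^sup>2 + 4 * ?\<kappa> / (?N\<^sup>2 * \<delta>\<^sup>2) * ?G x" for x
  proof (cases "x \<in> ?S")
    case True
    have G: "0 \<le> ?G x" unfolding kernel_energy_def by (intro sum_nonneg) auto
    let ?T = "2 * exp 1 * L * sqrt (8 * ?G x) / ?N"
    have "?U x \<le> ?T"
      using True pmf_quantile_perm_law_le[of n \<alpha> "diag_kernel W" x, OF n \<alpha> diag_kernel_commute]
      unfolding L_def by simp
    then consider "?U x \<le> \<delta> / 2" | "\<delta> / 2 \<le> ?T" by linarith
    then have "1 \<le> 4 / \<delta>\<^sup>2 * (?U x - \<delta>)\<^sup>2 + 4 * ?\<kappa> / (?N\<^sup>2 * \<delta>\<^sup>2) * ?G x"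
    proof cases
      case 1
      then have "(\<delta> / 2)\<^sup>2 \<le> (\<delta> - ?U x)\<^sup>2" using \<delta> by (intro power_mono) auto
      then have "1 \<le> 4 / \<delta>\<^sup>2 * (?U x - \<delta>)\<^sup>2"
        using \<delta> by (simp add: power2_commute[of "?U x"] power_divide field_simps)
      moreover have "0 \<le> 4 * ?\<kappa> / (?N\<^sup>2 * \<delta>\<^sup>2) * ?G x" using G by (intro mult_nonneg_nonneg) auto
      ultimately show ?thesis by linarith
    next
      case 2
      then have "(\<delta> / 2)\<^sup>2 \<le> ?T\<^sup>2" using \<delta> by (intro power_mono) auto
      also have "?T\<^sup>2 = ?\<kappa> * ?G x / ?N\<^sup>2"
        using G by (simp add: power_mult_distrib power_divide)
      finally have "\<delta>\<^sup>2 / 4 \<le> ?\<kappa> * ?G x / ?N\<^sup>2" by (simp add: power_divide)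
      then have "4 / \<delta>\<^sup>2 * (\<delta>\<^sup>2 / 4) \<le> 4 / \<delta>\<^sup>2 * (?\<kappa> * ?G x / ?N\<^sup>2)"
        by (intro mult_left_mono) auto
      also have "\<dots> = 4 * ?\<kappa> / (?N\<^sup>2 * \<delta>\<^sup>2) * ?G x" by (simp add: mult_ac)
      finally have "1 \<le> 4 * ?\<kappa> / (?N\<^sup>2 * \<delta>\<^sup>2) * ?G x" using \<delta> by simp
      moreover have "0 \<le> 4 / \<delta>\<^sup>2 * (?U x - \<delta>)\<^sup>2" by simp
      ultimately show ?thesis by linarith
    qed
    then show ?thesis using True by simp
  next
    case False
    have "0 \<le> ?G x" unfolding kernel_energy_def by (intro sum_nonneg) auto
    then have "0 \<le> 4 / \<delta>\<^sup>2 * (?U x - \<delta>)\<^sup>2 + 4 * ?\<kappa> / (?N\<^sup>2 * \<delta>\<^sup>2) * ?G x"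
      by (intro add_nonneg_nonneg mult_nonneg_nonneg) auto
    then show ?thesis using False by simp
  qed
  have "measure_pmf.prob X ?S = measure_pmf.expectation X (indicator ?S)" by simp
  also have "\<dots> \<le> measure_pmf.expectation X
      (\<lambda>x. 4 / \<delta>\<^sup>2 * (?U x - \<delta>)\<^sup>2 + 4 * ?\<kappa> / (?N\<^sup>2 * \<delta>\<^sup>2) * ?G x)"
    by (rule expectation_mono_finite[OF finite_set_pooled dominate])
  also have "\<dots> = 4 / \<delta>\<^sup>2 * measure_pmf.expectation X (\<lambda>x. (?U x - \<delta>)\<^sup>2)
      + 4 * ?\<kappa> / (?N\<^sup>2 * \<delta>\<^sup>2) * measure_pmf.expectation X ?G"
    by (subst Bochner_Integration.integral_add)
      (intro integrable_measure_pmf_finite finite_set_pooled | simp only: integral_mult_right_zero)+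
  also have "\<dots> \<le> 4 / \<delta>\<^sup>2 * (16 * ?M / (real n)\<^sup>2 + 4 / real n * sqrt (2 * ?M) * \<delta>)
      + 4 * ?\<kappa> / (?N\<^sup>2 * \<delta>\<^sup>2) * (4 * (real n)\<^sup>2 * ?M)"
    using variance_two_sample expectation_kernel_energy unfolding \<delta>_def
    by (intro add_mono mult_left_mono) auto
  also have "\<dots> \<le> 64 * ?r + 16 * (sqrt (2 * ?M) / (real n * \<delta>)) + 64 * ?\<kappa> * ?r"
  proof -
    have "(real n)\<^sup>2 / 2 \<le> ?N" using n by (simp add: power2_eq_square field_simps)
    then have "((real n)\<^sup>2 / 2)\<^sup>2 \<le> ?N\<^sup>2" by (intro power_mono) auto
    then have "4 * ?\<kappa> / (?N\<^sup>2 * \<delta>\<^sup>2) * (4 * (real n)\<^sup>2 * ?M) \<le> 4 * ?\<kappa> / (((real n)\<^sup>2 / 2)\<^sup>2 * \<delta>\<^sup>2) * (4 * (real n)\<^sup>2 * ?M)"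
      using n0 \<delta> M
      by (intro mult_right_mono divide_left_mono mult_nonneg_nonneg mult_pos_pos) auto
    also have "\<dots> = 64 * ?\<kappa> * ?r"
    proof -
      have "4 * k / ((m\<^sup>2 / 2)\<^sup>2 * x) * (4 * m\<^sup>2 * y) = 64 * k * (y / (m\<^sup>2 * x))"
        if "m \<noteq> 0" "x \<noteq> 0" for k m x y :: real
        using that by (simp add: field_simps power2_eq_square)
      moreover have "real n \<noteq> 0" "\<delta>\<^sup>2 \<noteq> 0" using n0 \<delta> by auto
      ultimately show ?thesis by blast
    qed
    finally have "4 * ?\<kappa> / (?N\<^sup>2 * \<delta>\<^sup>2) * (4 * (real n)\<^sup>2 * ?M) \<le> 64 * ?\<kappa> * ?r" .
    moreover have "4 / \<delta>\<^sup>2 * (16 * ?M / (real n)\<^sup>2 + 4 / real n * sqrt (2 * ?M) * \<delta>)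
        = 64 * ?r + 16 * (sqrt (2 * ?M) / (real n * \<delta>))"
      using \<delta> by (simp add: distrib_left power2_eq_square mult_ac)
    ultimately show ?thesis by linarith
  qed
  also have "\<dots> \<le> \<beta> / 2 + 19000 * L\<^sup>2 / \<beta> * ?r"
  proof -
    define s where "s = sqrt (2 * ?M) / (real n * \<delta>)"
    have r: "0 \<le> ?r" using M by simp
    have s2: "s\<^sup>2 = 2 * ?r"
      unfolding s_def using M by (simp add: power_divide power_mult_distrib)
    \<comment> \<open>The mean-dependent part of the variance contributes a term of order sqrt r.
      The arithmetic-geometric mean inequality trades it for half of the error budget and a term
      linear in r with coefficient 256/\<open>\<beta>\<close>.\<close>
    have "0 \<le> (\<beta> - 16 * s)\<^sup>2 / (2 * \<beta>)" using \<beta> by simp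
    also have "\<dots> = \<beta> / 2 + 128 * s\<^sup>2 / \<beta> - 16 * s"
      using \<beta> by (simp add: power2_eq_square field_simps)
    finally have amgm: "16 * s \<le> \<beta> / 2 + 256 / \<beta> * ?r"
      unfolding s2 by (simp add: mult_ac)
    have Lb: "1 \<le> L\<^sup>2" "1 \<le> 1 / \<beta>" using L \<beta> by auto
    have e: "(exp 1)\<^sup>2 \<le> (9::real)"
      using power_mono[OF exp_le, of 2] by simp
    \<comment> \<open>With e^2 <= 9 the last coefficient is 64 * 32 * 9 = 18432, and 64 + 256 +
      18432 is below 19000.\<close>
    have "64 + 256 / \<beta> + 64 * ?\<kappa> \<le> 64 * (L\<^sup>2 * (1 / \<beta>)) + 256 * (L\<^sup>2 * (1 / \<beta>)) + 18432 * (L\<^sup>2 * (1 / \<beta>))"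
    proof (intro add_mono)
      have "1 * 1 \<le> L\<^sup>2 * (1 / \<beta>)" using Lb \<beta> by (intro mult_mono) auto
      then show "64 \<le> 64 * (L\<^sup>2 * (1 / \<beta>))" by simp
      have "1 * (1 / \<beta>) \<le> L\<^sup>2 * (1 / \<beta>)" using Lb \<beta> by (intro mult_right_mono) auto
      then show "256 / \<beta> \<le> 256 * (L\<^sup>2 * (1 / \<beta>))" by simp
      have "(exp 1)\<^sup>2 * L\<^sup>2 \<le> 9 * (L\<^sup>2 * (1 / \<beta>))"
        using e Lb mult_left_mono[OF Lb(2), of "L\<^sup>2"] \<beta> by (intro mult_mono) auto
      then show "64 * ?\<kappa> \<le> 18432 * (L\<^sup>2 * (1 / \<beta>))" by simp
    qed
    also have "\<dots> \<le> 19000 * L\<^sup>2 / \<beta>" using \<beta> by (simp add: field_simps)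
    finally have "(64 + 256 / \<beta> + 64 * ?\<kappa>) * ?r \<le> 19000 * L\<^sup>2 / \<beta> * ?r"
      using r by (rule mult_right_mono)
    then show ?thesis using amgm unfolding s_def[symmetric] by (simp only: distrib_right)
  qed
  finally show ?thesis .
qed

text \<open>Adjoining one more observation \<^term>\<open>x a\<close>, the left-hand side becomes the expectation of
  the share of \<^term>\<open>x a\<close> among the observations equal to \<^term>\<open>k\<close>; by exchangeability all
  \<^term>\<open>card J + 1\<close> shares have the same expectation, and they sum to at most one.\<close>

lemma expectation_reciprocal_count:
  fixes J :: "nat set" and p :: "'b pmf"
  assumes J: "finite J" and p: "finite (set_pmf p)"
  shows "pmf p k * measure_pmf.expectation (Pi_pmf J d (\<lambda>_. p)) (\<lambda>x. 1 / (1 + (\<Sum>i\<in>J. of_bool (x i = k))))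
    \<le> 1 / (real (card J) + 1)"
proof -
  obtain a where a: "a \<notin> J" using J infinite_UNIV_nat by (metis ex_new_if_finite)
  let ?A = "insert a J"
  let ?P = "Pi_pmf ?A d (\<lambda>_. p)"
  let ?share = "\<lambda>b x. of_bool (x b = k) / (\<Sum>i\<in>?A. of_bool (x i = k)) :: real"
  have A: "finite ?A" using J by simp
  have fin: "finite (set_pmf ?P)" using A p by (intro finite_set_Pi_pmf) auto
  have same: "measure_pmf.expectation ?P (?share b) = measure_pmf.expectation ?P (?share a)" if "b \<in> ?A" for b
  proof -
    let ?t = "Transposition.transpose a b"
    have t: "?t permutes ?A" using that by (intro permutes_swap_id) auto
    have "?P = map_pmf (\<lambda>x. x \<circ> ?t) ?P"
      using A t by (intro Pi_pmf_bij_betw) (auto simp: permutes_imp_bij permutes_not_in)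
    then have "measure_pmf.expectation ?P (?share b) = measure_pmf.expectation (map_pmf (\<lambda>x. x \<circ> ?t) ?P) (?share b)"
      by simp
    also have "\<dots> = measure_pmf.expectation ?P (\<lambda>x. ?share b (x \<circ> ?t))" by (rule integral_map_pmf)
    also have "(\<lambda>x. ?share b (x \<circ> ?t)) = ?share a"
    proof
      fix x :: "nat \<Rightarrow> 'b"
      show "?share b (x \<circ> ?t) = ?share a x"
        using sum_permute[OF t, of "\<lambda>i. of_bool (x i = k)"] by simp
    qed
    finally show ?thesis .
  qed
  have "real (card ?A) * measure_pmf.expectation ?P (?share a) = (\<Sum>b\<in>?A. measure_pmf.expectation ?P (?share b))"
    by (simp only: same sum_constant cong: sum.cong)
  also have "\<dots> = measure_pmf.expectation ?P (\<lambda>x. \<Sum>b\<in>?A. ?share b x)"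
    by (rule Bochner_Integration.integral_sum[symmetric]) (rule integrable_measure_pmf_finite[OF fin])
  \<comment> \<open>The shares sum to 1, or to 0 when no observation equals k, since each quotient
    is then 0/0 = 0.\<close>
  also have "\<dots> \<le> measure_pmf.expectation ?P (\<lambda>x. 1)"
    by (rule expectation_mono_finite[OF fin]) (simp only: sum_divide_distrib[symmetric] divide_self_if; simp)
  finally have "real (card ?A) * measure_pmf.expectation ?P (?share a) \<le> 1" by simp
  moreover have "measure_pmf.expectation ?P (?share a)
      = pmf p k * measure_pmf.expectation (Pi_pmf J d (\<lambda>_. p)) (\<lambda>x. 1 / (1 + (\<Sum>i\<in>J. of_bool (x i = k))))"
  proof -
    let ?R = "measure_pmf.expectation (Pi_pmf J d (\<lambda>_. p)) (\<lambda>x. 1 / (1 + (\<Sum>i\<in>J. of_bool (x i = k)))) :: real"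
    have sumJ: "(\<Sum>i\<in>J. of_bool ((x(a := u)) i = k)) = (\<Sum>i\<in>J. of_bool (x i = k) :: real)" for x u
      using a by (intro sum.cong refl) auto
    have "measure_pmf.expectation ?P (?share a)
        = measure_pmf.expectation p (\<lambda>u. measure_pmf.expectation (Pi_pmf J d (\<lambda>_. p)) (\<lambda>x. ?share a (x(a := u))))"
      using J a p by (intro expectation_Pi_pmf_insert) auto
    also have "\<dots> = measure_pmf.expectation p (\<lambda>u. indicator {k} u * ?R)"
    proof (intro Bochner_Integration.integral_cong refl)
      fix u
      have "?share a (x(a := u)) = indicator {k} u * (1 / (1 + (\<Sum>i\<in>J. of_bool (x i = k))))" for x
      proof -
        have "(\<Sum>i\<in>?A. of_bool ((x(a := u)) i = k)) = of_bool (u = k) + (\<Sum>i\<in>J. of_bool (x i = k) :: real)"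
          unfolding sum.insert[OF J a] sumJ by simp
        then show ?thesis by (simp only:) (simp add: indicator_def)
      qed
      then show "measure_pmf.expectation (Pi_pmf J d (\<lambda>_. p)) (\<lambda>x. ?share a (x(a := u))) = indicator {k} u * ?R"
        by (simp only: integral_mult_right_zero)
    qed
    also have "\<dots> = pmf p k * ?R" by (simp add: measure_pmf_single)
    finally show ?thesis .
  qed
  ultimately show ?thesis using J a by (simp add: field_simps)
qed

section \<open>Size and mean square of the inverse weights\<close>

definition inverse_weight :: "nat \<Rightarrow> nat \<Rightarrow> (nat \<Rightarrow> nat) \<Rightarrow> nat \<Rightarrow> real" where
  "inverse_weight d n2 v k = (if k \<in> {1..d} then inverse (split_weight d n2 v k) else 0)"

text \<open>The value 0 of \<open>inverse_weight\<close> outside \<open>{1..d}\<close> makes this an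
  equality of functions on all of nat: for such an observation no summand of \<open>g_kernel\<close>
  matches.\<close>

lemma g_kernel_split_weight: "g_kernel d (split_weight d n2 v) = diag_kernel (inverse_weight d n2 v)"
proof (intro ext)
  fix a b
  have "g_kernel d (split_weight d n2 v) a b
      = (\<Sum>k\<in>{1..d}. if k = a then inverse (split_weight d n2 v k) * of_bool (a = b) else 0)"
    unfolding g_kernel_def by (intro sum.cong refl) auto
  then show "g_kernel d (split_weight d n2 v) a b = diag_kernel (inverse_weight d n2 v) a b"
    by (simp add: diag_kernel_def inverse_weight_def)
qed

text \<open>At most d observations enter the weights, so 1/(2m) >= 1/(2d). This puts the uniform
  part and the count over one denominator, in the form 1 + count that
  \<open>expectation_reciprocal_count\<close> handles.\<close>

lemma split_weight_ge:
  assumes "1 \<le> d" "1 \<le> n2"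
  shows "split_weight d n2 v k \<ge> (1 + (\<Sum>i\<in>{n2+1..n2+min n2 d}. of_bool (v i = k))) / (2 * real d)"
proof -
  let ?m = "min n2 d" and ?s = "\<Sum>i\<in>{n2+1..n2+min n2 d}. of_bool (v i = k) :: real"
  have s: "(\<Sum>i = 1..?m. of_bool (v (n2 + i) = k)) = ?s"
    using sum.shift_bounds_cl_nat_ivl[of "\<lambda>i. of_bool (v i = k) :: real" 1 n2 ?m] by (simp add: add.commute)
  have "0 \<le> ?s" by (intro sum_nonneg) auto
  then have "1 / (2 * real d) * ?s \<le> 1 / (2 * real ?m) * ?s"
    using assms by (intro mult_right_mono divide_left_mono) auto
  then show ?thesis
    unfolding split_weight_def Let_def s by (simp add: add_divide_distrib)
qed

lemma split_weight_pos:
  assumes "1 \<le> d" "1 \<le> n2"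
  shows "0 < split_weight d n2 v k"
proof -
  have "0 \<le> (\<Sum>i\<in>{n2+1..n2+min n2 d}. of_bool (v i = k) :: real)" by (intro sum_nonneg) auto
  then have "0 < (1 + (\<Sum>i\<in>{n2+1..n2+min n2 d}. of_bool (v i = k))) / (2 * real d)"
    using assms by (intro divide_pos_pos) auto
  then show ?thesis using split_weight_ge[OF assms, where v = v and k = k] by linarith
qed

lemma inverse_weight_nonneg:
  assumes "1 \<le> d" "1 \<le> n2"
  shows "0 \<le> inverse_weight d n2 v k"
  using split_weight_pos[OF assms, of v k] by (simp add: inverse_weight_def)

lemma inverse_weight_le:
  assumes "1 \<le> d" "1 \<le> n2"
  shows "inverse_weight d n2 v k \<le> 2 * real d / (1 + (\<Sum>i\<in>{n2+1..n2+min n2 d}. of_bool (v i = k)))"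
proof -
  let ?s = "1 + (\<Sum>i\<in>{n2+1..n2+min n2 d}. of_bool (v i = k)) :: real"
  have s: "0 < ?s" by (intro add_pos_nonneg sum_nonneg) auto
  have "inverse (split_weight d n2 v k) \<le> inverse (?s / (2 * real d))"
    using s assms by (intro le_imp_inverse_le split_weight_ge divide_pos_pos) auto
  then show ?thesis using s by (simp add: inverse_weight_def)
qed

lemma inverse_weight_le':
  assumes "1 \<le> d" "1 \<le> n2"
  shows "inverse_weight d n2 v k \<le> 2 * real d"
proof -
  have "0 \<le> (\<Sum>i\<in>{n2+1..n2+min n2 d}. of_bool (v i = k) :: real)" by (intro sum_nonneg) auto
  then have "2 * real d / (1 + (\<Sum>i\<in>{n2+1..n2+min n2 d}. of_bool (v i = k))) \<le> 2 * real d / 1"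
    by (intro divide_left_mono) auto
  then show ?thesis using inverse_weight_le[OF assms, of v k] by simp
qed

text \<open>An inequality because v is arbitrary: an observation outside \<open>{1..d}\<close> adds
  to none of these weights.\<close>

lemma sum_split_weight_le:
  assumes "1 \<le> d" "1 \<le> n2"
  shows "(\<Sum>k\<in>{1..d}. split_weight d n2 v k) \<le> 1"
proof -
  let ?m = "min n2 d"
  have "(\<Sum>k\<in>{1..d}. \<Sum>i = 1..?m. of_bool (v (n2 + i) = k) :: real)
      = (\<Sum>i = 1..?m. \<Sum>k\<in>{1..d}. of_bool (k = v (n2 + i)))"
    by (subst sum.swap) (simp only: eq_commute)
  also have "\<dots> \<le> (\<Sum>i = 1..?m. 1)"
    by (intro sum_mono) (simp add: of_bool_def)
  finally have c: "(\<Sum>k\<in>{1..d}. \<Sum>i = 1..?m. of_bool (v (n2 + i) = k) :: real) \<le> real ?m" by simp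
  have "(\<Sum>k\<in>{1..d}. split_weight d n2 v k)
      = 1 / 2 + 1 / (2 * real ?m) * (\<Sum>k\<in>{1..d}. \<Sum>i = 1..?m. of_bool (v (n2 + i) = k))"
    using assms unfolding split_weight_def Let_def by (simp only: sum.distrib sum_distrib_left[symmetric]) simp
  also have "\<dots> \<le> 1 / 2 + 1 / (2 * real ?m) * real ?m"
    by (intro add_left_mono mult_left_mono c) auto
  also have "\<dots> \<le> 1" using assms by simp
  finally show ?thesis .
qed

lemma l1_dist_square_le_separation:
  assumes "1 \<le> d" "1 \<le> n2"
  shows "(l1_dist d pY pZ)\<^sup>2 \<le> separation {1..d} (inverse_weight d n2 v) pY pZ"
proof -
  let ?w = "split_weight d n2 v" and ?\<Delta> = "\<lambda>k. pmf pY k - pmf pZ k"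
  have pos: "0 < ?w k" for k by (rule split_weight_pos[OF assms])
  have "l1_dist d pY pZ = (\<Sum>k\<in>{1..d}. sqrt (?w k) * (\<bar>?\<Delta> k\<bar> / sqrt (?w k)))"
    unfolding l1_dist_def using pos by (intro sum.cong refl) (simp add: less_imp_neq[symmetric])
  then have "(l1_dist d pY pZ)\<^sup>2 \<le> (\<Sum>k\<in>{1..d}. (sqrt (?w k))\<^sup>2) * (\<Sum>k\<in>{1..d}. (\<bar>?\<Delta> k\<bar> / sqrt (?w k))\<^sup>2)"
    by (simp only: Cauchy_Schwarz_ineq_sum)
  also have "\<dots> = (\<Sum>k\<in>{1..d}. ?w k) * separation {1..d} (inverse_weight d n2 v) pY pZ"
  proof -
    have "(sqrt (?w k))\<^sup>2 = ?w k" "(\<bar>?\<Delta> k\<bar> / sqrt (?w k))\<^sup>2 = inverse (?w k) * (?\<Delta> k)\<^sup>2" for k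
      using pos[of k] by (simp_all add: power_divide field_simps)
    then show ?thesis by (simp add: separation_def inverse_weight_def)
  qed
  also have "\<dots> \<le> 1 * separation {1..d} (inverse_weight d n2 v) pY pZ"
    unfolding separation_def using inverse_weight_nonneg[OF assms]
    by (intro mult_right_mono sum_split_weight_le[OF assms] sum_nonneg) auto
  finally show ?thesis by simp
qed

text \<open>The weights follow pZ only, so pY has to be eliminated: a^2 + b^2 <= 3 b^2 + 2 (a-b)^2
  is (a-2b)^2 >= 0 rearranged. In the difference part one of the two inverse weights is bounded by
  2d, and the other one leaves the separation.\<close>

lemma square_mass_le:
  assumes "1 \<le> d" "1 \<le> n2"
  shows "square_mass {1..d} (inverse_weight d n2 v) pY pZ
    \<le> 3 * (\<Sum>k\<in>{1..d}. (inverse_weight d n2 v k)\<^sup>2 * (pmf pZ k)\<^sup>2)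
      + 4 * real d * separation {1..d} (inverse_weight d n2 v) pY pZ"
proof -
  let ?W = "inverse_weight d n2 v"
  have "square_mass {1..d} ?W pY pZ
      \<le> (\<Sum>k\<in>{1..d}. 3 * ((?W k)\<^sup>2 * (pmf pZ k)\<^sup>2) + 4 * real d * (?W k * (pmf pY k - pmf pZ k)\<^sup>2))"
    unfolding square_mass_def
  proof (rule sum_mono)
    fix k
    let ?a = "pmf pY k" and ?b = "pmf pZ k"
    have "0 \<le> (?a - 2 * ?b)\<^sup>2" by simp
    then have "?a\<^sup>2 + ?b\<^sup>2 \<le> 3 * ?b\<^sup>2 + 2 * (?a - ?b)\<^sup>2"
      by (simp add: power2_eq_square algebra_simps)
    then have "(?W k)\<^sup>2 * (?a\<^sup>2 + ?b\<^sup>2) \<le> (?W k)\<^sup>2 * (3 * ?b\<^sup>2 + 2 * (?a - ?b)\<^sup>2)"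
      by (rule mult_left_mono) simp
    also have "\<dots> = 3 * ((?W k)\<^sup>2 * ?b\<^sup>2) + 2 * (?W k * (?W k * (?a - ?b)\<^sup>2))"
      by (simp add: power2_eq_square algebra_simps)
    also have "?W k * (?W k * (?a - ?b)\<^sup>2) \<le> 2 * real d * (?W k * (?a - ?b)\<^sup>2)"
      using inverse_weight_le'[OF assms] inverse_weight_nonneg[OF assms]
      by (intro mult_right_mono mult_nonneg_nonneg) auto
    finally show "(?W k)\<^sup>2 * (?a\<^sup>2 + ?b\<^sup>2) \<le> 3 * ((?W k)\<^sup>2 * ?b\<^sup>2) + 4 * real d * (?W k * (?a - ?b)\<^sup>2)"
      by simp
  qed
  then show ?thesis
    by (simp only: sum.distrib sum_distrib_left[symmetric] separation_def)
qed

text \<open>Of the two factors 1/(1 + count) in the squared inverse weight one is bounded by 1. The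
  mean of the other, times one factor \<open>pmf pZ k\<close>, is at most
  \<open>1 / real (min n2 d)\<close>; the second factor \<open>pmf pZ k\<close> then sums to
  1.\<close>

lemma expectation_inverse_weight:
  assumes "1 \<le> d" "1 \<le> n2" and pZ: "set_pmf pZ \<subseteq> {1..d}"
  shows "measure_pmf.expectation (Pi_pmf {n2+1..2*n2} 0 (\<lambda>_. pZ))
      (\<lambda>v. \<Sum>k\<in>{1..d}. (inverse_weight d n2 v k)\<^sup>2 * (pmf pZ k)\<^sup>2) \<le> 4 * (real d)\<^sup>2 / real (min n2 d)"
proof -
  let ?V = "Pi_pmf {n2+1..2*n2} 0 (\<lambda>_. pZ)" and ?J = "{n2+1..n2+min n2 d}"
  let ?R = "\<lambda>k v. 1 / (1 + (\<Sum>i\<in>?J. of_bool (v i = k))) :: real"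
  have finZ: "finite (set_pmf pZ)" using pZ by (rule finite_subset) simp
  have fin: "finite (set_pmf ?V)" using finZ by (intro finite_set_Pi_pmf) auto
  have share: "pmf pZ k * measure_pmf.expectation ?V (?R k) \<le> 1 / real (min n2 d)" for k
  proof -
    have "Pi_pmf ?J 0 (\<lambda>_. pZ) = map_pmf (\<lambda>v i. if i \<in> ?J then v i else 0) ?V"
      by (rule Pi_pmf_subset) auto
    then have "measure_pmf.expectation (Pi_pmf ?J 0 (\<lambda>_. pZ)) (?R k)
        = measure_pmf.expectation ?V (\<lambda>v. ?R k (\<lambda>i. if i \<in> ?J then v i else 0))"
      by (simp only: integral_map_pmf)
    also have "\<dots> = measure_pmf.expectation ?V (?R k)"
      by (intro Bochner_Integration.integral_cong refl arg_cong[where f = "\<lambda>s. 1 / (1 + s)"] sum.cong) simp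
    finally have "pmf pZ k * measure_pmf.expectation ?V (?R k) \<le> 1 / (real (card ?J) + 1)"
      using expectation_reciprocal_count[of ?J pZ k 0] finZ by simp
    also have "\<dots> \<le> 1 / real (min n2 d)" using assms by (intro divide_left_mono) auto
    finally show ?thesis .
  qed
  have "measure_pmf.expectation ?V (\<lambda>v. \<Sum>k\<in>{1..d}. (inverse_weight d n2 v k)\<^sup>2 * (pmf pZ k)\<^sup>2)
      \<le> measure_pmf.expectation ?V (\<lambda>v. \<Sum>k\<in>{1..d}. 4 * (real d)\<^sup>2 * (pmf pZ k)\<^sup>2 * ?R k v)"
  proof (rule expectation_mono_finite[OF fin], rule sum_mono)
    fix v :: "nat \<Rightarrow> nat" and k
    let ?s = "1 + (\<Sum>i\<in>?J. of_bool (v i = k)) :: real"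
    have s: "1 \<le> ?s" by (simp add: sum_nonneg)
    have "(inverse_weight d n2 v k)\<^sup>2 \<le> (2 * real d / ?s)\<^sup>2"
      using inverse_weight_le[OF assms(1,2)] inverse_weight_nonneg[OF assms(1,2)] by (intro power_mono) auto
    also have "\<dots> = 4 * (real d)\<^sup>2 * (1 / ?s\<^sup>2)" by (simp add: power_divide power_mult_distrib)
    also have "\<dots> \<le> 4 * (real d)\<^sup>2 * (1 / ?s)"
    proof (intro mult_left_mono divide_left_mono)
      show "?s \<le> ?s\<^sup>2" using mult_left_mono[OF s, of ?s] s by (simp add: power2_eq_square)
    qed (use s in auto)
    finally have "(inverse_weight d n2 v k)\<^sup>2 * (pmf pZ k)\<^sup>2 \<le> 4 * (real d)\<^sup>2 * (1 / ?s) * (pmf pZ k)\<^sup>2"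
      by (rule mult_right_mono) simp
    then show "(inverse_weight d n2 v k)\<^sup>2 * (pmf pZ k)\<^sup>2 \<le> 4 * (real d)\<^sup>2 * (pmf pZ k)\<^sup>2 * ?R k v"
      by (simp only: mult_ac)
  qed
  also have "\<dots> = (\<Sum>k\<in>{1..d}. 4 * (real d)\<^sup>2 * (pmf pZ k)\<^sup>2 * measure_pmf.expectation ?V (?R k))"
    by (subst Bochner_Integration.integral_sum)
      (simp_all only: integral_mult_right_zero integrable_measure_pmf_finite[OF fin])
  also have "\<dots> = (\<Sum>k\<in>{1..d}. 4 * (real d)\<^sup>2 * pmf pZ k * (pmf pZ k * measure_pmf.expectation ?V (?R k)))"
    by (simp only: power2_eq_square[of "pmf _ _"] mult.assoc)
  also have "\<dots> \<le> (\<Sum>k\<in>{1..d}. 4 * (real d)\<^sup>2 * pmf pZ k * (1 / real (min n2 d)))"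
    by (intro sum_mono mult_left_mono share) auto
  also have "\<dots> = 4 * (real d)\<^sup>2 / real (min n2 d) * (\<Sum>k\<in>{1..d}. pmf pZ k)"
    by (simp add: sum_distrib_left)
  also have "(\<Sum>k\<in>{1..d}. pmf pZ k) = 1"
    using pZ by (intro sum_pmf_eq_1) auto
  finally show ?thesis by simp
qed

section \<open>Averaging over the weights and fixing the radius\<close>

lemma l1_dist_le_2:
  assumes "set_pmf pY \<subseteq> {1..d}" "set_pmf pZ \<subseteq> {1..d}"
  shows "l1_dist d pY pZ \<le> 2"
proof -
  have "l1_dist d pY pZ \<le> (\<Sum>k = 1..d. pmf pY k + pmf pZ k)"
    unfolding l1_dist_def
  proof (rule sum_mono)
    fix k
    show "\<bar>pmf pY k - pmf pZ k\<bar> \<le> pmf pY k + pmf pZ k"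
      using pmf_nonneg[of pY k] pmf_nonneg[of pZ k] by linarith
  qed
  also have "\<dots> = 2"
    using sum_pmf_eq_1[OF _ assms(1)] sum_pmf_eq_1[OF _ assms(2)] by (simp add: sum.distrib)
  finally show ?thesis .
qed

text \<open>The split of the square mass by \<open>square_mass_le\<close> cancels one power of the
  separation in the second summand. Both summands then decrease in the separation, which can be
  replaced by its deterministic lower bound e. Only the sum of squared inverse weights against pZ
  stays random, and its mean bound turns the coefficient 3 into 12.\<close>

lemma type_II_error:
  fixes \<alpha> \<beta> :: real and d n1 n2 :: nat and pY pZ :: "nat pmf"
  defines "L \<equiv> ln (1 / \<alpha>)" and "e \<equiv> (l1_dist d pY pZ)\<^sup>2"
  assumes d: "1 \<le> d" and n1: "2 \<le> n1" "n1 \<le> n2"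
    and \<alpha>: "0 < \<alpha>" "\<alpha> < exp (-1)" and \<beta>: "0 < \<beta>" "\<beta> < 1"
    and pY: "set_pmf pY \<subseteq> {1..d}" and pZ: "set_pmf pZ \<subseteq> {1..d}" and e: "0 < e"
    and budget: "19000 * L\<^sup>2 / \<beta> * (12 * ((real d)\<^sup>2 / (real (min n2 d) * (real n1)\<^sup>2)) / e\<^sup>2
      + 4 * (real d / (real n1)\<^sup>2) / e) \<le> \<beta> / 2"
  shows "emeasure (measure_pmf (data_pmf n1 n2 (pY, pZ)))
    {(y, z). U_split d n1 n2 y z \<le> crit_value d n1 n2 \<alpha> y z} \<le> ennreal \<beta>"
proof -
  let ?g = "\<lambda>v. g_kernel d (split_weight d n2 v)" and ?W = "inverse_weight d n2"
  let ?E = "{(v, x). two_sample n1 (?g v) x \<le> pmf_quantile (1 - \<alpha>) (perm_law n1 (?g v) x)}"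
  let ?X = "Pi_pmf {1..2*n1} 0 (sample_law n1 pY pZ)" and ?V = "Pi_pmf {n2+1..2*n2} 0 (\<lambda>_. pZ)"
  let ?B = "\<lambda>v. \<Sum>k\<in>{1..d}. (?W v k)\<^sup>2 * (pmf pZ k)\<^sup>2"
  let ?c = "19000 * L\<^sup>2 / \<beta>" and ?n = "(real n1)\<^sup>2"
  let ?h = "\<lambda>v. \<beta> / 2 + ?c * (3 / (?n * e\<^sup>2) * ?B v + 4 * (real d / ?n) / e)"
  have n2: "1 \<le> n2" using n1 by simp
  have n0: "0 < ?n" using n1 by simp
  have c: "0 \<le> ?c" using \<beta> by simp
  have "finite (set_pmf pZ)" using pZ by (rule finite_subset) simp
  then have fin: "finite (set_pmf ?V)" by (intro finite_set_Pi_pmf) auto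
  have B: "0 \<le> ?B v" for v by (intro sum_nonneg) auto
  have cond: "measure_pmf.prob ?X (Pair v -` ?E) \<le> ?h v" for v
  proof -
    interpret two_sample_model n1 "{1..d}" pY pZ "?W v" "0::nat"
      by unfold_locales (use n1 pY pZ inverse_weight_nonneg[OF d n2] in auto)
    let ?\<delta> = "separation {1..d} (?W v) pY pZ" and ?M = "square_mass {1..d} (?W v) pY pZ"
    have \<delta>: "e \<le> ?\<delta>" unfolding e_def by (rule l1_dist_square_le_separation[OF d n2])
    then have \<delta>0: "0 < ?\<delta>" using e by linarith
    have "Pair v -` ?E = {x. two_sample n1 (diag_kernel (?W v)) x \<le> pmf_quantile (1 - \<alpha>) (perm_law n1 (diag_kernel (?W v)) x)}"
      by (auto simp: g_kernel_split_weight)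
    then have "measure_pmf.prob ?X (Pair v -` ?E) \<le> \<beta> / 2 + ?c * (?M / (?n * ?\<delta>\<^sup>2))"
      using type_II_given_weights[OF \<alpha> \<beta> \<delta>0] by (simp only: L_def)
    also have "\<dots> \<le> ?h v"
    proof (intro add_left_mono mult_left_mono c)
      have "?M / (?n * ?\<delta>\<^sup>2) \<le> (3 * ?B v + 4 * real d * ?\<delta>) / (?n * ?\<delta>\<^sup>2)"
        by (intro divide_right_mono square_mass_le[OF d n2]) simp
      also have "\<dots> = 3 * ?B v / (?n * ?\<delta>\<^sup>2) + 4 * (real d / ?n) / ?\<delta>"
        using \<delta>0 by (simp add: add_divide_distrib power2_eq_square)
      also have "\<dots> \<le> 3 * ?B v / (?n * e\<^sup>2) + 4 * (real d / ?n) / e"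
      proof (intro add_mono divide_left_mono)
        show "?n * e\<^sup>2 \<le> ?n * ?\<delta>\<^sup>2" using \<delta> e by (intro mult_left_mono power_mono) auto
      qed (use \<delta> e \<delta>0 n0 B[of v] in auto)
      finally show "?M / (?n * ?\<delta>\<^sup>2) \<le> 3 / (?n * e\<^sup>2) * ?B v + 4 * (real d / ?n) / e" by simp
    qed
    finally show ?thesis .
  qed
  have h0: "0 \<le> ?h v" for v using order_trans[OF measure_nonneg cond] .
  have Eh: "measure_pmf.expectation ?V ?h \<le> \<beta>"
  proof -
    have "measure_pmf.expectation ?V ?h
        = \<beta> / 2 + ?c * (3 / (?n * e\<^sup>2) * measure_pmf.expectation ?V ?B + 4 * (real d / ?n) / e)"
      by (rule expectation_affine[OF fin])
    also have "\<dots> \<le> \<beta> / 2 + ?c * (3 / (?n * e\<^sup>2) * (4 * (real d)\<^sup>2 / real (min n2 d)) + 4 * (real d / ?n) / e)"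
      using expectation_inverse_weight[OF d n2 pZ] n0
      by (intro add_left_mono mult_left_mono add_right_mono c) auto
    also have "3 / (?n * e\<^sup>2) * (4 * (real d)\<^sup>2 / real (min n2 d))
        = 12 * ((real d)\<^sup>2 / (real (min n2 d) * ?n)) / e\<^sup>2" by (simp add: mult_ac)
    finally show ?thesis using budget by linarith
  qed
  have "{(y, z). U_split d n1 n2 y z \<le> crit_value d n1 n2 \<alpha> y z}
      = (\<lambda>(y, z). (weight_part n2 z, pooled_part n1 y z)) -` ?E"
    using n1 by (auto simp: U_split_eq crit_value_eq)
  then have "emeasure (measure_pmf (data_pmf n1 n2 (pY, pZ))) {(y, z). U_split d n1 n2 y z \<le> crit_value d n1 n2 \<alpha> y z}
      = emeasure (measure_pmf (map_pmf (\<lambda>(y, z). (weight_part n2 z, pooled_part n1 y z)) (data_pmf n1 n2 (pY, pZ)))) ?E"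
    by simp
  also have "\<dots> = emeasure (measure_pmf (pair_pmf ?V ?X)) ?E"
    by (simp only: map_pmf_data_pmf[OF n1(2)])
  also have "\<dots> = (\<integral>\<^sup>+v. emeasure (measure_pmf ?X) (Pair v -` ?E) \<partial>?V)"
    by (rule emeasure_pair_pmf)
  also have "\<dots> \<le> (\<integral>\<^sup>+v. ennreal (?h v) \<partial>?V)"
    unfolding measure_pmf.emeasure_eq_measure by (intro nn_integral_mono ennreal_leI cond)
  also have "\<dots> = ennreal (measure_pmf.expectation ?V ?h)"
    by (intro nn_integral_eq_integral integrable_measure_pmf_finite[OF fin] AE_I2 h0)
  also have "\<dots> \<le> ennreal \<beta>" by (rule ennreal_leI[OF Eh])
  finally show ?thesis .
qed

text \<open>The fourth powers of the two terms of the maximum are d^2/(n1^2 n2) and d/n1^2, and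
  d^2/(min(n2, d) n1^2) is one of them in either case. The summand with 1/l^2 is brought to the form
  1/l^4 by l^2 <= 4, which gives 12 + 4 * 4 = 28 and the numerator 19000 * 28 = 532000.\<close>

lemma separation_budget:
  fixes \<beta> L l :: real
  assumes d: "1 \<le> d" and n1: "2 \<le> n1" "n1 \<le> n2" and \<beta>: "0 < \<beta>" "\<beta> < 1" and L: "1 < L" and l2: "l \<le> 2"
    and l: "l \<ge> 100 / \<beta> powr (3/4) * sqrt L *
      max (real d powr (1/2) / (real n1 powr (1/2) * real n2 powr (1/4)))
        (real d powr (1/4) / real n1 powr (1/2))"
  shows "0 < l\<^sup>2"
    and "19000 * L\<^sup>2 / \<beta> * (12 * ((real d)\<^sup>2 / (real (min n2 d) * (real n1)\<^sup>2)) / (l\<^sup>2)\<^sup>2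
      + 4 * (real d / (real n1)\<^sup>2) / l\<^sup>2) \<le> \<beta> / 2"
proof -
  let ?a = "real d powr (1/2) / (real n1 powr (1/2) * real n2 powr (1/4))"
  let ?b = "real d powr (1/4) / real n1 powr (1/2)"
  let ?Q = "max ?a ?b"
  have pos: "0 < real d" "0 < real n1" "0 < real n2" using d n1 by auto
  have Q: "0 < ?Q" using pos by (simp add: less_max_iff_disj)
  have half: "(x powr (1/2)) ^ 4 = x\<^sup>2" and quarter: "(x powr (1/4)) ^ 4 = x" and three: "(x powr (3/4)) ^ 4 = x ^ 3"
    if "0 < x" for x :: real
    using that by (simp_all add: powr_power)
  have a4: "?a ^ 4 = (real d)\<^sup>2 / ((real n1)\<^sup>2 * real n2)"
    by (simp only: power_divide power_mult_distrib half quarter pos)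
  have b4: "?b ^ 4 = real d / (real n1)\<^sup>2"
    by (simp only: power_divide half quarter pos)
  have X: "0 < 100 / \<beta> powr (3/4) * sqrt L * ?Q"
    using \<beta> L Q by (intro mult_pos_pos divide_pos_pos) auto
  then have l0: "0 < l" using l by linarith
  then show e0: "0 < l\<^sup>2" by simp
  have sL: "sqrt L ^ 4 = L\<^sup>2"
  proof -
    have "sqrt L ^ 4 = ((sqrt L)\<^sup>2)\<^sup>2" by (simp only: power_mult[symmetric]) simp
    then show ?thesis using L by simp
  qed
  have "(100 / \<beta> powr (3/4) * sqrt L * ?Q) ^ 4 \<le> l ^ 4"
    using l X by (intro power_mono) auto
  then have "(100 / \<beta> powr (3/4)) ^ 4 * sqrt L ^ 4 * ?Q ^ 4 \<le> (l\<^sup>2)\<^sup>2"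
    by (simp only: power_mult_distrib) simp
  then have "100 ^ 4 / \<beta> ^ 3 * L\<^sup>2 * ?Q ^ 4 \<le> (l\<^sup>2)\<^sup>2"
    by (simp only: power_divide three[OF \<beta>(1)] sL)
  then have "100 ^ 4 * L\<^sup>2 * ?Q ^ 4 \<le> \<beta> ^ 3 * (l\<^sup>2)\<^sup>2"
    using \<beta> by (simp add: divide_le_eq mult_ac)
  then have Q4: "100 ^ 4 * L\<^sup>2 * (?Q ^ 4 / (l\<^sup>2)\<^sup>2) \<le> \<beta> ^ 3"
    using l0 by (simp add: divide_le_eq)
  have aQ: "?a ^ 4 \<le> ?Q ^ 4" "?b ^ 4 \<le> ?Q ^ 4"
    by (intro power_mono; simp)+
  have "(real d)\<^sup>2 / (real (min n2 d) * (real n1)\<^sup>2) \<le> ?Q ^ 4"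
  proof (cases "n2 \<le> d")
    case True
    then show ?thesis using aQ(1) unfolding a4 by (simp add: mult.commute)
  next
    case False
    then have "(real d)\<^sup>2 / (real (min n2 d) * (real n1)\<^sup>2) = real d / (real n1)\<^sup>2"
      using pos by (simp add: power2_eq_square)
    then show ?thesis using aQ(2) unfolding b4 by simp
  qed
  then have t1: "12 * ((real d)\<^sup>2 / (real (min n2 d) * (real n1)\<^sup>2)) / (l\<^sup>2)\<^sup>2 \<le> 12 * ?Q ^ 4 / (l\<^sup>2)\<^sup>2"
    by (intro divide_right_mono mult_left_mono) auto
  have "4 * (real d / (real n1)\<^sup>2) / l\<^sup>2 \<le> 4 * ?Q ^ 4 / l\<^sup>2"
    using aQ(2) unfolding b4 by (intro divide_right_mono mult_left_mono) auto
  also have "\<dots> = 4 * l\<^sup>2 * ?Q ^ 4 / (l\<^sup>2)\<^sup>2" using l0 by (simp add: power2_eq_square)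
  also have "\<dots> \<le> 16 * ?Q ^ 4 / (l\<^sup>2)\<^sup>2"
  proof -
    have "l\<^sup>2 \<le> 2\<^sup>2" using l2 l0 by (intro power_mono) auto
    then show ?thesis using Q by (intro divide_right_mono mult_right_mono) auto
  qed
  finally have "12 * ((real d)\<^sup>2 / (real (min n2 d) * (real n1)\<^sup>2)) / (l\<^sup>2)\<^sup>2 + 4 * (real d / (real n1)\<^sup>2) / l\<^sup>2
      \<le> 28 * (?Q ^ 4 / (l\<^sup>2)\<^sup>2)"
    using t1 by (simp add: add_divide_distrib[symmetric])
  then have "19000 * L\<^sup>2 / \<beta> * (12 * ((real d)\<^sup>2 / (real (min n2 d) * (real n1)\<^sup>2)) / (l\<^sup>2)\<^sup>2
      + 4 * (real d / (real n1)\<^sup>2) / l\<^sup>2) \<le> 19000 * L\<^sup>2 / \<beta> * (28 * (?Q ^ 4 / (l\<^sup>2)\<^sup>2))"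
    using \<beta> by (intro mult_left_mono) auto
  also have "\<dots> = 532000 / (100 ^ 4 * \<beta>) * (100 ^ 4 * L\<^sup>2 * (?Q ^ 4 / (l\<^sup>2)\<^sup>2))"
    by simp
  also have "\<dots> \<le> 532000 / (100 ^ 4 * \<beta>) * \<beta> ^ 3"
    using \<beta> by (intro mult_left_mono Q4) auto
  also have "\<dots> = 532000 / 100 ^ 4 * (\<beta> * \<beta>)"
    using \<beta> by (simp add: power3_eq_cube)
  also have "\<dots> \<le> 532000 / 100 ^ 4 * (\<beta> * 1)"
    using \<beta> by (intro mult_left_mono) auto
  also have "\<dots> \<le> \<beta> / 2" using \<beta> by simp
  finally show "19000 * L\<^sup>2 / \<beta> * (12 * ((real d)\<^sup>2 / (real (min n2 d) * (real n1)\<^sup>2)) / (l\<^sup>2)\<^sup>2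
      + 4 * (real d / (real n1)\<^sup>2) / l\<^sup>2) \<le> \<beta> / 2" .
qed

theorem proposition8p2:
  "\<exists>C > (0::real). \<forall>(d::nat) (n1::nat) (n2::nat) (\<alpha>::real) (\<beta>::real) (\<epsilon>::real).
     1 \<le> d \<longrightarrow> 2 \<le> n1 \<longrightarrow> n1 \<le> n2 \<longrightarrow>
     0 < \<alpha> \<longrightarrow> \<alpha> < exp (-1) \<longrightarrow> 0 < \<beta> \<longrightarrow> \<beta> < 1 - \<alpha> \<longrightarrow>
     \<epsilon> \<ge> C / \<beta> powr (3/4) * sqrt (ln (1 / \<alpha>)) *
         max (real d powr (1/2) / (real n1 powr (1/2) * real n2 powr (1/4)))
             (real d powr (1/4) / real n1 powr (1/2)) \<longrightarrow>
     (SUP P \<in> P_null d. emeasure (measure_pmf (data_pmf n1 n2 P))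
        {(y, z). U_split d n1 n2 y z > crit_value d n1 n2 \<alpha> y z}) \<le> ennreal \<alpha> \<and>
     (SUP P \<in> P_alt d \<epsilon>. emeasure (measure_pmf (data_pmf n1 n2 P))
        {(y, z). U_split d n1 n2 y z \<le> crit_value d n1 n2 \<alpha> y z}) \<le> ennreal \<beta>"
\<comment> \<open>The budget computation asks that the fourth power of C be at least 2 * 532000,
  which holds for 100.\<close>
proof (intro exI[of _ 100] conjI allI impI)
  show "0 < (100::real)" by simp
next
  fix d n1 n2 :: nat and \<alpha> \<beta> \<epsilon> :: real
  assume n1: "2 \<le> n1" "n1 \<le> n2" and \<alpha>: "0 < \<alpha>"
  show "(SUP P \<in> P_null d. emeasure (measure_pmf (data_pmf n1 n2 P))
        {(y, z). U_split d n1 n2 y z > crit_value d n1 n2 \<alpha> y z}) \<le> ennreal \<alpha>"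
    using type_I_error[OF n1] \<alpha> by (intro SUP_least) (auto simp: P_null_def)
next
  fix d n1 n2 :: nat and \<alpha> \<beta> \<epsilon> :: real
  assume d: "1 \<le> d" and n1: "2 \<le> n1" "n1 \<le> n2" and \<alpha>: "0 < \<alpha>" "\<alpha> < exp (-1)"
    and \<beta>: "0 < \<beta>" "\<beta> < 1 - \<alpha>"
    and \<epsilon>: "\<epsilon> \<ge> 100 / \<beta> powr (3/4) * sqrt (ln (1 / \<alpha>)) *
         max (real d powr (1/2) / (real n1 powr (1/2) * real n2 powr (1/4)))
             (real d powr (1/4) / real n1 powr (1/2))"
  have \<beta>1: "\<beta> < 1" using \<alpha> \<beta> by linarith
  note L = one_less_ln_reciprocal[OF \<alpha>]
  show "(SUP P \<in> P_alt d \<epsilon>. emeasure (measure_pmf (data_pmf n1 n2 P))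
        {(y, z). U_split d n1 n2 y z \<le> crit_value d n1 n2 \<alpha> y z}) \<le> ennreal \<beta>"
  proof (rule SUP_least)
    fix P assume "P \<in> P_alt d \<epsilon>"
    then obtain pY pZ where P: "P = (pY, pZ)" "set_pmf pY \<subseteq> {1..d}" "set_pmf pZ \<subseteq> {1..d}"
      and l: "\<epsilon> \<le> l1_dist d pY pZ"
      unfolding P_alt_def P_Multi_def by blast
    show "emeasure (measure_pmf (data_pmf n1 n2 P))
        {(y, z). U_split d n1 n2 y z \<le> crit_value d n1 n2 \<alpha> y z} \<le> ennreal \<beta>"
      unfolding P(1) using separation_budget[OF d n1 \<beta>(1) \<beta>1 L l1_dist_le_2[OF P(2,3)] order_trans[OF \<epsilon> l]]
      by (intro type_II_error d n1 \<alpha> \<beta>(1) \<beta>1 P(2,3))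
  qed
qed
end
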